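(* Let $T>0$, $0<\varepsilon\le1$, and consider a uniform partition $t_j=j\tau$, $j=0,\dots,n$, $\tau=T/n$. Let $f,g\in H^1(0,T;L^2(\mathcal E))$, $h\in H^2(0,T;\mathbb R^{n_D})$, $r\in H^2(0,T;\mathbb R^{n_N})$. Let $p(0)\in H^1(\bar{\mathcal E})$ with $\mathcal Bp(0)=h(0)$, $m(0)\in L^2(\mathcal E)$, and assume there are $m_*,p_*\in L^2(\mathcal E)$ such that for all $q\in H^1_0(\bar{\mathcal E})$ $$(m_*,q)=\langle\mathcal K^*m(0),q\rangle-\langle\mathcal C^*r(0),q\rangle,$$ $$(p_*,q)=\big\langle g(0)-\mathcal C^*r(0)-(\mathcal L+a)p(0)-\mathcal B^-\dot h(0)+\mathcal K^*d^{-1}f(0),\,q\big\rangle.$$ Assume $m(0)=m_0(0):=d^{-1}(f(0)-\mathcal Kp(0))$. Let $(p,m,\lambda)$ be the solution of the hyperbolic system $(H_\varepsilon)$ with initial values $p(0),m(0)$. Let $p_{0,j},m_{0,j},\lambda_{0,j},\mu_{0,j}$ be defined by the implicit Euler scheme (E) of the context (which does not involve $\varepsilon$), with right-hand sides given by function evaluations at $t_j$. Let $\overline p_{0,\tau},\overline m_{0,\tau}$ be the piecewise constant functions with values $p_{0,j},m_{0,j}$ on $(t_{j-1},t_j]$ and $p_{0,\tau}$ the continuous piecewise linear interpolant of $p_{0,j}$, $j=0,\dots,n$. Then $$\|p-\overline p_{0,\tau}\|_{L^2(0,T;H^1(\bar{\mathcal E}))}+\|m-\overline m_{0,\tau}\|_{L^2(0,T;L^2(\mathcal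 E))}+\|p-p_{0,\tau}\|_{C([0,T];L^2(\mathcal E))}\le(\varepsilon+\tau)\,C_{\rm data}$$ with a constant $C_{\rm data}$ depending only on the data (not on $\varepsilon$ or $\tau$).
   Context: Network: $\mathcal G=(\mathcal V,\mathcal E)$ is a finite connected directed graph whose edges are identified with bounded intervals of positive length. $\mathcal V$ is the disjoint union of $\mathcal V_D$ (boundary vertices where the potential is prescribed) and $\mathcal V_N$ (all other vertices); $n_D=|\mathcal V_D|\ge1$, $n_N=|\mathcal V_N|$, and vectors in $\mathbb R^{n_D},\mathbb R^{n_N}$ are indexed by these vertices. Spaces: $L^2(\mathcal E)$ = functions edgewise in $L^2(e)$, with inner product $(\cdot,\cdot)=\sum_e(\cdot,\cdot)_{L^2(e)}$ and norm $\|\cdot\|$. $H^1(\bar{\mathcal E})$ = functions edgewise in $H^1(e)$ that are globally continuous on the network (usual $H^1$ norm); $H^1_0(\bar{\mathcal E})$ = those vanishing at $\mathcal V_D$. $L^2(\mathcal E)$ is identified with its dual and embedded in $[H^1(\bar{\mathcal E})]^*$. Coefficients: measurable, time-independent $a,d$ on $\mathcal E$ with $0\le a\le\overline a$ and $0<\underline d\le d\le\overline d<\infty$ a.e. Operators: $\mathcal K:H^1(\bar{\mathcal E})\to[L^2(\mathcal E)]^*$, $\langle\mathcal Kq,m\rangle=(\partial_xq,m)$ (edgewise derivative); $\mathcal B:H^1(\bar{\mathcal E})\to\mathbb R^{n_D}$ and $\mathcal C:H^1(\bar{\mathcal E})\to\mathbb R^{n_N}$ are point evaluation at $\mathcal V_D$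 and $\mathcal V_N$; $\mathcal B^-:\mathbb R^{n_D}\to H^1(\bar{\mathcal E})$ is a fixed linear right inverse of $\mathcal B$; $\mathcal L=\mathcal K^*d^{-1}\mathcal K$. System $(H_\varepsilon)$: $\dot p+ap-\mathcal K^*m+\mathcal B^*\lambda=g-\mathcal C^*r$ in $[H^1(\bar{\mathcal E})]^*$; $\varepsilon\dot m+\mathcal Kp+dm=f$ in $[L^2(\mathcal E)]^*$; $\mathcal Bp=h$ in $\mathbb R^{n_D}$. Scheme (E): $M\in\mathbb R^{n_D\times n_D}$ is a fixed invertible matrix, $p_{0,0}=p(0)$, $D_\tau p_{0,j}=(p_{0,j}-p_{0,j-1})/\tau$, and for $j=1,\dots,n$ one seeks $(p_{0,j},m_{0,j},\lambda_{0,j},\mu_{0,j})\in H^1(\bar{\mathcal E})\times L^2(\mathcal E)\times\mathbb R^{n_D}\times\mathbb R^{n_D}$ with $D_\tau p_{0,j}+ap_{0,j}-\mathcal K^*m_{0,j}+\mathcal B^*\lambda_{0,j}+\mathcal B^*\mu_{0,j}=g(t_j)-\mathcal C^*r(t_j)$ in $[H^1(\bar{\mathcal E})]^*$; $\mathcal Kp_{0,j}+dm_{0,j}=f(t_j)$ in $[L^2(\mathcal E)]^*$; $\mathcal Bp_{0,j}-M\mu_{0,j}=h(t_j)$; $\mathcal BD_\tau p_{0,j}=\dot h(t_j)$ in $\mathbb R^{n_D}$. "Data" means $f,g,h,r$, the initial values, $m_*,p_*$, together with the fixed quantities $T$, network, $a$, $d$, $M$. *)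

theory Defs
  imports "HOL-Analysis.Analysis" "Graph_Theory.Digraph_Component"
begin

text \<open>
  Edge \<open>e\<close> is identified with the interval \<open>{0..len e}\<close>, where \<open>0\<close> is the tail and \<open>len e\<close> the
  head of \<open>e\<close>. A function on the edges is a representative \<open>u :: 'e \<Rightarrow> real \<Rightarrow> real\<close>; only its values
  \<open>u e x\<close> with \<open>e \<in> arcs G\<close> and \<open>x \<in> {0..len e}\<close> matter. Loops and parallel edges are not excluded.
  Vectors indexed by a set \<open>S\<close> of vertices are functions \<open>'v \<Rightarrow> real\<close> of which only the values on
  \<open>S\<close> matter; \<open>V\<^sub>D\<close> is \<open>VD\<close> and \<open>V\<^sub>N\<close> is \<open>verts G - VD\<close>.
\<close>

type_synonym 'e edge_fun = "'e \<Rightarrow> real \<Rightarrow> real"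

locale network = fin_digraph G for G :: "('v, 'e) pre_digraph" +
  fixes len :: "'e \<Rightarrow> real" and VD :: "'v set"
  assumes connected_G: "Digraph_Component.connected G"
    and len_pos: "e \<in> arcs G \<Longrightarrow> 0 < len e"
    and VD_subset: "VD \<subseteq> verts G"
    and VD_nonempty: "VD \<noteq> {}"


section \<open>Sobolev spaces on an interval\<close>

definition L2_on :: "real \<Rightarrow> (real \<Rightarrow> real) \<Rightarrow> bool" where
  "L2_on l u \<longleftrightarrow> u \<in> borel_measurable (lebesgue_on {0..l}) \<and>
     integrable (lebesgue_on {0..l}) (\<lambda>x. (u x)\<^sup>2)"

text \<open>
  The functions of \<open>H\<^sup>1(0,l)\<close> are taken in their continuous representative on \<open>{0..l}\<close>, which is
  the indefinite integral of the square integrable weak derivative \<open>w\<close>.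
\<close>

definition has_sobolev_deriv :: "real \<Rightarrow> (real \<Rightarrow> real) \<Rightarrow> (real \<Rightarrow> real) \<Rightarrow> bool" where
  "has_sobolev_deriv l q w \<longleftrightarrow> L2_on l w \<and>
     (\<forall>x\<in>{0..l}. q x = q 0 + (LINT y|lebesgue_on {0..x}. w y))"

definition H1_on :: "real \<Rightarrow> (real \<Rightarrow> real) \<Rightarrow> bool" where
  "H1_on l q \<longleftrightarrow> (\<exists>w. has_sobolev_deriv l q w)"

definition H2_on :: "real \<Rightarrow> (real \<Rightarrow> real) \<Rightarrow> bool" where
  "H2_on l q \<longleftrightarrow> (\<exists>q'. (\<forall>x\<in>{0..l}. (q has_real_derivative q' x) (at x within {0..l})) \<and> H1_on l q')"


section \<open>Spaces on the network\<close>

definition ae_eq :: "('v, 'e) pre_digraph \<Rightarrow> ('e \<Rightarrow> real) \<Rightarrow> 'e edge_fun \<Rightarrow> 'e edge_fun \<Rightarrow> bool" where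
  "ae_eq G len u w \<longleftrightarrow> (\<forall>e\<in>arcs G. AE x in lebesgue_on {0..len e}. u e x = w e x)"

definition L2_net :: "('v, 'e) pre_digraph \<Rightarrow> ('e \<Rightarrow> real) \<Rightarrow> 'e edge_fun set" where
  "L2_net G len = {u. \<forall>e\<in>arcs G. L2_on (len e) (u e)}"

definition inner_L2 :: "('v, 'e) pre_digraph \<Rightarrow> ('e \<Rightarrow> real) \<Rightarrow> 'e edge_fun \<Rightarrow> 'e edge_fun \<Rightarrow> real" where
  "inner_L2 G len u w = (\<Sum>e\<in>arcs G. LINT x|lebesgue_on {0..len e}. u e x * w e x)"

definition norm_L2 :: "('v, 'e) pre_digraph \<Rightarrow> ('e \<Rightarrow> real) \<Rightarrow> 'e edge_fun \<Rightarrow> real" where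
  "norm_L2 G len u = sqrt (inner_L2 G len u u)"

text \<open>The edgewise weak derivative; it is determined up to null sets.\<close>

definition dx :: "('e \<Rightarrow> real) \<Rightarrow> 'e edge_fun \<Rightarrow> 'e edge_fun" where
  "dx len q = (\<lambda>e. SOME w. has_sobolev_deriv (len e) (q e) w)"

text \<open>
  Continuity on the network means that at every vertex the boundary values of all incident edges
  agree (with the value \<open>\<phi>\<close> there).
\<close>

definition H1_net :: "('v, 'e) pre_digraph \<Rightarrow> ('e \<Rightarrow> real) \<Rightarrow> 'e edge_fun set" where
  "H1_net G len = {q. (\<forall>e\<in>arcs G. H1_on (len e) (q e)) \<and>
     (\<exists>\<phi>. \<forall>e\<in>arcs G. q e 0 = \<phi> (tail G e) \<and> q e (len e) = \<phi> (head G e))}"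

definition norm_H1 :: "('v, 'e) pre_digraph \<Rightarrow> ('e \<Rightarrow> real) \<Rightarrow> 'e edge_fun \<Rightarrow> real" where
  "norm_H1 G len q = sqrt ((norm_L2 G len q)\<^sup>2 + (norm_L2 G len (dx len q))\<^sup>2)"

definition vertex_val :: "('v, 'e) pre_digraph \<Rightarrow> ('e \<Rightarrow> real) \<Rightarrow> 'e edge_fun \<Rightarrow> 'v \<Rightarrow> real" where
  "vertex_val G len q v = (THE c. \<forall>e\<in>arcs G.
     (tail G e = v \<longrightarrow> q e 0 = c) \<and> (head G e = v \<longrightarrow> q e (len e) = c))"

definition H10_net :: "('v, 'e) pre_digraph \<Rightarrow> ('e \<Rightarrow> real) \<Rightarrow> 'v set \<Rightarrow> 'e edge_fun set" where
  "H10_net G len VD = {q \<in> H1_net G len. \<forall>v\<in>VD. vertex_val G len q v = 0}"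


section \<open>Operators\<close>

text \<open>Elements of dual spaces are given by their action on edge functions.\<close>

definition K_op :: "('v, 'e) pre_digraph \<Rightarrow> ('e \<Rightarrow> real) \<Rightarrow> 'e edge_fun \<Rightarrow> 'e edge_fun \<Rightarrow> real" where
  "K_op G len q m = inner_L2 G len (dx len q) m"

definition K_adj :: "('v, 'e) pre_digraph \<Rightarrow> ('e \<Rightarrow> real) \<Rightarrow> 'e edge_fun \<Rightarrow> 'e edge_fun \<Rightarrow> real" where
  "K_adj G len m q = K_op G len q m"

text \<open>
  The adjoint of point evaluation at the vertices in \<open>S\<close>: \<open>\<B>\<^sup>*\<close> is \<open>S = VD\<close>
  and \<open>\<C>\<^sup>*\<close> is \<open>S = verts G - VD\<close>.
\<close>

definition eval_adj ::
  "('v, 'e) pre_digraph \<Rightarrow> ('e \<Rightarrow> real) \<Rightarrow> 'v set \<Rightarrow> ('v \<Rightarrow> real) \<Rightarrow> 'e edge_fun \<Rightarrow> real" where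
  "eval_adj G len S y q = (\<Sum>v\<in>S. y v * vertex_val G len q v)"

definition L_op ::
  "('v, 'e) pre_digraph \<Rightarrow> ('e \<Rightarrow> real) \<Rightarrow> 'e edge_fun \<Rightarrow> 'e edge_fun \<Rightarrow> 'e edge_fun \<Rightarrow> real" where
  "L_op G len d p q = K_adj G len (\<lambda>e x. dx len p e x / d e x) q"

definition linear_right_inverse ::
  "('v, 'e) pre_digraph \<Rightarrow> ('e \<Rightarrow> real) \<Rightarrow> 'v set \<Rightarrow> (('v \<Rightarrow> real) \<Rightarrow> 'e edge_fun) \<Rightarrow> bool" where
  "linear_right_inverse G len VD R \<longleftrightarrow>
     (\<forall>y. R y \<in> H1_net G len \<and> (\<forall>v\<in>VD. vertex_val G len (R y) v = y v)) \<and>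
     (\<forall>y z. (\<forall>v\<in>VD. y v = z v) \<longrightarrow> ae_eq G len (R y) (R z)) \<and>
     (\<forall>\<alpha> \<beta> y z. ae_eq G len (R (\<lambda>v. \<alpha> * y v + \<beta> * z v)) (\<lambda>e x. \<alpha> * R y e x + \<beta> * R z e x))"

definition mat_vec :: "'v set \<Rightarrow> ('v \<Rightarrow> 'v \<Rightarrow> real) \<Rightarrow> ('v \<Rightarrow> real) \<Rightarrow> 'v \<Rightarrow> real" where
  "mat_vec S M y v = (\<Sum>w\<in>S. M v w * y w)"

definition invertible_on :: "'v set \<Rightarrow> ('v \<Rightarrow> 'v \<Rightarrow> real) \<Rightarrow> bool" where
  "invertible_on S M \<longleftrightarrow> (\<exists>N. \<forall>u\<in>S. \<forall>v\<in>S.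
     (\<Sum>w\<in>S. M u w * N w v) = (if u = v then 1 else 0) \<and>
     (\<Sum>w\<in>S. N u w * M w v) = (if u = v then 1 else 0))"

definition coeff_bounds ::
  "('v, 'e) pre_digraph \<Rightarrow> ('e \<Rightarrow> real) \<Rightarrow> 'e edge_fun \<Rightarrow> real \<Rightarrow> real \<Rightarrow> bool" where
  "coeff_bounds G len c lo up \<longleftrightarrow> (\<forall>e\<in>arcs G.
     c e \<in> borel_measurable (lebesgue_on {0..len e}) \<and>
     (AE x in lebesgue_on {0..len e}. lo \<le> c e x \<and> c e x \<le> up))"


section \<open>Functions of time\<close>

text \<open>
  \<open>L\<^sup>2(0,T;L\<^sup>2(\<E>))\<close> is identified with the jointly measurable functions that are square integrable
  on \<open>{0..T} \<times> {0..len e}\<close> for every edge \<open>e\<close>. A function of \<open>H\<^sup>1(0,T;L\<^sup>2(\<E>))\<close> is taken in its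
  continuous representative, which is the indefinite integral of its weak derivative \<open>f'\<close>.
  It is no restriction that \<open>f'\<close> is Borel and not only Lebesgue measurable.
\<close>

definition H1_time_L2 ::
  "('v, 'e) pre_digraph \<Rightarrow> ('e \<Rightarrow> real) \<Rightarrow> real \<Rightarrow> (real \<Rightarrow> 'e edge_fun) \<Rightarrow> bool" where
  "H1_time_L2 G len T f \<longleftrightarrow> f 0 \<in> L2_net G len \<and>
     (\<exists>f' :: real \<Rightarrow> 'e edge_fun. \<forall>e\<in>arcs G.
        (\<lambda>(t, x). f' t e x) \<in> borel_measurable borel \<and>
        set_integrable lborel ({0..T} \<times> {0..len e}) (\<lambda>(t, x). (f' t e x)\<^sup>2) \<and>
        (\<forall>t\<in>{0..T}. AE x in lebesgue_on {0..len e}.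
           f t e x = f 0 e x + (LINT s|lebesgue_on {0..t}. f' s e x)))"

definition has_L2_time_deriv ::
  "('v, 'e) pre_digraph \<Rightarrow> ('e \<Rightarrow> real) \<Rightarrow> real \<Rightarrow> (real \<Rightarrow> 'e edge_fun) \<Rightarrow> (real \<Rightarrow> 'e edge_fun) \<Rightarrow> bool"
  where
  "has_L2_time_deriv G len T u u' \<longleftrightarrow> (\<forall>t\<in>{0..T}.
     ((\<lambda>s. norm_L2 G len (\<lambda>e x. (u s e x - u t e x) / (s - t) - u' t e x)) \<longlongrightarrow> 0)
       (at t within {0..T}))"

definition continuous_L2 ::
  "('v, 'e) pre_digraph \<Rightarrow> ('e \<Rightarrow> real) \<Rightarrow> real \<Rightarrow> (real \<Rightarrow> 'e edge_fun) \<Rightarrow> bool" where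
  "continuous_L2 G len T u \<longleftrightarrow> (\<forall>t\<in>{0..T}.
     ((\<lambda>s. norm_L2 G len (\<lambda>e x. u s e x - u t e x)) \<longlongrightarrow> 0) (at t within {0..T}))"

definition vec_deriv :: "real \<Rightarrow> (real \<Rightarrow> 'v \<Rightarrow> real) \<Rightarrow> real \<Rightarrow> 'v \<Rightarrow> real" where
  "vec_deriv T y t v = vector_derivative (\<lambda>s. y s v) (at t within {0..T})"

definition norm_L2_time :: "real \<Rightarrow> ('e edge_fun \<Rightarrow> real) \<Rightarrow> (real \<Rightarrow> 'e edge_fun) \<Rightarrow> real" where
  "norm_L2_time T N u = sqrt (LINT t|lebesgue_on {0..T}. (N (u t))\<^sup>2)"

definition norm_sup_time :: "real \<Rightarrow> ('e edge_fun \<Rightarrow> real) \<Rightarrow> (real \<Rightarrow> 'e edge_fun) \<Rightarrow> real" where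
  "norm_sup_time T N u = (SUP t\<in>{0..T}. N (u t))"


section \<open>The hyperbolic system and the implicit Euler scheme\<close>

text \<open>
  Classical solutions: \<open>p, m \<in> C\<^sup>1([0,T];L\<^sup>2(\<E>))\<close> with \<open>p(t)\<close> in \<open>H\<^sup>1\<close>, and the equations hold for
  every \<open>t\<close>. Continuity of \<open>p\<close> with values in \<open>H\<^sup>1\<close> follows from the second equation if \<open>f\<close> is
  continuous in time, that of \<open>lam\<close> then from the first one. For \<open>f\<close>, \<open>g\<close> in \<open>H\<^sup>1\<close> and \<open>h\<close>, \<open>r\<close> in \<open>H\<^sup>2\<close>
  in time and initial values with \<open>\<B> p(0) = h(0)\<close> for which \<open>\<K>\<^sup>* m(0) - \<C>\<^sup>* r(0)\<close> acts on
  \<open>H\<^sup>1\<^sub>0\<close> as an \<open>L\<^sup>2\<close> function, the unique solution is of this kind by semigroup theory (after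
  subtracting liftings of \<open>h\<close> and \<open>r\<close>).
\<close>

definition hyperbolic_solution ::
  "('v, 'e) pre_digraph \<Rightarrow> ('e \<Rightarrow> real) \<Rightarrow> 'v set \<Rightarrow> 'e edge_fun \<Rightarrow> 'e edge_fun \<Rightarrow> real \<Rightarrow>
   (real \<Rightarrow> 'e edge_fun) \<Rightarrow> (real \<Rightarrow> 'e edge_fun) \<Rightarrow> (real \<Rightarrow> 'v \<Rightarrow> real) \<Rightarrow> (real \<Rightarrow> 'v \<Rightarrow> real) \<Rightarrow>
   'e edge_fun \<Rightarrow> 'e edge_fun \<Rightarrow> real \<Rightarrow>
   (real \<Rightarrow> 'e edge_fun) \<Rightarrow> (real \<Rightarrow> 'e edge_fun) \<Rightarrow> (real \<Rightarrow> 'v \<Rightarrow> real) \<Rightarrow> bool" where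
  "hyperbolic_solution G len VD a d T f g h r p_init m_init \<epsilon> p m lam \<longleftrightarrow>
     (\<forall>t\<in>{0..T}. p t \<in> H1_net G len \<and> m t \<in> L2_net G len) \<and>
     ae_eq G len (p 0) p_init \<and> ae_eq G len (m 0) m_init \<and>
     (\<exists>p' m'.
        (\<forall>t\<in>{0..T}. p' t \<in> L2_net G len \<and> m' t \<in> L2_net G len) \<and>
        has_L2_time_deriv G len T p p' \<and> continuous_L2 G len T p' \<and>
        has_L2_time_deriv G len T m m' \<and> continuous_L2 G len T m' \<and>
        (\<forall>t\<in>{0..T}.
           (\<forall>q\<in>H1_net G len.
              inner_L2 G len (p' t) q + inner_L2 G len (\<lambda>e x. a e x * p t e x) q
                - K_adj G len (m t) q + eval_adj G len VD (lam t) q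
              = inner_L2 G len (g t) q - eval_adj G len (verts G - VD) (r t) q) \<and>
           (\<forall>w\<in>L2_net G len.
              \<epsilon> * inner_L2 G len (m' t) w + K_op G len (p t) w
                + inner_L2 G len (\<lambda>e x. d e x * m t e x) w
              = inner_L2 G len (f t) w) \<and>
           (\<forall>v\<in>VD. vertex_val G len (p t) v = h t v)))"

definition diff_quot :: "real \<Rightarrow> (nat \<Rightarrow> 'e edge_fun) \<Rightarrow> nat \<Rightarrow> 'e edge_fun" where
  "diff_quot \<tau> P j = (\<lambda>e x. (P j e x - P (j - 1) e x) / \<tau>)"

definition euler_scheme ::
  "('v, 'e) pre_digraph \<Rightarrow> ('e \<Rightarrow> real) \<Rightarrow> 'v set \<Rightarrow> 'e edge_fun \<Rightarrow> 'e edge_fun \<Rightarrow>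
   ('v \<Rightarrow> 'v \<Rightarrow> real) \<Rightarrow> real \<Rightarrow>
   (real \<Rightarrow> 'e edge_fun) \<Rightarrow> (real \<Rightarrow> 'e edge_fun) \<Rightarrow> (real \<Rightarrow> 'v \<Rightarrow> real) \<Rightarrow> (real \<Rightarrow> 'v \<Rightarrow> real) \<Rightarrow>
   'e edge_fun \<Rightarrow> nat \<Rightarrow>
   (nat \<Rightarrow> 'e edge_fun) \<Rightarrow> (nat \<Rightarrow> 'e edge_fun) \<Rightarrow> (nat \<Rightarrow> 'v \<Rightarrow> real) \<Rightarrow> (nat \<Rightarrow> 'v \<Rightarrow> real) \<Rightarrow> bool"
  where
  "euler_scheme G len VD a d M T f g h r p_init n P Q Lam Mu \<longleftrightarrow>
     (let \<tau> = T / real n in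
        P 0 \<in> H1_net G len \<and> ae_eq G len (P 0) p_init \<and>
        (\<forall>j\<in>{1..n}. let t = real j * \<tau> in
           P j \<in> H1_net G len \<and> Q j \<in> L2_net G len \<and>
           (\<forall>q\<in>H1_net G len.
              inner_L2 G len (diff_quot \<tau> P j) q + inner_L2 G len (\<lambda>e x. a e x * P j e x) q
                - K_adj G len (Q j) q + eval_adj G len VD (Lam j) q + eval_adj G len VD (Mu j) q
              = inner_L2 G len (g t) q - eval_adj G len (verts G - VD) (r t) q) \<and>
           (\<forall>w\<in>L2_net G len.
              K_op G len (P j) w + inner_L2 G len (\<lambda>e x. d e x * Q j e x) w
              = inner_L2 G len (f t) w) \<and>
           (\<forall>v\<in>VD. vertex_val G len (P j) v - mat_vec VD M (Mu j) v = h t v) \<and>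
           (\<forall>v\<in>VD. vertex_val G len (diff_quot \<tau> P j) v = vec_deriv T h t v)))"

text \<open>
  The value \<open>U j\<close> is taken on \<open>((j - 1) \<tau>, j \<tau>]\<close>. The index of the piecewise linear interpolant at
  the last grid point \<open>n \<tau>\<close> is \<open>i = n\<close>, where the weight of \<open>U (n + 1)\<close> vanishes.
\<close>

definition pw_const :: "real \<Rightarrow> (nat \<Rightarrow> 'e edge_fun) \<Rightarrow> real \<Rightarrow> 'e edge_fun" where
  "pw_const \<tau> U t = U (nat \<lceil>t / \<tau>\<rceil>)"

definition pw_linear :: "real \<Rightarrow> (nat \<Rightarrow> 'e edge_fun) \<Rightarrow> real \<Rightarrow> 'e edge_fun" where
  "pw_linear \<tau> U t = (\<lambda>e x. let i = nat \<lfloor>t / \<tau>\<rfloor> in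
     U i e x + (t / \<tau> - real i) * (U (i + 1) e x - U i e x))"

end

theory Submission
  imports Defs "HOL-Analysis.Analysis" "HOL-Real_Asymp.Real_Asymp"
begin

text \<open>
  The hyperbolic solution is compared directly with the Euler iterates, without the parabolic limit
  in between. Testing the error equation for the difference \<open>E\<close> of \<open>p\<close> and the piecewise linear
  interpolant with \<open>E\<close> itself leaves, besides oscillations of the data over one time step, two
  remainders: \<open>\<epsilon> \<partial>\<^sub>t m\<close> and the \<open>H\<^sup>1\<close> norms of the increments of the scheme. The first is of order \<open>\<epsilon>\<close>
  by the energy estimate for time differences of the hyperbolic solution, whose initial velocities
  are bounded because \<open>m(0) = m\<^sub>0(0)\<close> gives \<open>\<partial>\<^sub>t m(0) = 0\<close> and \<open>m\<^sub>*\<close> gives \<open>\<partial>\<^sub>t p(0)\<close>; the second is of order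
  \<open>\<tau>\<close> by the same estimate for the differenced scheme. Only \<open>H\<^sup>1\<^sub>0\<close> test functions are needed, so the
  multipliers drop out, and the boundary values of the scheme are \<open>h(0)\<close> plus the right endpoint rule
  for \<open>\<partial>\<^sub>t h\<close>.
\<close>

section \<open>Square integrable functions\<close>

text \<open>The solution is only once continuously differentiable in time, so the system itself
  cannot be differentiated: time regularity is extracted from differences at distance
  \<open>\<delta>\<close>, and Fatou's lemma passes to \<open>\<delta>\<close> = 0. Accordingly H^1
  in time is encoded by a scalar modulus whose increments bound squared increments of the function
  and telescope over the grid. The energy estimates run in an inner product space without
  completeness, since every limit that occurs is a derivative given in advance; a pair of function
  and derivative stands for an element of H^1_0. The rate is \<epsilon> rather than its square root
  because the bound on the time derivative of \<open>m\<close> comes from the damping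
  \<open>d_lo\<close>, not from the energy of weight \<epsilon>. For the discrete counterpart the
  scheme is continued to index 0, with the flux \<open>m(0)\<close> and a fictitious increment that
  plays the role of the initial velocity. Inhomogeneous data are removed by liftings. The price is
  twofold: the accumulated boundary values of the scheme leave defects of order \<tau>, and the
  shift of the flux leaves a source of weight \<epsilon>.\<close>

definition sq_integrable :: "'a measure \<Rightarrow> ('a \<Rightarrow> real) \<Rightarrow> bool" where
  "sq_integrable M u \<longleftrightarrow> u \<in> borel_measurable M \<and> integrable M (\<lambda>x. (u x)\<^sup>2)"

lemma sq_integrable_measurable[measurable_dest]: "sq_integrable M u \<Longrightarrow> u \<in> borel_measurable M"
  by (simp add: sq_integrable_def)

lemma sq_integrable_bounded_mult:
  assumes u: "sq_integrable M u" and c: "c \<in> borel_measurable M" "AE x in M. \<bar>c x\<bar> \<le> B"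
  shows "sq_integrable M (\<lambda>x. c x * u x)"
  unfolding sq_integrable_def
proof
  note [measurable] = sq_integrable_measurable[OF u] c(1)
  show "(\<lambda>x. c x * u x) \<in> borel_measurable M" by measurable
  have "integrable M (\<lambda>x. B\<^sup>2 * (u x)\<^sup>2)" using u by (simp add: sq_integrable_def)
  then show "integrable M (\<lambda>x. (c x * u x)\<^sup>2)"
  proof (rule Bochner_Integration.integrable_bound)
    show "AE x in M. norm ((c x * u x)\<^sup>2) \<le> norm (B\<^sup>2 * (u x)\<^sup>2)"
      using c(2)
    proof eventually_elim
      case (elim x)
      then have "(c x)\<^sup>2 \<le> B\<^sup>2" using power_mono[of "\<bar>c x\<bar>" B 2] by simp
      then show ?case by (simp add: power_mult_distrib mult_right_mono)
    qed
  qed measurable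
qed

lemma sq_integrable_cmult: "sq_integrable M u \<Longrightarrow> sq_integrable M (\<lambda>x. c * u x)"
  by (rule sq_integrable_bounded_mult[where B = "\<bar>c\<bar>"]) auto

lemma sq_integrable_mult_integrable:
  assumes "sq_integrable M u" "sq_integrable M w"
  shows "integrable M (\<lambda>x. u x * w x)"
proof (rule Bochner_Integration.integrable_bound)
  note [measurable] = assms[THEN sq_integrable_measurable]
  show "integrable M (\<lambda>x. (u x)\<^sup>2 + (w x)\<^sup>2)" using assms by (simp add: sq_integrable_def)
  show "(\<lambda>x. u x * w x) \<in> borel_measurable M" by measurable
  show "AE x in M. norm (u x * w x) \<le> norm ((u x)\<^sup>2 + (w x)\<^sup>2)"
  proof (rule AE_I2)
    fix x
    have "0 \<le> (\<bar>u x\<bar> - \<bar>w x\<bar>)\<^sup>2" "0 \<le> (u x)\<^sup>2" "0 \<le> (w x)\<^sup>2" by auto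
    moreover have "0 \<le> \<bar>u x\<bar> * \<bar>w x\<bar>" by simp
    ultimately show "norm (u x * w x) \<le> norm ((u x)\<^sup>2 + (w x)\<^sup>2)"
      unfolding power2_diff power2_abs mult.assoc real_norm_def abs_mult
      by (simp only: abs_of_nonneg[OF add_nonneg_nonneg[OF zero_le_power2 zero_le_power2]])
  qed
qed

lemma sq_integrable_add:
  assumes "sq_integrable M u" "sq_integrable M w"
  shows "sq_integrable M (\<lambda>x. u x + w x)"
proof -
  have "integrable M (\<lambda>x. (u x)\<^sup>2 + (w x)\<^sup>2 + 2 * (u x * w x))"
    using assms sq_integrable_mult_integrable[OF assms] by (simp add: sq_integrable_def)
  then show ?thesis
    using assms by (auto simp: sq_integrable_def power2_sum mult.assoc)
qed

lemma sq_integrable_zero: "sq_integrable M (\<lambda>x. 0)"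
  by (simp add: sq_integrable_def)

lemma sq_integrable_cong_AE:
  assumes "sq_integrable M u" "w \<in> borel_measurable M" "AE x in M. u x = w x"
  shows "sq_integrable M w"
proof -
  note [measurable] = assms(1)[THEN sq_integrable_measurable] assms(2)
  have "integrable M (\<lambda>x. (w x)\<^sup>2) \<longleftrightarrow> integrable M (\<lambda>x. (u x)\<^sup>2)"
    by (intro integrable_cong_AE) (use assms(3) in auto)
  then show ?thesis using assms by (simp add: sq_integrable_def)
qed

subsection \<open>Finitely many copies of the real line\<close>

definition l2_support :: "('e \<Rightarrow> real \<Rightarrow> real) \<Rightarrow> 'e set" where
  "l2_support u = {e. \<not> (AE x in lebesgue. u e x = 0)}"

text \<open>The edge type may be infinite. A finite support keeps the edge sum in
  \<open>l2_inner_raw\<close> finite without any reference to a network.\<close>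

definition l2_raw :: "('e \<Rightarrow> real \<Rightarrow> real) \<Rightarrow> bool" where
  "l2_raw u \<longleftrightarrow> finite (l2_support u) \<and> (\<forall>e. sq_integrable lebesgue (u e))"

definition l2_rel :: "('e \<Rightarrow> real \<Rightarrow> real) \<Rightarrow> ('e \<Rightarrow> real \<Rightarrow> real) \<Rightarrow> bool" where
  "l2_rel u w \<longleftrightarrow> l2_raw u \<and> l2_raw w \<and> (\<forall>e. AE x in lebesgue. u e x = w e x)"

definition l2_inner_raw :: "('e \<Rightarrow> real \<Rightarrow> real) \<Rightarrow> ('e \<Rightarrow> real \<Rightarrow> real) \<Rightarrow> real" where
  "l2_inner_raw u w = (\<Sum>e\<in>l2_support u. LINT x|lebesgue. u e x * w e x)"

lemma l2_support_rel: "l2_rel u w \<Longrightarrow> l2_support u = l2_support w"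
proof -
  assume "l2_rel u w"
  then have ae: "AE x in lebesgue. u e x = w e x" for e by (simp add: l2_rel_def)
  have "(AE x in lebesgue. u e x = 0) \<longleftrightarrow> (AE x in lebesgue. w e x = 0)" for e
  proof
    assume "AE x in lebesgue. u e x = 0"
    with ae[of e] show "AE x in lebesgue. w e x = 0" by eventually_elim simp
  next
    assume "AE x in lebesgue. w e x = 0"
    with ae[of e] show "AE x in lebesgue. u e x = 0" by eventually_elim simp
  qed
  then show ?thesis by (simp add: l2_support_def)
qed

lemma l2_rel_refl: "l2_raw u \<Longrightarrow> l2_rel u u"
  by (simp add: l2_rel_def)

lemma l2_raw_zero: "l2_raw (\<lambda>e x. 0)"
  by (simp add: l2_raw_def l2_support_def sq_integrable_zero)

lemma l2_raw_add:
  assumes "l2_raw u" "l2_raw w"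
  shows "l2_raw (\<lambda>e x. u e x + w e x)"
proof -
  have "l2_support (\<lambda>e x. u e x + w e x) \<subseteq> l2_support u \<union> l2_support w"
  proof
    fix e assume "e \<in> l2_support (\<lambda>e x. u e x + w e x)"
    then have "\<not> (AE x in lebesgue. u e x + w e x = 0)" by (simp add: l2_support_def)
    moreover have "AE x in lebesgue. u e x + w e x = 0"
      if "AE x in lebesgue. u e x = 0" "AE x in lebesgue. w e x = 0"
      using that by eventually_elim simp
    ultimately show "e \<in> l2_support u \<union> l2_support w" by (auto simp: l2_support_def)
  qed
  then show ?thesis
    using assms by (auto simp: l2_raw_def sq_integrable_add elim: finite_subset)
qed

lemma l2_support_mult: "l2_support (\<lambda>e x. c e x * u e x) \<subseteq> l2_support u"
proof
  fix e assume "e \<in> l2_support (\<lambda>e x. c e x * u e x)"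
  then have "\<not> (AE x in lebesgue. c e x * u e x = 0)" by (simp add: l2_support_def)
  moreover have "AE x in lebesgue. c e x * u e x = 0" if "AE x in lebesgue. u e x = 0"
    using that by eventually_elim simp
  ultimately show "e \<in> l2_support u" by (auto simp: l2_support_def)
qed

lemma l2_raw_bounded_mult:
  assumes u: "l2_raw u" and c: "\<And>e. c e \<in> borel_measurable lebesgue" "\<And>e. AE x in lebesgue. \<bar>c e x\<bar> \<le> B"
  shows "l2_raw (\<lambda>e x. c e x * u e x)"
  using l2_support_mult[of c u] u c by (auto simp: l2_raw_def elim: finite_subset intro!: sq_integrable_bounded_mult[where B = B])

lemma l2_raw_cmult: "l2_raw u \<Longrightarrow> l2_raw (\<lambda>e x. c * u e x)"
  by (rule l2_raw_bounded_mult[where B = "\<bar>c\<bar>"]) auto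

lemma l2_raw_uminus: "l2_raw u \<Longrightarrow> l2_raw (\<lambda>e x. - u e x)"
  using l2_raw_cmult[of u "-1"] by simp

lemma l2_raw_diff: "l2_raw u \<Longrightarrow> l2_raw w \<Longrightarrow> l2_raw (\<lambda>e x. u e x - w e x)"
  using l2_raw_add[of u "\<lambda>e x. - w e x"] l2_raw_uminus[of w] by simp

lemma l2_mult_integrable: "l2_raw u \<Longrightarrow> l2_raw w \<Longrightarrow> integrable lebesgue (\<lambda>x. u e x * w e x)"
  by (simp add: l2_raw_def sq_integrable_mult_integrable)

text \<open>Off the support the integrands are null, so every finite superset is an equally good
  range of summation. Symmetry uses the union of both supports, the link to \<open>inner_L2\<close>
  uses \<open>arcs G\<close>.\<close>

lemma l2_inner_raw_eq:
  assumes "finite S" "l2_support u \<subseteq> S"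
  shows "l2_inner_raw u w = (\<Sum>e\<in>S. LINT x|lebesgue. u e x * w e x)"
  unfolding l2_inner_raw_def
proof (rule sum.mono_neutral_left[OF assms])
  show "\<forall>e\<in>S - l2_support u. (LINT x|lebesgue. u e x * w e x) = 0"
  proof
    fix e assume "e \<in> S - l2_support u"
    then have "AE x in lebesgue. u e x = 0" by (simp add: l2_support_def)
    then have "AE x in lebesgue. u e x * w e x = 0" by eventually_elim simp
    then show "(LINT x|lebesgue. u e x * w e x) = 0" by (rule integral_eq_zero_AE)
  qed
qed

lemma l2_inner_raw_commute:
  assumes "l2_raw u" "l2_raw w"
  shows "l2_inner_raw u w = l2_inner_raw w u"
proof -
  let ?S = "l2_support u \<union> l2_support w"
  have "finite ?S" using assms by (simp add: l2_raw_def)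
  then show ?thesis
    using l2_inner_raw_eq[of ?S u w] l2_inner_raw_eq[of ?S w u] by (simp add: mult.commute)
qed

lemma l2_inner_raw_rel:
  assumes "l2_rel u u'" "l2_rel w w'"
  shows "l2_inner_raw u w = l2_inner_raw u' w'"
  unfolding l2_inner_raw_def l2_support_rel[OF assms(1)]
proof (rule sum.cong[OF refl])
  fix e
  have "(\<lambda>x. u e x * w e x) \<in> borel_measurable lebesgue" "(\<lambda>x. u' e x * w' e x) \<in> borel_measurable lebesgue"
    using assms by (auto simp: l2_rel_def intro: borel_measurable_integrable l2_mult_integrable)
  moreover have "AE x in lebesgue. u e x * w e x = u' e x * w' e x"
  proof -
    have "AE x in lebesgue. u e x = u' e x" "AE x in lebesgue. w e x = w' e x"
      using assms by (auto simp: l2_rel_def)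
    then show ?thesis by eventually_elim simp
  qed
  ultimately show "(LINT x|lebesgue. u e x * w e x) = (LINT x|lebesgue. u' e x * w' e x)"
    by (rule integral_cong_AE)
qed

lemma l2_inner_raw_add_right:
  "l2_raw u \<Longrightarrow> l2_raw w \<Longrightarrow> l2_raw z \<Longrightarrow>
    l2_inner_raw u (\<lambda>e x. w e x + z e x) = l2_inner_raw u w + l2_inner_raw u z"
  unfolding l2_inner_raw_def
  by (simp add: distrib_left l2_mult_integrable sum.distrib)

lemma l2_inner_raw_cmult_right: "l2_inner_raw u (\<lambda>e x. c * w e x) = c * l2_inner_raw u w"
  unfolding l2_inner_raw_def by (simp add: mult.left_commute sum_distrib_left)

lemma l2_inner_raw_nonneg: "0 \<le> l2_inner_raw u u"
  unfolding l2_inner_raw_def by (intro sum_nonneg integral_nonneg_AE) auto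

lemma l2_inner_raw_eq_0:
  assumes "l2_raw u" "l2_inner_raw u u = 0"
  shows "AE x in lebesgue. u e x = 0"
proof (rule ccontr)
  assume "\<not> (AE x in lebesgue. u e x = 0)"
  then have e: "e \<in> l2_support u" by (simp add: l2_support_def)
  have "(LINT x|lebesgue. u e x * u e x) = 0"
    using assms e unfolding l2_inner_raw_def
    by (subst (asm) sum_nonneg_eq_0_iff) (auto simp: l2_raw_def intro!: integral_nonneg_AE)
  then have "AE x in lebesgue. u e x * u e x = 0"
    using l2_mult_integrable[OF assms(1,1), of e] by (subst (asm) integral_nonneg_eq_0_iff_AE) auto
  then have "AE x in lebesgue. u e x = 0" by eventually_elim simp
  with e show False by (simp add: l2_support_def)
qed

lemma AE_eq_binary:
  assumes "AE x in M. u x = u' x" "AE x in M. w x = w' x"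
  shows "AE x in M. f (u x) (w x) = f (u' x) (w' x)"
  using assms by eventually_elim simp

text \<open>Edge functions modulo null functions form a real inner product space, so that the energy
  estimates can be carried out in an abstract one. The type depends on the edges only; functions on
  a network are extended by zero.\<close>

quotient_type 'e l2 = "'e \<Rightarrow> real \<Rightarrow> real" / partial: l2_rel
proof (rule part_equivpI)
  show "\<exists>x. l2_rel x x" using l2_rel_refl l2_raw_zero by blast
  show "symp l2_rel"
    by (rule sympI) (auto simp: l2_rel_def intro: AE_symmetric)
  show "transp l2_rel"
  proof (rule transpI)
    fix x y z
    assume 1: "l2_rel x y" "l2_rel y z"
    have "AE t in lebesgue. x e t = z e t" for e
    proof -
      have "AE t in lebesgue. x e t = y e t" "AE t in lebesgue. y e t = z e t"
        using 1 by (auto simp: l2_rel_def)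
      then show ?thesis by eventually_elim simp
    qed
    with 1 show "l2_rel x z" by (simp add: l2_rel_def)
  qed
qed

instantiation l2 :: (type) real_vector
begin

lift_definition zero_l2 :: "'a l2" is "\<lambda>e x. 0"
  by (simp add: l2_rel_refl l2_raw_zero)

lift_definition plus_l2 :: "'a l2 \<Rightarrow> 'a l2 \<Rightarrow> 'a l2" is "\<lambda>u w e x. u e x + w e x"
  unfolding l2_rel_def by (auto intro: l2_raw_add AE_eq_binary)

lift_definition minus_l2 :: "'a l2 \<Rightarrow> 'a l2 \<Rightarrow> 'a l2" is "\<lambda>u w e x. u e x - w e x"
  unfolding l2_rel_def by (auto intro: l2_raw_diff AE_eq_binary)

lift_definition uminus_l2 :: "'a l2 \<Rightarrow> 'a l2" is "\<lambda>u e x. - u e x"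
  unfolding l2_rel_def by (auto intro: l2_raw_uminus elim: AE_mp)

lift_definition scaleR_l2 :: "real \<Rightarrow> 'a l2 \<Rightarrow> 'a l2" is "\<lambda>c u e x. c * u e x"
  unfolding l2_rel_def by (auto intro: l2_raw_cmult elim: AE_mp)

instance
proof
  fix a b c :: "'a l2" and r s :: real
  show "a + b + c = a + (b + c)"
    by transfer (auto simp: l2_rel_def add.assoc intro!: l2_raw_add)
  show "a + b = b + a"
    by transfer (auto simp: l2_rel_def add.commute intro!: l2_raw_add)
  show "0 + a = a" by transfer (auto simp: l2_rel_def)
  show "- a + a = 0" by transfer (auto simp: l2_rel_def l2_raw_zero)
  show "a - b = a + - b"
    by transfer (auto simp: l2_rel_def intro!: l2_raw_diff)
  show "r *\<^sub>R (a + b) = r *\<^sub>R a + r *\<^sub>R b"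
    by transfer (auto simp: l2_rel_def distrib_left intro!: l2_raw_add l2_raw_cmult)
  show "(r + s) *\<^sub>R a = r *\<^sub>R a + s *\<^sub>R a"
    by transfer (auto simp: l2_rel_def distrib_right intro!: l2_raw_add l2_raw_cmult)
  show "r *\<^sub>R s *\<^sub>R a = (r * s) *\<^sub>R a"
    by transfer (auto simp: l2_rel_def mult.assoc intro!: l2_raw_cmult)
  show "1 *\<^sub>R a = a" by transfer (auto simp: l2_rel_def)
qed

end

instantiation l2 :: (type) real_inner
begin

lift_definition inner_l2 :: "'a l2 \<Rightarrow> 'a l2 \<Rightarrow> real" is l2_inner_raw
  by (rule l2_inner_raw_rel)

definition norm_l2 :: "'a l2 \<Rightarrow> real" where "norm_l2 x = sqrt (inner x x)"

definition dist_l2 :: "'a l2 \<Rightarrow> 'a l2 \<Rightarrow> real" where "dist_l2 x y = norm (x - y)"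

definition sgn_l2 :: "'a l2 \<Rightarrow> 'a l2" where "sgn_l2 x = x /\<^sub>R norm x"

definition uniformity_l2 :: "('a l2 \<times> 'a l2) filter" where
  "uniformity_l2 = (INF e\<in>{0<..}. principal {(x, y). dist x y < e})"

definition open_l2 :: "'a l2 set \<Rightarrow> bool" where
  "open_l2 U \<longleftrightarrow> (\<forall>x\<in>U. eventually (\<lambda>(x', y). x' = x \<longrightarrow> y \<in> U) uniformity)"

instance
proof
  fix a b c :: "'a l2" and r s :: real
  show "dist a b = norm (a - b)" by (rule dist_l2_def)
  show "sgn a = a /\<^sub>R norm a" by (rule sgn_l2_def)
  show "(uniformity :: ('a l2 \<times> 'a l2) filter) = (INF e\<in>{0<..}. principal {(x, y). dist x y < e})"
    by (rule uniformity_l2_def)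
  show "open U \<longleftrightarrow> (\<forall>x\<in>U. eventually (\<lambda>(x', y). x' = x \<longrightarrow> y \<in> U) uniformity)" for U :: "'a l2 set"
    by (rule open_l2_def)
  show "norm a = sqrt (inner a a)" by (rule norm_l2_def)
  show "inner a b = inner b a"
    by transfer (simp add: l2_rel_def l2_inner_raw_commute)
  show "inner (a + b) c = inner a c + inner b c"
  proof transfer
    fix a b c :: "'a \<Rightarrow> real \<Rightarrow> real"
    assume "l2_rel a a" "l2_rel b b" "l2_rel c c"
    then have "l2_raw a" "l2_raw b" "l2_raw c" by (auto simp: l2_rel_def)
    then show "l2_inner_raw (\<lambda>e x. a e x + b e x) c = l2_inner_raw a c + l2_inner_raw b c"
      using l2_inner_raw_add_right[of c a b]
      by (simp add: l2_inner_raw_commute[of _ c] l2_raw_add)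
  qed
  show "inner (r *\<^sub>R a) b = r * inner a b"
  proof transfer
    fix r :: real and a b :: "'a \<Rightarrow> real \<Rightarrow> real"
    assume "l2_rel a a" "l2_rel b b"
    then have "l2_raw a" "l2_raw b" by (auto simp: l2_rel_def)
    then show "l2_inner_raw (\<lambda>e x. r * a e x) b = r * l2_inner_raw a b"
      using l2_inner_raw_cmult_right[of b r a]
      by (simp add: l2_inner_raw_commute[of _ b] l2_raw_cmult)
  qed
  show "0 \<le> inner a a" by transfer (rule l2_inner_raw_nonneg)
  show "inner a a = 0 \<longleftrightarrow> a = 0"
  proof transfer
    fix a :: "'a \<Rightarrow> real \<Rightarrow> real"
    assume "l2_rel a a"
    then have a: "l2_raw a" by (simp add: l2_rel_def)
    show "l2_inner_raw a a = 0 \<longleftrightarrow> l2_rel a (\<lambda>e x. 0)"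
    proof
      assume "l2_inner_raw a a = 0"
      then show "l2_rel a (\<lambda>e x. 0)"
        using l2_inner_raw_eq_0[OF a] a by (simp add: l2_rel_def l2_raw_zero)
    next
      assume "l2_rel a (\<lambda>e x. 0)"
      then have "l2_support a = {}" by (auto simp: l2_rel_def l2_support_def)
      then show "l2_inner_raw a a = 0" by (simp add: l2_inner_raw_def)
    qed
  qed
qed

end

text \<open>A lifted definition would have to respect the relation for every \<open>c\<close>, but
  the product is sure to be square integrable only for bounded \<open>c\<close>. In that case
  \<open>l2_mult_abs\<close> shows that the chosen representative does not matter.\<close>

definition l2_mult :: "('e \<Rightarrow> real \<Rightarrow> real) \<Rightarrow> 'e l2 \<Rightarrow> 'e l2" where
  "l2_mult c X = abs_l2 (\<lambda>e x. c e x * rep_l2 X e x)"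

definition l2_bounded :: "('e \<Rightarrow> real \<Rightarrow> real) \<Rightarrow> real \<Rightarrow> real \<Rightarrow> bool" where
  "l2_bounded c lo up \<longleftrightarrow> (\<forall>e. c e \<in> borel_measurable lebesgue \<and> (AE x in lebesgue. lo \<le> c e x \<and> c e x \<le> up))"

lemma l2_bounded_raw_mult: "l2_bounded c lo up \<Longrightarrow> l2_raw u \<Longrightarrow> l2_raw (\<lambda>e x. c e x * u e x)"
proof -
  assume c: "l2_bounded c lo up" and u: "l2_raw u"
  have "AE x in lebesgue. \<bar>c e x\<bar> \<le> max \<bar>lo\<bar> \<bar>up\<bar>" for e
  proof -
    have "AE x in lebesgue. lo \<le> c e x \<and> c e x \<le> up" using c by (simp add: l2_bounded_def)
    then show ?thesis by eventually_elim auto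
  qed
  then show ?thesis using c by (intro l2_raw_bounded_mult[OF u]) (auto simp: l2_bounded_def)
qed

lemma l2_rep: "l2_raw (rep_l2 X)" "abs_l2 (rep_l2 X) = X"
  using Quotient_rep_reflp[OF Quotient_l2, of X] Quotient_abs_rep[OF Quotient_l2, of X]
  by (simp_all add: l2_rel_def)

lemma abs_l2_eq: "l2_raw u \<Longrightarrow> l2_raw w \<Longrightarrow> abs_l2 u = abs_l2 w \<longleftrightarrow> (\<forall>e. AE x in lebesgue. u e x = w e x)"
  using Quotient_rel[OF Quotient_l2, of u w] by (auto simp: l2_rel_def)

lemma inner_abs_l2: "l2_raw u \<Longrightarrow> l2_raw w \<Longrightarrow> inner (abs_l2 u) (abs_l2 w) = l2_inner_raw u w"
  by (simp add: inner_l2.abs_eq l2_rel_refl)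

lemma abs_l2_add: "l2_raw u \<Longrightarrow> l2_raw w \<Longrightarrow> abs_l2 u + abs_l2 w = abs_l2 (\<lambda>e x. u e x + w e x)"
  by (simp add: plus_l2.abs_eq l2_rel_refl)

lemma abs_l2_diff: "l2_raw u \<Longrightarrow> l2_raw w \<Longrightarrow> abs_l2 u - abs_l2 w = abs_l2 (\<lambda>e x. u e x - w e x)"
  by (simp add: minus_l2.abs_eq l2_rel_refl)

lemma abs_l2_scaleR: "l2_raw u \<Longrightarrow> c *\<^sub>R abs_l2 u = abs_l2 (\<lambda>e x. c * u e x)"
  by (simp add: scaleR_l2.abs_eq l2_rel_refl)

lemma l2_mult_abs:
  assumes c: "l2_bounded c lo up" and u: "l2_raw u"
  shows "l2_mult c (abs_l2 u) = abs_l2 (\<lambda>e x. c e x * u e x)"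
proof -
  have "\<forall>e. AE x in lebesgue. rep_l2 (abs_l2 u) e x = u e x"
    using abs_l2_eq[OF l2_rep(1) u] l2_rep(2) by blast
  then have "\<forall>e. AE x in lebesgue. c e x * rep_l2 (abs_l2 u) e x = c e x * u e x"
    by (auto elim: AE_mp)
  then show ?thesis
    unfolding l2_mult_def
    by (subst abs_l2_eq) (auto intro!: l2_bounded_raw_mult[OF c] l2_rep u)
qed

lemma linear_l2_mult:
  assumes c: "l2_bounded c lo up"
  shows "linear (l2_mult c)"
proof
  fix X Y :: "'a l2" and r :: real
  obtain u w where u: "l2_raw u" "X = abs_l2 u" and w: "l2_raw w" "Y = abs_l2 w" using l2_rep by metis
  show "l2_mult c (X + Y) = l2_mult c X + l2_mult c Y"
    using u w by (simp add: abs_l2_add l2_mult_abs[OF c] l2_raw_add l2_bounded_raw_mult[OF c] distrib_left)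
  show "l2_mult c (r *\<^sub>R X) = r *\<^sub>R l2_mult c X"
    using u by (simp add: abs_l2_scaleR l2_mult_abs[OF c] l2_raw_cmult l2_bounded_raw_mult[OF c] mult.left_commute)
qed

lemma l2_mult_lower:
  assumes c: "l2_bounded c lo up"
  shows "lo * (norm X)\<^sup>2 \<le> l2_mult c X \<bullet> X"
proof -
  obtain u where u: "l2_raw u" "X = abs_l2 u" using l2_rep by metis
  note cu = l2_bounded_raw_mult[OF c u(1)]
  have "lo * (norm X)\<^sup>2 = l2_inner_raw u (\<lambda>e x. lo * u e x)"
    using u by (simp add: power2_norm_eq_inner inner_abs_l2 l2_inner_raw_cmult_right)
  also have "\<dots> \<le> l2_inner_raw u (\<lambda>e x. c e x * u e x)"
    unfolding l2_inner_raw_def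
  proof (intro sum_mono integral_mono_AE l2_mult_integrable u cu l2_raw_cmult)
    fix e
    have "AE x in lebesgue. lo \<le> c e x \<and> c e x \<le> up" using c by (simp add: l2_bounded_def)
    then show "AE x in lebesgue. u e x * (lo * u e x) \<le> u e x * (c e x * u e x)"
    proof eventually_elim
      case (elim x)
      then have "lo * (u e x * u e x) \<le> c e x * (u e x * u e x)" by (intro mult_right_mono) auto
      then show ?case by (simp add: algebra_simps)
    qed
  qed
  also have "\<dots> = l2_mult c X \<bullet> X"
    using u cu by (simp add: l2_mult_abs[OF c] inner_abs_l2 l2_inner_raw_commute)
  finally show ?thesis .
qed

lemma l2_mult_norm:
  assumes c: "l2_bounded c lo up" and B: "\<bar>lo\<bar> \<le> B" "\<bar>up\<bar> \<le> B"
  shows "norm (l2_mult c X) \<le> B * norm X"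
proof -
  obtain u where u: "l2_raw u" "X = abs_l2 u" using l2_rep by metis
  note cu = l2_bounded_raw_mult[OF c u(1)]
  have S: "finite (l2_support u)" using u by (simp add: l2_raw_def)
  have "(norm (l2_mult c X))\<^sup>2 = l2_inner_raw (\<lambda>e x. c e x * u e x) (\<lambda>e x. c e x * u e x)"
    using u cu by (simp add: l2_mult_abs[OF c] power2_norm_eq_inner inner_abs_l2)
  also have "\<dots> = (\<Sum>e\<in>l2_support u. LINT x|lebesgue. (c e x * u e x) * (c e x * u e x))"
    by (rule l2_inner_raw_eq[OF S l2_support_mult])
  also have "\<dots> \<le> (\<Sum>e\<in>l2_support u. LINT x|lebesgue. u e x * (B\<^sup>2 * u e x))"
  proof (intro sum_mono integral_mono_AE l2_mult_integrable[OF cu cu] l2_mult_integrable u l2_raw_cmult)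
    fix e
    have "AE x in lebesgue. lo \<le> c e x \<and> c e x \<le> up" using c by (simp add: l2_bounded_def)
    then show "AE x in lebesgue. c e x * u e x * (c e x * u e x) \<le> u e x * (B\<^sup>2 * u e x)"
    proof eventually_elim
      case (elim x)
      then have "\<bar>c e x\<bar> \<le> B" using B by auto
      then have "(c e x)\<^sup>2 \<le> B\<^sup>2" using power_mono[of "\<bar>c e x\<bar>" B 2] by simp
      then have "(c e x)\<^sup>2 * (u e x * u e x) \<le> B\<^sup>2 * (u e x * u e x)" by (intro mult_right_mono) auto
      then show ?case by (simp add: algebra_simps power2_eq_square)
    qed
  qed
  also have "\<dots> = l2_inner_raw u (\<lambda>e x. B\<^sup>2 * u e x)"
    by (simp add: l2_inner_raw_def)
  also have "\<dots> = (B * norm X)\<^sup>2"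
    using u by (simp add: power_mult_distrib power2_norm_eq_inner inner_abs_l2 l2_inner_raw_cmult_right)
  finally show ?thesis
    by (rule power2_le_imp_le) (use B in auto)
qed

section \<open>Gronwall inequalities and time regularity\<close>

text \<open>Young's inequality, by expanding the square of \<open>x / c - y\<close>. The weight is
  free so that the part in \<open>y\<close> can be absorbed: \<open>d_lo\<close> matches the damping
  of the flux, \<open>1 / T\<close> and \<open>1 / (2 * T)\<close> match the Gronwall terms.\<close>

lemma two_inner_le:
  fixes x y :: "'a::real_inner"
  assumes "0 < c"
  shows "2 * (x \<bullet> y) \<le> (norm x)\<^sup>2 / c + c * (norm y)\<^sup>2"
proof -
  have "0 \<le> (norm ((1/c) *\<^sub>R x - y))\<^sup>2" by simp
  also have "\<dots> = (norm x)\<^sup>2 / c\<^sup>2 - 2 * (x \<bullet> y) / c + (norm y)\<^sup>2"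
    unfolding power2_norm_eq_inner
    by (simp add: inner_diff_left inner_diff_right inner_commute power2_eq_square field_simps)
  finally have "0 \<le> c * ((norm x)\<^sup>2 / c\<^sup>2 - 2 * (x \<bullet> y) / c + (norm y)\<^sup>2)"
    using assms by simp
  also have "\<dots> = (norm x)\<^sup>2 / c - 2 * (x \<bullet> y) + c * (norm y)\<^sup>2"
    using assms by (simp add: field_simps power2_eq_square)
  finally show ?thesis by simp
qed

lemma norm_add_power2_le:
  fixes x y :: "'a::real_normed_vector"
  shows "(norm (x + y))\<^sup>2 \<le> 2 * (norm x)\<^sup>2 + 2 * (norm y)\<^sup>2"
proof -
  have "(norm (x + y))\<^sup>2 \<le> (norm x + norm y)\<^sup>2"
    by (intro power_mono norm_triangle_ineq) simp
  also have "\<dots> \<le> 2 * (norm x)\<^sup>2 + 2 * (norm y)\<^sup>2"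
    using sum_squares_bound[of "norm x" "norm y"] by (simp add: power2_sum)
  finally show ?thesis .
qed

lemma norm_diff_power2_le:
  fixes x y :: "'a::real_normed_vector"
  shows "(norm (x - y))\<^sup>2 \<le> 2 * (norm x)\<^sup>2 + 2 * (norm y)\<^sup>2"
  using norm_add_power2_le[of x "- y"] by simp

lemma has_real_derivative_norm_power2:
  fixes u :: "real \<Rightarrow> 'a::real_inner"
  assumes "(u has_vector_derivative u') (at t within S)"
  shows "((\<lambda>t. (norm (u t))\<^sup>2) has_real_derivative 2 * (u' \<bullet> u t)) (at t within S)"
proof -
  have "((\<lambda>t. u t \<bullet> u t) has_derivative (\<lambda>h. u t \<bullet> (h *\<^sub>R u') + (h *\<^sub>R u') \<bullet> u t)) (at t within S)"
    using assms unfolding has_vector_derivative_def by (intro has_derivative_inner)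
  then show ?thesis
    unfolding has_field_derivative_def power2_norm_eq_inner
    by (rule has_derivative_eq_rhs) (auto simp: inner_commute fun_eq_iff)
qed

text \<open>The factor \<open>exp (- \<kappa> * (t - a))\<close> turns
  \<open>y' - \<kappa> y\<close> into a derivative. On the interval it lies between
  \<open>exp (- \<kappa> * (b - a))\<close> and 1; the lower bound serves \<open>w\<close>, the
  upper one \<open>k\<close>. Keeping \<open>w\<close> on the left preserves the dissipation, which
  is what controls the flux later. The gauge integral of a derivative exists without continuity of
  \<open>y'\<close>.\<close>

lemma energy_gronwall:
  fixes y y' k w :: "real \<Rightarrow> real"
  assumes "a \<le> b" "0 \<le> \<kappa>"
    and y: "\<And>t. t \<in> {a..b} \<Longrightarrow> (y has_real_derivative y' t) (at t within {a..b})"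
    and le: "\<And>t. t \<in> {a..b} \<Longrightarrow> y' t \<le> \<kappa> * y t + k t - w t"
    and k: "continuous_on {a..b} k" "\<And>t. t \<in> {a..b} \<Longrightarrow> 0 \<le> k t"
    and w: "continuous_on {a..b} w" "\<And>t. t \<in> {a..b} \<Longrightarrow> 0 \<le> w t"
  shows "exp (- \<kappa> * (b - a)) * (y b + integral {a..b} w) \<le> y a + integral {a..b} k"
proof -
  define z where "z t = exp (- \<kappa> * (t - a)) * y t" for t
  define z' where "z' t = exp (- \<kappa> * (t - a)) * (y' t - \<kappa> * y t)" for t
  have "(z has_real_derivative z' t) (at t within {a..b})" if "t \<in> {a..b}" for t
    unfolding z_def z'_def
    by (rule derivative_eq_intros y[OF that] refl)+ (simp add: algebra_simps)
  then have int: "(z' has_integral (z b - z a)) {a..b}"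
    using \<open>a \<le> b\<close>
    by (intro fundamental_theorem_of_calculus)
      (auto simp: has_real_derivative_iff_has_vector_derivative[symmetric])
  have wi: "w integrable_on {a..b}" and ki: "k integrable_on {a..b}"
    using w k by (auto intro: integrable_continuous_real)
  have int2: "((\<lambda>t. k t - exp (- \<kappa> * (b - a)) * w t) has_integral
      (integral {a..b} k - exp (- \<kappa> * (b - a)) * integral {a..b} w)) {a..b}"
    by (intro has_integral_diff has_integral_mult_right integrable_integral wi ki)
  have "z' t \<le> k t - exp (- \<kappa> * (b - a)) * w t" if t: "t \<in> {a..b}" for t
  proof -
    have e1: "exp (- \<kappa> * (t - a)) \<le> 1" and e2: "exp (- \<kappa> * (b - a)) \<le> exp (- \<kappa> * (t - a))"
      using t \<open>0 \<le> \<kappa>\<close> by (auto intro!: mult_left_mono)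
    have "z' t \<le> exp (- \<kappa> * (t - a)) * (k t - w t)"
      unfolding z'_def using le[OF t] by (intro mult_left_mono) auto
    also have "\<dots> \<le> k t - exp (- \<kappa> * (b - a)) * w t"
      using mult_right_mono[OF e1 k(2)[OF t]] mult_right_mono[OF e2 w(2)[OF t]]
      by (simp add: algebra_simps)
    finally show ?thesis .
  qed
  then have "z b - z a \<le> integral {a..b} k - exp (- \<kappa> * (b - a)) * integral {a..b} w"
    by (rule has_integral_le[OF int int2])
  then show ?thesis by (simp add: z_def algebra_simps)
qed

text \<open>Let \<open>X\<close> be the maximum, attained at \<open>J\<close>. Summing up to
  \<open>J\<close>, the terms \<open>x j / (2 * n)\<close> amount to at most \<open>X / 2\<close>,
  which is absorbed on the left; hence the factor 2 and no exponential. The term of index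
  \<open>j\<close> on the right reflects an implicit step.\<close>

lemma discrete_gronwall:
  fixes x y z :: "nat \<Rightarrow> real"
  assumes n: "0 < n"
    and nonneg: "\<And>j. j \<le> n \<Longrightarrow> 0 \<le> x j" "\<And>j. j \<in> {1..n} \<Longrightarrow> 0 \<le> y j"
      "\<And>j. j \<in> {1..n} \<Longrightarrow> 0 \<le> z j"
    and step: "\<And>j. j \<in> {1..n} \<Longrightarrow> x j - x (j - 1) + z j \<le> x j / (2 * real n) + y j"
  shows "\<And>j. j \<le> n \<Longrightarrow> x j \<le> 2 * (x 0 + (\<Sum>i=1..n. y i))"
    and "(\<Sum>i=1..n. z i) \<le> 2 * (x 0 + (\<Sum>i=1..n. y i))"
proof -
  define X where "X = Max (x ` {0..n})"
  have X: "x j \<le> X" if "j \<le> n" for j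
    unfolding X_def using that by (intro Max_ge) auto
  have "X \<in> x ` {0..n}" unfolding X_def by (intro Max_in) auto
  then obtain J where J: "J \<le> n" "X = x J" by auto
  have tel: "x j + (\<Sum>i=1..j. z i) \<le> x 0 + real j * (X / (2 * real n)) + (\<Sum>i=1..j. y i)"
    if "j \<le> n" for j
    using that
  proof (induction j)
    case (Suc j)
    have "x (Suc j) - x j + z (Suc j) \<le> x (Suc j) / (2 * real n) + y (Suc j)"
      using step[of "Suc j"] Suc.prems by simp
    moreover have "x (Suc j) / (2 * real n) \<le> X / (2 * real n)"
      using X[OF Suc.prems] by (simp add: divide_right_mono)
    ultimately show ?case using Suc by (simp add: algebra_simps add_divide_distrib)
  qed simp
  have X0: "0 \<le> X" using J nonneg by simp
  have half: "real j * (X / (2 * real n)) \<le> X / 2" if "j \<le> n" for j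
  proof -
    have "real j * (X / (2 * real n)) \<le> real n * (X / (2 * real n))"
      using that X0 by (intro mult_right_mono) auto
    then show ?thesis using n by simp
  qed
  have ys: "(\<Sum>i=1..j. y i) \<le> (\<Sum>i=1..n. y i)" if "j \<le> n" for j
    using that nonneg by (intro sum_mono2) auto
  have tel': "x j + (\<Sum>i=1..j. z i) \<le> x 0 + X / 2 + (\<Sum>i=1..n. y i)" if "j \<le> n" for j
    by (rule order_trans[OF tel[OF that]]) (intro add_mono half[OF that] ys[OF that] order_refl)
  have "0 \<le> (\<Sum>i=1..J. z i)" using nonneg J by (intro sum_nonneg) auto
  then have XX: "X \<le> 2 * (x 0 + (\<Sum>i=1..n. y i))"
    using tel'[OF J(1)] J(2) by (simp add: field_simps)
  then show "\<And>j. j \<le> n \<Longrightarrow> x j \<le> 2 * (x 0 + (\<Sum>i=1..n. y i))"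
    using X by fastforce
  show "(\<Sum>i=1..n. z i) \<le> 2 * (x 0 + (\<Sum>i=1..n. y i))"
    using tel'[of n] XX nonneg(1)[of n] by simp
qed

text \<open>This is the shape in which \<open>has_L2_time_deriv\<close> speaks of derivatives, and
  the one that yields limits of difference quotients.\<close>

lemma has_vector_derivative_iff_quotient:
  fixes u :: "real \<Rightarrow> 'a::real_normed_vector"
  shows "(u has_vector_derivative u') (at t within S) \<longleftrightarrow>
    ((\<lambda>s. norm ((1 / (s - t)) *\<^sub>R (u s - u t) - u')) \<longlongrightarrow> 0) (at t within S)"
proof -
  have "norm ((1 / norm (s - t)) *\<^sub>R (u s - (u t + (s - t) *\<^sub>R u')))
      = norm ((1 / (s - t)) *\<^sub>R (u s - u t) - u')" if "s \<noteq> t" for s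
  proof -
    have "norm ((1 / norm (s - t)) *\<^sub>R (u s - (u t + (s - t) *\<^sub>R u')))
        = norm ((1 / (s - t)) *\<^sub>R (u s - (u t + (s - t) *\<^sub>R u')))"
      by simp
    also have "(1 / (s - t)) *\<^sub>R (u s - (u t + (s - t) *\<^sub>R u')) = (1 / (s - t)) *\<^sub>R (u s - u t) - u'"
      using that by (simp add: scaleR_diff_right scaleR_add_right del: scaleR_left_diff_distrib)
    finally show ?thesis .
  qed
  then have ev: "\<forall>\<^sub>F s in at t within S. norm ((1 / norm (s - t)) *\<^sub>R (u s - (u t + (s - t) *\<^sub>R u')))
      = norm ((1 / (s - t)) *\<^sub>R (u s - u t) - u')"
    unfolding eventually_at_filter by simp
  have "(u has_vector_derivative u') (at t within S) \<longleftrightarrow>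
    ((\<lambda>s. norm ((1 / norm (s - t)) *\<^sub>R (u s - (u t + (s - t) *\<^sub>R u')))) \<longlongrightarrow> 0) (at t within S)"
    unfolding has_vector_derivative_def has_derivative_within tendsto_norm_zero_iff
    by (simp add: bounded_linear_scaleR_left)
  also have "\<dots> \<longleftrightarrow> ((\<lambda>s. norm ((1 / (s - t)) *\<^sub>R (u s - u t) - u')) \<longlongrightarrow> 0) (at t within S)"
    by (rule tendsto_cong[OF ev])
  finally show ?thesis .
qed

section \<open>Square integrable time derivatives expressed by moduli\<close>

definition time_modulus :: "real \<Rightarrow> (real \<Rightarrow> real) \<Rightarrow> bool" where
  "time_modulus T \<Phi> \<longleftrightarrow> continuous_on {0..T} \<Phi> \<and> mono_on {0..T} \<Phi>"

text \<open>For Hilbert space valued functions, a bound of this kind characterises \<open>H\<^sup>1(0,T)\<close>: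
  \<open>\<Phi>\<close> is the indefinite integral of the squared norm of the derivative.\<close>

definition has_modulus :: "real \<Rightarrow> (real \<Rightarrow> real) \<Rightarrow> (real \<Rightarrow> 'a::real_normed_vector) \<Rightarrow> bool" where
  "has_modulus T \<Phi> X \<longleftrightarrow>
     (\<forall>s t. 0 \<le> s \<longrightarrow> s \<le> t \<longrightarrow> t \<le> T \<longrightarrow> (norm (X t - X s))\<^sup>2 \<le> (t - s) * (\<Phi> t - \<Phi> s))"

lemma has_modulusD:
  "has_modulus T \<Phi> X \<Longrightarrow> 0 \<le> s \<Longrightarrow> s \<le> t \<Longrightarrow> t \<le> T \<Longrightarrow>
    (norm (X t - X s))\<^sup>2 \<le> (t - s) * (\<Phi> t - \<Phi> s)"
  by (auto simp: has_modulus_def)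

lemma time_modulus_mono:
  "time_modulus T \<Phi> \<Longrightarrow> 0 \<le> s \<Longrightarrow> s \<le> t \<Longrightarrow> t \<le> T \<Longrightarrow> \<Phi> s \<le> \<Phi> t"
  unfolding time_modulus_def mono_on_def by auto

text \<open>Monotonicity bounds every increment of \<open>\<Phi>\<close> by \<open>K\<close>, so
  \<open>X\<close> is even Hoelder continuous with exponent 1/2.\<close>

lemma has_modulus_continuous_on:
  assumes "time_modulus T \<Phi>" "has_modulus T \<Phi> X"
  shows "continuous_on {0..T} X"
proof (cases "0 \<le> T")
  case True
  define K where "K = \<Phi> T - \<Phi> 0"
  have K: "0 \<le> K" using time_modulus_mono[OF assms(1), of 0 T] True by (simp add: K_def)
  have *: "norm (X t - X s) \<le> sqrt (\<bar>t - s\<bar> * K)" if "s \<in> {0..T}" "t \<in> {0..T}" for s t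
  proof -
    have main: "norm (X t - X s) \<le> sqrt (\<bar>t - s\<bar> * K)" if "0 \<le> s" "s \<le> t" "t \<le> T" for s t
    proof (rule real_le_rsqrt)
      have "(norm (X t - X s))\<^sup>2 \<le> (t - s) * (\<Phi> t - \<Phi> s)"
        using that by (intro has_modulusD[OF assms(2)])
      also have "\<dots> \<le> (t - s) * K"
        unfolding K_def
        using time_modulus_mono[OF assms(1), of 0 s] time_modulus_mono[OF assms(1), of t T] that
        by (intro mult_left_mono) auto
      finally show "(norm (X t - X s))\<^sup>2 \<le> \<bar>t - s\<bar> * K" using that by simp
    qed
    show ?thesis
      using main[of s t] main[of t s] that
      by (cases "s \<le> t") (auto simp: norm_minus_commute abs_minus_commute)
  qed
  show ?thesis
    unfolding continuous_on_def
  proof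
    fix t assume t: "t \<in> {0..T}"
    have "((\<lambda>s. sqrt (\<bar>s - t\<bar> * K)) \<longlongrightarrow> sqrt (\<bar>t - t\<bar> * K)) (at t within {0..T})"
      by (intro tendsto_intros)
    moreover have "\<forall>\<^sub>F s in at t within {0..T}. norm (norm (X s - X t)) \<le> sqrt (\<bar>s - t\<bar> * K)"
      unfolding eventually_at_filter using *[OF t] by (intro always_eventually) auto
    ultimately have "((\<lambda>s. norm (X s - X t)) \<longlongrightarrow> 0) (at t within {0..T})"
      using Lim_null_comparison by fastforce
    then show "(X \<longlongrightarrow> X t) (at t within {0..T})"
      using Lim_null tendsto_norm_zero_iff by blast
  qed
qed auto

lemma nn_integral_continuous_interval:
  fixes f :: "real \<Rightarrow> real"
  assumes "continuous_on {a..b} f" "\<And>t. t \<in> {a..b} \<Longrightarrow> 0 \<le> f t"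
  shows "(\<integral>\<^sup>+t. ennreal (indicator {a..b} t * f t) \<partial>lborel) = ennreal (integral {a..b} f)"
proof -
  have int: "set_integrable lborel {a..b} f"
    using borel_integrable_atLeastAtMost'[OF assms(1)] .
  then have "(\<integral>\<^sup>+t. ennreal (indicator {a..b} t * f t) \<partial>lborel)
      = ennreal (LINT t:{a..b}|lborel. f t)"
    unfolding set_lebesgue_integral_def set_integrable_def
    using assms(2) by (subst nn_integral_eq_integral) (auto simp: indicator_def)
  then show ?thesis using set_borel_integral_eq_integral(2)[OF int] by simp
qed

text \<open>After the shift the two integrals cancel except for end pieces of length
  \<open>\<delta>\<close>, where \<open>\<Phi>\<close> is compared with its extreme values. Together
  with the factor \<open>\<delta>\<close> in \<open>has_modulus\<close> this makes the integrated
  squared increments of the data of order \<open>\<delta>\<close> squared.\<close>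

lemma integral_shift_increment_le:
  assumes \<Phi>: "time_modulus T \<Phi>" and \<delta>: "0 < \<delta>" "\<delta> < T"
  shows "integral {0..T-\<delta>} (\<lambda>t. \<Phi> (t + \<delta>) - \<Phi> t) \<le> \<delta> * (\<Phi> T - \<Phi> 0)"
proof -
  have cont: "continuous_on {0..T} \<Phi>" using \<Phi> by (simp add: time_modulus_def)
  have io: "\<Phi> integrable_on {c..e}" if "0 \<le> c" "e \<le> T" for c e
    using that by (intro integrable_continuous_real continuous_on_subset[OF cont]) auto
  have c1: "continuous_on {0 + \<delta>..T - \<delta> + \<delta>} \<Phi>"
    using \<delta> by (intro continuous_on_subset[OF cont]) auto
  have "continuous_on {0..T - \<delta>} (\<lambda>t. \<Phi> (t + \<delta>))"
    using \<delta> by (intro continuous_on_compose2[OF cont] continuous_intros) auto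
  then have "integral {0..T-\<delta>} (\<lambda>t. \<Phi> (t + \<delta>) - \<Phi> t)
      = integral {0..T-\<delta>} (\<lambda>t. \<Phi> (t + \<delta>)) - integral {0..T-\<delta>} \<Phi>"
    using \<delta> by (intro integral_diff io integrable_continuous_real) auto
  also have "integral {0..T-\<delta>} (\<lambda>t. \<Phi> (t + \<delta>)) = integral {\<delta>..T} \<Phi>"
    using integral_shift[OF c1] by (simp add: o_def)
  also have "integral {\<delta>..T} \<Phi> - integral {0..T-\<delta>} \<Phi> = integral {T-\<delta>..T} \<Phi> - integral {0..\<delta>} \<Phi>"
    using Henstock_Kurzweil_Integration.integral_combine[of 0 \<delta> T \<Phi>]
      Henstock_Kurzweil_Integration.integral_combine[of 0 "T - \<delta>" T \<Phi>] io \<delta> by simp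
  finally have eq: "integral {0..T-\<delta>} (\<lambda>t. \<Phi> (t + \<delta>) - \<Phi> t)
      = integral {T-\<delta>..T} \<Phi> - integral {0..\<delta>} \<Phi>" .
  have "integral {T-\<delta>..T} \<Phi> \<le> integral {T-\<delta>..T} (\<lambda>_. \<Phi> T)"
    using \<delta> by (intro integral_le io) (auto intro: time_modulus_mono[OF \<Phi>])
  moreover have "integral {0..\<delta>} \<Phi> \<ge> integral {0..\<delta>} (\<lambda>_. \<Phi> 0)"
    using \<delta> by (intro integral_le io) (auto intro: time_modulus_mono[OF \<Phi>])
  ultimately show ?thesis using \<delta> eq by (simp add: algebra_simps)
qed

text \<open>Fatou's lemma for the squared difference quotients \<open>F k\<close>, which converge
  pointwise to the squared norm of \<open>v'\<close>. No domination is available, since only the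
  integrals of the quotients are bounded.\<close>

lemma integral_norm_deriv_le:
  fixes v :: "real \<Rightarrow> 'a::real_inner"
  assumes T: "0 < T"
    and v: "\<And>t. t \<in> {0..T} \<Longrightarrow> (v has_vector_derivative v' t) (at t within {0..T})"
    and v': "continuous_on {0..T} v'"
    and \<delta>: "\<And>k. 0 < \<delta> k" "\<And>k. \<delta> k < T" "\<delta> \<longlonglongrightarrow> 0"
    and le: "\<And>k::nat. integral {0..T - \<delta> k} (\<lambda>t. (norm (v (t + \<delta> k) - v t))\<^sup>2) \<le> (\<delta> k)\<^sup>2 * B k"
    and B: "B \<longlonglongrightarrow> B0"
  shows "integral {0..T} (\<lambda>t. (norm (v' t))\<^sup>2) \<le> B0"
proof -
  define F where "F k t = indicator {0..T - \<delta> k} t * (norm (v (t + \<delta> k) - v t) / \<delta> k)\<^sup>2" for k t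
  have contv: "continuous_on {0..T} v"
    using v has_vector_derivative_continuous continuous_on_eq_continuous_within by blast
  have contk: "continuous_on {0..T - \<delta> k} (\<lambda>t. (norm (v (t + \<delta> k) - v t) / \<delta> k)\<^sup>2)" for k
    using \<delta>(1)[of k] \<delta>(2)[of k]
    by (intro continuous_intros continuous_on_compose2[OF contv]) auto
  have Fm: "(\<lambda>t. ennreal (F k t)) \<in> borel_measurable lborel" for k
    using borel_measurable_continuous_on_indicator[OF _ contk[of k]] unfolding F_def by simp
  have Fint: "(\<integral>\<^sup>+t. ennreal (F k t) \<partial>lborel) \<le> ennreal (B k)" for k
  proof -
    have "(\<integral>\<^sup>+t. ennreal (F k t) \<partial>lborel)
        = ennreal (integral {0..T - \<delta> k} (\<lambda>t. (norm (v (t + \<delta> k) - v t) / \<delta> k)\<^sup>2))"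
      unfolding F_def by (intro nn_integral_continuous_interval contk) simp
    also have "integral {0..T - \<delta> k} (\<lambda>t. (norm (v (t + \<delta> k) - v t) / \<delta> k)\<^sup>2)
        = integral {0..T - \<delta> k} (\<lambda>t. (norm (v (t + \<delta> k) - v t))\<^sup>2) / (\<delta> k)\<^sup>2"
      by (simp add: power_divide)
    also have "\<dots> \<le> B k"
      using le[of k] \<delta>(1)[of k] by (simp add: field_simps)
    finally show ?thesis by (simp add: ennreal_leI)
  qed
  have lim: "(\<lambda>k. F k t) \<longlonglongrightarrow> (norm (v' t))\<^sup>2" if t: "0 \<le> t" "t < T" for t
  proof -
    have ev: "\<forall>\<^sub>F k in sequentially. t + \<delta> k < T"
      using order_tendstoD(2)[OF tendsto_add[OF tendsto_const[of t] \<delta>(3)], of T] t by simp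
    have "((\<lambda>y. (1 / (y - t)) *\<^sub>R (v y - v t)) \<longlongrightarrow> v' t) (at t within {0..T})"
      using v[of t] t unfolding has_vector_derivative_iff_quotient
      by (simp add: tendsto_norm_zero_iff Lim_null[symmetric])
    moreover have "filterlim (\<lambda>k. t + \<delta> k) (at t within {0..T}) sequentially"
      unfolding filterlim_at
    proof
      show "(\<lambda>k. t + \<delta> k) \<longlonglongrightarrow> t"
        using tendsto_add[OF tendsto_const[of t] \<delta>(3)] by simp
      show "\<forall>\<^sub>F k in sequentially. t + \<delta> k \<in> {0..T} \<and> t + \<delta> k \<noteq> t"
        using ev by eventually_elim (use \<delta>(1) t in \<open>auto simp: less_imp_le less_imp_neq[symmetric]\<close>)
    qed
    ultimately have "(\<lambda>k. (1 / (t + \<delta> k - t)) *\<^sub>R (v (t + \<delta> k) - v t)) \<longlonglongrightarrow> v' t"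
      by (rule filterlim_compose)
    then have "(\<lambda>k. (norm ((1 / (t + \<delta> k - t)) *\<^sub>R (v (t + \<delta> k) - v t)))\<^sup>2) \<longlonglongrightarrow> (norm (v' t))\<^sup>2"
      by (intro tendsto_intros)
    moreover have "\<forall>\<^sub>F k in sequentially.
        (norm ((1 / (t + \<delta> k - t)) *\<^sub>R (v (t + \<delta> k) - v t)))\<^sup>2 = F k t"
      using ev by eventually_elim (use \<delta>(1) t in \<open>auto simp: F_def indicator_def less_imp_le\<close>)
    ultimately show ?thesis by (simp add: tendsto_cong)
  qed
  have "ennreal (integral {0..T} (\<lambda>t. (norm (v' t))\<^sup>2))
      = (\<integral>\<^sup>+t. ennreal (indicator {0..T} t * (norm (v' t))\<^sup>2) \<partial>lborel)"
    using v' by (intro nn_integral_continuous_interval[symmetric] continuous_intros) auto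
  also have "\<dots> \<le> (\<integral>\<^sup>+t. liminf (\<lambda>k. ennreal (F k t)) \<partial>lborel)"
  proof (rule nn_integral_mono_AE)
    \<comment> \<open>At \<open>T\<close> there is no forward difference quotient inside the
      interval, so this point is discarded.\<close>
    show "AE t in lborel. ennreal (indicator {0..T} t * (norm (v' t))\<^sup>2)
        \<le> liminf (\<lambda>k. ennreal (F k t))"
      using AE_lborel_singleton[of T]
    proof eventually_elim
      case (elim t)
      show ?case
      proof (cases "t \<in> {0..T}")
        case True
        then have "(\<lambda>k. ennreal (F k t)) \<longlonglongrightarrow> ennreal ((norm (v' t))\<^sup>2)"
          using elim by (intro tendsto_ennrealI lim) auto
        then have "liminf (\<lambda>k. ennreal (F k t)) = ennreal ((norm (v' t))\<^sup>2)"
          by (intro lim_imp_Liminf) auto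
        then show ?thesis using True by simp
      qed simp
    qed
  qed
  also have "\<dots> \<le> liminf (\<lambda>k. \<integral>\<^sup>+t. ennreal (F k t) \<partial>lborel)"
    by (intro nn_integral_liminf Fm)
  also have "\<dots> \<le> liminf (\<lambda>k. ennreal (B k))"
    by (intro Liminf_mono always_eventually allI Fint)
  also have "\<dots> = ennreal B0"
    using B by (intro lim_imp_Liminf tendsto_ennrealI) auto
  finally have "ennreal (integral {0..T} (\<lambda>t. (norm (v' t))\<^sup>2)) \<le> ennreal B0" .
  \<comment> \<open>\<open>ennreal\<close> sends negative numbers to 0, so the inequality can be
    read back in the reals only once \<open>B0\<close> is known to be nonnegative.\<close>
  moreover have "0 \<le> B k" for k
  proof -
    have "0 \<le> integral {0..T - \<delta> k} (\<lambda>t. (norm (v (t + \<delta> k) - v t))\<^sup>2)"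
      by (intro integral_nonneg integrable_continuous_real continuous_intros
          continuous_on_compose2[OF contv]) (use \<delta>(1)[of k] \<delta>(2)[of k] in auto)
    then have "0 \<le> (\<delta> k)\<^sup>2 * B k" using le[of k] by linarith
    then show ?thesis using \<delta>(1)[of k] by (simp add: zero_le_mult_iff)
  qed
  then have "0 \<le> B0" using B by (intro LIMSEQ_le_const) auto
  ultimately show ?thesis by (simp add: ennreal_le_iff)
qed

section \<open>Energy estimates\<close>

text \<open>\<open>V\<close> models the graph of the weak derivative over H^1_0, that is, pairs of a
  test function and its derivative; this replaces an unbounded operator with a domain.
  \<open>A\<close> and \<open>D\<close> model multiplication by the coefficients \<open>a\<close>
  and \<open>d\<close>.\<close>

locale energy_space =
  fixes V :: "('a::real_inner \<times> 'a) set" and A D :: "'a \<Rightarrow> 'a" and a_up d_lo d_up :: real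
  assumes V: "subspace V" and A: "linear A" and D: "linear D"
    and A_nonneg: "0 \<le> A x \<bullet> x" and A_bound: "norm (A x) \<le> a_up * norm x"
    and D_lower: "d_lo * (norm x)\<^sup>2 \<le> D x \<bullet> x" and d_lo: "0 < d_lo"
    and D_bound: "norm (D x) \<le> d_up * norm x"
begin

lemma V_diff: "(x, x') \<in> V \<Longrightarrow> (y, y') \<in> V \<Longrightarrow> (x - y, x' - y') \<in> V"
  using subspace_diff[OF V, of "(x, x')" "(y, y')"] by simp

lemma V_scale: "(x, x') \<in> V \<Longrightarrow> (c *\<^sub>R x, c *\<^sub>R x') \<in> V"
  using subspace_scale[OF V, of "(x, x')" c] by simp

lemma A_bound_power2: "(norm (A x))\<^sup>2 \<le> a_up\<^sup>2 * (norm x)\<^sup>2"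
  using power_mono[OF A_bound[of x], of 2] by (simp add: power_mult_distrib)

lemma D_bound_power2: "(norm (D x))\<^sup>2 \<le> d_up\<^sup>2 * (norm x)\<^sup>2"
  using power_mono[OF D_bound[of x], of 2] by (simp add: power_mult_distrib)

text \<open>The system with homogeneous boundary conditions. \<open>ux\<close> is the derivative of
  \<open>u\<close>. The source \<open>R\<close> is the time derivative of the shift of the flux and
  therefore enters with weight \<epsilon>.\<close>

definition hyperbolic ::
  "real \<Rightarrow> real \<Rightarrow> (real \<Rightarrow> 'a) \<Rightarrow> (real \<Rightarrow> 'a) \<Rightarrow> (real \<Rightarrow> 'a) \<Rightarrow>
   (real \<Rightarrow> 'a) \<Rightarrow> (real \<Rightarrow> 'a) \<Rightarrow> (real \<Rightarrow> 'a) \<Rightarrow> (real \<Rightarrow> 'a) \<Rightarrow> (real \<Rightarrow> 'a) \<Rightarrow> bool" where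
  "hyperbolic T \<epsilon> F G R u ux v u' v' \<longleftrightarrow> continuous_on {0..T} v' \<and>
     (\<forall>t\<in>{0..T}. (u has_vector_derivative u' t) (at t within {0..T}) \<and>
        (v has_vector_derivative v' t) (at t within {0..T}) \<and> (u t, ux t) \<in> V \<and>
        (\<forall>q qx. (q, qx) \<in> V \<longrightarrow> u' t \<bullet> q + A (u t) \<bullet> q - v t \<bullet> qx = G t \<bullet> q) \<and>
        \<epsilon> *\<^sub>R v' t + ux t + D (v t) = F t - \<epsilon> *\<^sub>R R t)"

text \<open>The difference of two time levels solves the same linear system with increments as data,
  and it is an admissible test function. The Gronwall rate 1 comes from the increment of
  \<open>G\<close> and gives \<open>exp T\<close>. The integral of the flux increments is kept
  through the damping, hence without a weight \<epsilon>.\<close>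

lemma difference_energy:
  assumes hyp: "hyperbolic T \<epsilon> F G R u ux v u' v'"
    and \<epsilon>: "0 < \<epsilon>" "\<epsilon> \<le> 1" and \<delta>: "0 < \<delta>" "\<delta> < T"
    and \<Phi>: "time_modulus T \<Phi>" "has_modulus T \<Phi> F" "has_modulus T \<Phi> G" "has_modulus T \<Phi> R"
  shows "integral {0..T-\<delta>} (\<lambda>t. (norm (v (t + \<delta>) - v t))\<^sup>2) \<le>
    exp T / d_lo * ((norm (u \<delta> - u 0))\<^sup>2 + \<epsilon> * (norm (v \<delta> - v 0))\<^sup>2
      + (1 + 4 / d_lo) * \<delta>\<^sup>2 * (\<Phi> T - \<Phi> 0))"
proof -
  define \<Delta> where "\<Delta> X t = X (t + \<delta>) - X t" for X :: "real \<Rightarrow> 'a" and t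
  define y where "y t = (norm (\<Delta> u t))\<^sup>2 + \<epsilon> * (norm (\<Delta> v t))\<^sup>2" for t
  define y' where "y' t = 2 * (\<Delta> u' t \<bullet> \<Delta> u t) + \<epsilon> * (2 * (\<Delta> v' t \<bullet> \<Delta> v t))" for t
  \<comment> \<open>The 1 belongs to \<open>G\<close>, tested with Young weight 1;
    \<open>4 / d_lo\<close> belongs to \<open>F - \<epsilon> R\<close>, whose squared increment is
    at most four times the bound for a single function.\<close>
  define c where "c = 1 + 4 / d_lo"
  define k where "k t = c * \<delta> * (\<Phi> (t + \<delta>) - \<Phi> t)" for t
  define w where "w t = d_lo * (norm (\<Delta> v t))\<^sup>2" for t
  have c0: "0 \<le> c" using d_lo by (simp add: c_def)
  have H: "(u has_vector_derivative u' t) (at t within {0..T})"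
    "(v has_vector_derivative v' t) (at t within {0..T})" "(u t, ux t) \<in> V"
    "\<And>q qx. (q, qx) \<in> V \<Longrightarrow> u' t \<bullet> q + A (u t) \<bullet> q - v t \<bullet> qx = G t \<bullet> q"
    "\<epsilon> *\<^sub>R v' t + ux t + D (v t) = F t - \<epsilon> *\<^sub>R R t" if "t \<in> {0..T}" for t
    using hyp that unfolding hyperbolic_def by blast+
  have dd: "(\<Delta> X has_vector_derivative \<Delta> X' t) (at t within {0..T-\<delta>})"
    if X: "\<And>t. t \<in> {0..T} \<Longrightarrow> (X has_vector_derivative X' t) (at t within {0..T})"
      and t: "t \<in> {0..T-\<delta>}" for X X' :: "real \<Rightarrow> 'a" and t
  proof -
    have "(X has_vector_derivative X' (t + \<delta>)) (at (t + \<delta>) within (\<lambda>t. t + \<delta>) ` {0..T-\<delta>})"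
      using t \<delta> by (intro has_vector_derivative_within_subset[OF X]) auto
    then have "((X \<circ> (\<lambda>t. t + \<delta>)) has_vector_derivative 1 *\<^sub>R X' (t + \<delta>)) (at t within {0..T-\<delta>})"
      by (intro vector_diff_chain_within) (auto intro!: derivative_eq_intros)
    then have "((\<lambda>t. X (t + \<delta>)) has_vector_derivative X' (t + \<delta>)) (at t within {0..T-\<delta>})"
      by (simp add: o_def)
    moreover have "(X has_vector_derivative X' t) (at t within {0..T-\<delta>})"
      using t \<delta> by (intro has_vector_derivative_within_subset[OF X]) auto
    ultimately show ?thesis unfolding \<Delta>_def by (rule has_vector_derivative_diff)
  qed
  have du: "(\<Delta> u has_vector_derivative \<Delta> u' t) (at t within {0..T-\<delta>})"
    and dv: "(\<Delta> v has_vector_derivative \<Delta> v' t) (at t within {0..T-\<delta>})" if "t \<in> {0..T-\<delta>}" for t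
    using that H by (auto intro: dd)
  have contv: "continuous_on {0..T-\<delta>} (\<Delta> v)"
    using dv has_vector_derivative_continuous continuous_on_eq_continuous_within by blast
  have der: "(y has_real_derivative y' t) (at t within {0..T-\<delta>})" if "t \<in> {0..T-\<delta>}" for t
    unfolding y_def y'_def
    by (intro DERIV_add DERIV_cmult has_real_derivative_norm_power2 du dv that)
  have est: "y' t \<le> 1 * y t + k t - w t" if t: "t \<in> {0..T-\<delta>}" for t
  proof -
    have t1: "t \<in> {0..T}" and t2: "t + \<delta> \<in> {0..T}" using t \<delta> by auto
    have q: "(\<Delta> u t, \<Delta> ux t) \<in> V"
      unfolding \<Delta>_def by (intro V_diff H t1 t2)
    have "\<Delta> u' t \<bullet> \<Delta> u t + A (\<Delta> u t) \<bullet> \<Delta> u t - \<Delta> v t \<bullet> \<Delta> ux t = \<Delta> G t \<bullet> \<Delta> u t"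
      using H(4)[OF t1 q] H(4)[OF t2 q]
      by (simp add: \<Delta>_def[of u'] \<Delta>_def[of v] \<Delta>_def[of G] \<Delta>_def[of u] linear_diff[OF A] inner_diff_left)
    moreover have eq2: "\<epsilon> *\<^sub>R \<Delta> v' t + \<Delta> ux t + D (\<Delta> v t) = \<Delta> F t - \<epsilon> *\<^sub>R \<Delta> R t"
      using arg_cong2[OF H(5)[OF t2] H(5)[OF t1], of minus]
      by (simp add: \<Delta>_def linear_diff[OF D] algebra_simps)
    have "\<epsilon> * (\<Delta> v' t \<bullet> \<Delta> v t) + \<Delta> ux t \<bullet> \<Delta> v t + D (\<Delta> v t) \<bullet> \<Delta> v t = (\<Delta> F t - \<epsilon> *\<^sub>R \<Delta> R t) \<bullet> \<Delta> v t"
      unfolding eq2[symmetric] by (simp add: inner_add_left)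
    \<comment> \<open>Adding the two tested equations cancels the coupling of
      \<open>\<Delta> v\<close> and \<open>\<Delta> ux\<close>: the system is skew-symmetric up to
      damping.\<close>
    ultimately have "y' t = 2 * (\<Delta> G t \<bullet> \<Delta> u t) + 2 * ((\<Delta> F t - \<epsilon> *\<^sub>R \<Delta> R t) \<bullet> \<Delta> v t)
        - 2 * (A (\<Delta> u t) \<bullet> \<Delta> u t) - 2 * (D (\<Delta> v t) \<bullet> \<Delta> v t)"
      unfolding y'_def by (simp add: algebra_simps inner_commute[of "\<Delta> ux t" "\<Delta> v t"])
    also have "\<dots> \<le> ((norm (\<Delta> G t))\<^sup>2 + (norm (\<Delta> u t))\<^sup>2)
        + ((norm (\<Delta> F t - \<epsilon> *\<^sub>R \<Delta> R t))\<^sup>2 / d_lo + d_lo * (norm (\<Delta> v t))\<^sup>2) - 2 * w t"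
      using two_inner_le[of 1 "\<Delta> G t" "\<Delta> u t"] two_inner_le[OF d_lo, of "\<Delta> F t - \<epsilon> *\<^sub>R \<Delta> R t" "\<Delta> v t"]
        A_nonneg[of "\<Delta> u t"] D_lower[of "\<Delta> v t"] by (simp add: w_def)
    finally have 1: "y' t \<le> (norm (\<Delta> G t))\<^sup>2 + (norm (\<Delta> u t))\<^sup>2
        + (norm (\<Delta> F t - \<epsilon> *\<^sub>R \<Delta> R t))\<^sup>2 / d_lo - w t" by (simp add: w_def)
    have mod: "(norm (\<Delta> X t))\<^sup>2 \<le> \<delta> * (\<Phi> (t + \<delta>) - \<Phi> t)" if "has_modulus T \<Phi> X" for X
      using has_modulusD[OF that, of t "t + \<delta>"] t \<delta> by (simp add: \<Delta>_def)
    have "(norm (\<epsilon> *\<^sub>R \<Delta> R t))\<^sup>2 \<le> (norm (\<Delta> R t))\<^sup>2"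
      using \<epsilon> by (intro power_mono) (auto intro: mult_left_le_one_le)
    then have "(norm (\<Delta> F t - \<epsilon> *\<^sub>R \<Delta> R t))\<^sup>2 \<le> 4 * (\<delta> * (\<Phi> (t + \<delta>) - \<Phi> t))"
      using norm_diff_power2_le[of "\<Delta> F t" "\<epsilon> *\<^sub>R \<Delta> R t"] mod[OF \<Phi>(2)] mod[OF \<Phi>(4)] by linarith
    then have "(norm (\<Delta> F t - \<epsilon> *\<^sub>R \<Delta> R t))\<^sup>2 / d_lo \<le> 4 * (\<delta> * (\<Phi> (t + \<delta>) - \<Phi> t)) / d_lo"
      using d_lo by (intro divide_right_mono) auto
    then have "(norm (\<Delta> G t))\<^sup>2 + (norm (\<Delta> F t - \<epsilon> *\<^sub>R \<Delta> R t))\<^sup>2 / d_lo \<le> k t"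
      using mod[OF \<Phi>(3)] by (simp add: k_def c_def algebra_simps)
    moreover have "(norm (\<Delta> u t))\<^sup>2 \<le> y t" using \<epsilon> by (simp add: y_def)
    ultimately show ?thesis using 1 by linarith
  qed
  have cphi: "continuous_on {0..T-\<delta>} (\<lambda>t. \<Phi> (t + \<delta>) - \<Phi> t)"
    using \<Phi>(1) \<delta> unfolding time_modulus_def
    by (intro continuous_intros continuous_on_compose2[where f = "\<lambda>t. t + \<delta>" and g = \<Phi> and t = "{0..T}"])
      (auto elim: continuous_on_subset)
  have "exp (- 1 * (T - \<delta> - 0)) * (y (T - \<delta>) + integral {0..T-\<delta>} w) \<le> y 0 + integral {0..T-\<delta>} k"
  proof (rule energy_gronwall[OF _ _ der est])
    show "continuous_on {0..T-\<delta>} k" unfolding k_def by (intro continuous_intros cphi)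
    show "0 \<le> k t" if "t \<in> {0..T-\<delta>}" for t
      using that \<delta> c0 time_modulus_mono[OF \<Phi>(1), of t "t + \<delta>"] by (simp add: k_def)
    show "continuous_on {0..T-\<delta>} w" unfolding w_def by (intro continuous_intros contv)
  qed (use \<delta> d_lo in \<open>auto simp: w_def\<close>)
  moreover have "integral {0..T-\<delta>} k = c * \<delta> * integral {0..T-\<delta>} (\<lambda>t. \<Phi> (t + \<delta>) - \<Phi> t)"
    unfolding k_def by simp
  moreover have "\<dots> \<le> c * \<delta> * (\<delta> * (\<Phi> T - \<Phi> 0))"
    using \<delta> c0 by (intro mult_left_mono integral_shift_increment_le \<Phi>) auto
  moreover have "0 \<le> y (T - \<delta>)" using \<epsilon> by (simp add: y_def)
  moreover have int0: "0 \<le> integral {0..T-\<delta>} w"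
    using d_lo by (intro integral_nonneg integrable_continuous_real)
      (auto simp: w_def intro!: continuous_intros contv)
  moreover have "exp (- 1 * (T - \<delta> - 0)) * integral {0..T-\<delta>} w \<le> exp (- 1 * (T - \<delta> - 0)) * (y (T - \<delta>) + integral {0..T-\<delta>} w)"
    using \<open>0 \<le> y (T - \<delta>)\<close> by (intro mult_left_mono) auto
  ultimately have "exp (- 1 * (T - \<delta> - 0)) * integral {0..T-\<delta>} w \<le> y 0 + c * \<delta> * (\<delta> * (\<Phi> T - \<Phi> 0))"
    by linarith
  moreover have "exp (- T) * integral {0..T-\<delta>} w \<le> exp (- 1 * (T - \<delta> - 0)) * integral {0..T-\<delta>} w"
    using \<delta> int0 by (intro mult_right_mono) auto
  ultimately have "exp (- T) * integral {0..T-\<delta>} w \<le> y 0 + c * \<delta> * (\<delta> * (\<Phi> T - \<Phi> 0))"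
    by linarith
  moreover have "integral {0..T-\<delta>} w = d_lo * integral {0..T-\<delta>} (\<lambda>t. (norm (\<Delta> v t))\<^sup>2)"
    unfolding w_def by simp
  ultimately show ?thesis
    using d_lo by (simp add: \<Delta>_def y_def c_def exp_minus field_simps power2_eq_square)
qed

text \<open>The velocity \<open>u' 0\<close> is not itself known to be a test function, but it is a
  limit of difference quotients that are. The element \<open>s\<close> trades their derivatives
  \<open>qx k\<close>, which need not converge, for the \<open>q k\<close>, which do. In the limit
  the squared norm of \<open>u' 0\<close> is an inner product with a fixed element, and
  Cauchy-Schwarz finishes.\<close>

lemma hyperbolic_initial_velocity:
  assumes T: "0 < T" and hyp: "hyperbolic T \<epsilon> F G R u ux v u' v'"
    and s: "\<And>q qx. (q, qx) \<in> V \<Longrightarrow> s \<bullet> q = v 0 \<bullet> qx"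
    and \<delta>: "\<And>k. 0 < \<delta> k" "\<And>k. \<delta> k < T"
    and lim: "(\<lambda>k. (1 / \<delta> k) *\<^sub>R (u (\<delta> k) - u 0)) \<longlonglongrightarrow> u' 0"
  shows "norm (u' 0) \<le> norm (G 0 - A (u 0) + s)"
proof -
  define q where "q k = (1 / \<delta> k) *\<^sub>R (u (\<delta> k) - u 0)" for k :: nat
  define qx where "qx k = (1 / \<delta> k) *\<^sub>R (ux (\<delta> k) - ux 0)" for k :: nat
  have V: "(u t, ux t) \<in> V" if "t \<in> {0..T}" for t using hyp that unfolding hyperbolic_def by blast
  have "(q k, qx k) \<in> V" for k
    unfolding q_def qx_def using \<delta>[of k] T by (intro V_scale V_diff V) auto
  moreover have "u' 0 \<bullet> q + A (u 0) \<bullet> q - v 0 \<bullet> qx = G 0 \<bullet> q" if "(q, qx) \<in> V" for q qx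
    using hyp T that unfolding hyperbolic_def by auto
  ultimately have "u' 0 \<bullet> q k = (G 0 - A (u 0) + s) \<bullet> q k" for k
    using s[of "q k" "qx k"] by (simp add: inner_add_left inner_diff_left algebra_simps)
  moreover have "(\<lambda>k. u' 0 \<bullet> q k) \<longlonglongrightarrow> u' 0 \<bullet> u' 0"
    "(\<lambda>k. (G 0 - A (u 0) + s) \<bullet> q k) \<longlonglongrightarrow> (G 0 - A (u 0) + s) \<bullet> u' 0"
    using lim[folded q_def] by (auto intro!: tendsto_inner)
  ultimately have "u' 0 \<bullet> u' 0 = (G 0 - A (u 0) + s) \<bullet> u' 0"
    using LIMSEQ_unique by force
  then have "norm (u' 0) * norm (u' 0) \<le> norm (G 0 - A (u 0) + s) * norm (u' 0)"
    using norm_cauchy_schwarz[of "G 0 - A (u 0) + s" "u' 0"]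
    by (simp add: power2_norm_eq_inner flip: power2_eq_square)
  then show ?thesis by (cases "u' 0 = 0") auto
qed

text \<open>The difference estimate divided by the square of the step, in the limit of vanishing
  step. What remains on the right are the initial velocities and the modulus of the data, all
  bounded without reference to \<epsilon>.\<close>

lemma hyperbolic_regularity:
  assumes T: "0 < T" and \<epsilon>: "0 < \<epsilon>" "\<epsilon> \<le> 1"
    and \<Phi>: "time_modulus T \<Phi>" "has_modulus T \<Phi> F" "has_modulus T \<Phi> G" "has_modulus T \<Phi> R"
    and hyp: "hyperbolic T \<epsilon> F G R u ux v u' v'"
    and compat: "D (v 0) = F 0 - ux 0"
    and s: "\<And>q qx. (q, qx) \<in> V \<Longrightarrow> s \<bullet> q = v 0 \<bullet> qx"
  shows "integral {0..T} (\<lambda>t. (norm (v' t))\<^sup>2) \<le>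
    exp T / d_lo * ((norm (G 0 - A (u 0) + s))\<^sup>2 + (norm (R 0))\<^sup>2 + (1 + 4 / d_lo) * (\<Phi> T - \<Phi> 0))"
proof -
  \<comment> \<open>The summand 2 keeps \<open>\<delta> 0\<close> strictly below
    \<open>T\<close>.\<close>
  define \<delta> where "\<delta> k = T / (real k + 2)" for k
  define B where "B k = exp T / d_lo * ((norm ((1 / \<delta> k) *\<^sub>R (u (\<delta> k) - u 0)))\<^sup>2
    + \<epsilon> * (norm ((1 / \<delta> k) *\<^sub>R (v (\<delta> k) - v 0)))\<^sup>2 + (1 + 4 / d_lo) * (\<Phi> T - \<Phi> 0))" for k
  have \<delta>: "0 < \<delta> k" "\<delta> k < T" for k
    using T by (auto simp: \<delta>_def field_simps add_pos_nonneg)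
  have \<delta>0: "\<delta> \<longlonglongrightarrow> 0" unfolding \<delta>_def by real_asymp
  have der: "(u has_vector_derivative u' t) (at t within {0..T})"
    "(v has_vector_derivative v' t) (at t within {0..T})" if "t \<in> {0..T}" for t
    using hyp that unfolding hyperbolic_def by blast+
  have lim: "(\<lambda>k. (1 / \<delta> k) *\<^sub>R (X (\<delta> k) - X 0)) \<longlonglongrightarrow> X'"
    if "(X has_vector_derivative X') (at 0 within {0..T})" for X and X' :: 'a
  proof -
    have "((\<lambda>y. (1 / (y - 0)) *\<^sub>R (X y - X 0)) \<longlongrightarrow> X') (at 0 within {0..T})"
      using that unfolding has_vector_derivative_iff_quotient
      by (simp add: tendsto_norm_zero_iff Lim_null[symmetric])
    moreover have "filterlim \<delta> (at 0 within {0..T}) sequentially"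
      unfolding filterlim_at using \<delta>0 \<delta> by (auto simp: less_imp_le less_imp_neq[symmetric])
    ultimately have "(\<lambda>k. (1 / (\<delta> k - 0)) *\<^sub>R (X (\<delta> k) - X 0)) \<longlonglongrightarrow> X'"
      by (rule filterlim_compose)
    then show ?thesis by simp
  qed
  have limu: "(\<lambda>k. (1 / \<delta> k) *\<^sub>R (u (\<delta> k) - u 0)) \<longlonglongrightarrow> u' 0"
    and limv: "(\<lambda>k. (1 / \<delta> k) *\<^sub>R (v (\<delta> k) - v 0)) \<longlonglongrightarrow> v' 0"
    using T by (auto intro!: lim der)
  have "B \<longlonglongrightarrow> exp T / d_lo * ((norm (u' 0))\<^sup>2 + \<epsilon> * (norm (v' 0))\<^sup>2 + (1 + 4 / d_lo) * (\<Phi> T - \<Phi> 0))"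
    unfolding B_def by (intro tendsto_intros limu limv)
  moreover have "integral {0..T - \<delta> k} (\<lambda>t. (norm (v (t + \<delta> k) - v t))\<^sup>2) \<le> (\<delta> k)\<^sup>2 * B k" for k
  proof -
    have n: "(\<delta> k)\<^sup>2 * (norm ((1 / \<delta> k) *\<^sub>R x))\<^sup>2 = (norm x)\<^sup>2" for x :: 'a
      using \<delta>[of k] by (simp add: power_divide)
    have "(\<delta> k)\<^sup>2 * (c * (X + \<epsilon> * Y + e * P)) = c * ((\<delta> k)\<^sup>2 * X + \<epsilon> * ((\<delta> k)\<^sup>2 * Y) + e * (\<delta> k)\<^sup>2 * P)"
      for c e X Y P :: real by (simp add: algebra_simps)
    then have "(\<delta> k)\<^sup>2 * B k = exp T / d_lo * ((norm (u (\<delta> k) - u 0))\<^sup>2 + \<epsilon> * (norm (v (\<delta> k) - v 0))\<^sup>2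
        + (1 + 4 / d_lo) * (\<delta> k)\<^sup>2 * (\<Phi> T - \<Phi> 0))"
      unfolding B_def by (simp only: n)
    then show ?thesis using difference_energy[OF hyp \<epsilon> \<delta>[of k] \<Phi>] by simp
  qed
  moreover have "continuous_on {0..T} v'" using hyp unfolding hyperbolic_def by blast
  ultimately have "integral {0..T} (\<lambda>t. (norm (v' t))\<^sup>2) \<le>
      exp T / d_lo * ((norm (u' 0))\<^sup>2 + \<epsilon> * (norm (v' 0))\<^sup>2 + (1 + 4 / d_lo) * (\<Phi> T - \<Phi> 0))"
    using integral_norm_deriv_le[OF T, of v v' \<delta> B] der \<delta> \<delta>0 by blast
  also have "\<dots> \<le> exp T / d_lo * ((norm (G 0 - A (u 0) + s))\<^sup>2 + (norm (R 0))\<^sup>2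
      + (1 + 4 / d_lo) * (\<Phi> T - \<Phi> 0))"
  proof -
    \<comment> \<open>By \<open>compat\<close> the flux equation at time 0 reduces to
      \<open>\<epsilon> v' 0 = - \<epsilon> R 0\<close>. Without this compatibility
      \<open>v' 0\<close> could be of size 1/\<epsilon>.\<close>
    have "\<epsilon> *\<^sub>R v' 0 + ux 0 + D (v 0) = F 0 - \<epsilon> *\<^sub>R R 0"
      using hyp T unfolding hyperbolic_def by auto
    then have "\<epsilon> *\<^sub>R v' 0 = \<epsilon> *\<^sub>R (- R 0)" by (simp add: compat algebra_simps eq_neg_iff_add_eq_0)
    then have "v' 0 = - R 0" using \<epsilon> by (simp del: scaleR_minus_right)
    then have "\<epsilon> * (norm (v' 0))\<^sup>2 \<le> (norm (R 0))\<^sup>2" using \<epsilon> by (simp add: mult_left_le_one_le)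
    moreover have "(norm (u' 0))\<^sup>2 \<le> (norm (G 0 - A (u 0) + s))\<^sup>2"
      using hyperbolic_initial_velocity[OF T hyp s \<delta> limu] by (intro power_mono) auto
    ultimately show ?thesis using d_lo by (intro mult_left_mono add_mono) auto
  qed
  finally show ?thesis .
qed

end

section \<open>The homogeneous Euler scheme and stability of its increments\<close>

abbreviation cell :: "real \<Rightarrow> nat \<Rightarrow> real set" where
  "cell \<tau> j \<equiv> {real (j - 1) * \<tau>..real j * \<tau>}"

lemma sum_integral_grid:
  fixes f :: "real \<Rightarrow> real"
  assumes "continuous_on {0..T} f" "0 \<le> \<tau>" "real m * \<tau> \<le> T"
  shows "(\<Sum>j=1..m. integral (cell \<tau> j) f) = integral {0..real m * \<tau>} f"
  using assms(3)
proof (induction m)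
  case (Suc m)
  have le: "real m * \<tau> \<le> real (Suc m) * \<tau>" "real m * \<tau> \<le> T"
    using assms(2) Suc.prems by (auto simp: algebra_simps)
  have "integral {0..real m * \<tau>} f + integral {real m * \<tau>..real (Suc m) * \<tau>} f
      = integral {0..real (Suc m) * \<tau>} f"
    using assms le Suc.prems
    by (intro Henstock_Kurzweil_Integration.integral_combine integrable_continuous_real)
      (auto elim: continuous_on_subset)
  then show ?case using Suc.IH le by simp
qed simp

lemma norm_add3_power2_le:
  fixes x y z :: "'a::real_normed_vector"
  shows "(norm (x + y + z))\<^sup>2 \<le> 4 * ((norm x)\<^sup>2 + (norm y)\<^sup>2 + (norm z)\<^sup>2)"
  using norm_add_power2_le[of "x + y" z] norm_add_power2_le[of x y] zero_le_power2[of "norm z"]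
  unfolding distrib_left by linarith

lemma norm_add4_power2_le:
  fixes x y z w :: "'a::real_normed_vector"
  shows "(norm (x + y + z + w))\<^sup>2 \<le> 4 * ((norm x)\<^sup>2 + (norm y)\<^sup>2 + (norm z)\<^sup>2 + (norm w)\<^sup>2)"
  using norm_add_power2_le[of "x + y" "z + w"] norm_add_power2_le[of x y] norm_add_power2_le[of z w]
  by (simp add: add.assoc)

text \<open>Everything a constant may depend on is fixed here, before \<epsilon>, the grid and the
  solutions enter, so independence of them is visible from the locale. One modulus
  \<open>\<Phi>\<close> serves all data, so that oscillations over the cells telescope.
  \<open>Rm\<close> bounds the source of weight \<epsilon>, and \<open>K\<close> the defects caused
  by the boundary values of the scheme.\<close>

locale evolution_data = energy_space V A D a_up d_lo d_up
  for V :: "('a::real_inner \<times> 'a) set" and A D :: "'a \<Rightarrow> 'a" and a_up d_lo d_up :: real +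
  fixes T :: real and \<Phi> :: "real \<Rightarrow> real" and F G R :: "real \<Rightarrow> 'a" and u0 ux0 v0 s :: 'a and Rm K :: real
  assumes T: "0 < T"
    and \<Phi>: "time_modulus T \<Phi>" "has_modulus T \<Phi> F" "has_modulus T \<Phi> G" "has_modulus T \<Phi> R"
    and compat: "D v0 = F 0 - ux0"
    and s: "\<And>q qx. (q, qx) \<in> V \<Longrightarrow> s \<bullet> q = v0 \<bullet> qx"
    and Rm: "\<And>t. t \<in> {0..T} \<Longrightarrow> (norm (R t))\<^sup>2 \<le> Rm"
    and K: "0 \<le> K"
begin

text \<open>The role of each constant: \<open>N_init\<close> bounds the squared initial velocity,
  \<open>C_vel\<close> the integral of the squared norm of \<open>v'\<close>, \<open>C_inc\<close>
  and \<open>C_incx\<close> the increments of the scheme in L^2 and of their derivatives,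
  \<open>C_step\<close> the sum of the local errors, \<open>C_fin\<close> the same after Gronwall,
  and \<open>C_int\<close> the integrated error.\<close>

definition "P_tot = \<Phi> T - \<Phi> 0"
definition "N_init = (norm (G 0 - A u0 + s))\<^sup>2"
definition "C_vel = exp T / d_lo * (N_init + (norm (R 0))\<^sup>2 + (1 + 4 / d_lo) * P_tot)"
definition "C_inc = 2 * (N_init + (8 * T + 4 / d_lo) * P_tot)"
definition "C_incx = 8 * P_tot + 2 * d_up\<^sup>2 * (C_inc / d_lo)"
definition "C_step = 4 * T * (a_up\<^sup>2 * (T * C_inc) + P_tot + K * T)
  + 4 / d_lo * (P_tot + K * T + 2 * Rm * T + C_incx) + 8 / d_lo * C_vel"
definition "C_fin = exp 1 * C_step"
definition "C_int = T * (2 * C_fin + 2 * C_inc + 8 * K + 8 * Rm) + 8 * P_tot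
  + (2 * d_up\<^sup>2 + 1) * (C_fin / d_lo) + 8 * C_vel"

lemma P_tot_nonneg: "0 \<le> P_tot"
  using time_modulus_mono[OF \<Phi>(1), of 0 T] T by (simp add: P_tot_def)

lemma Rm_nonneg: "0 \<le> Rm"
  using order_trans[OF zero_le_power2 Rm[of 0]] T by simp

lemma C_nonneg: "0 \<le> C_vel" "0 \<le> C_inc" "0 \<le> C_incx" "0 \<le> C_step" "0 \<le> C_fin" "0 \<le> C_int"
proof -
  have N: "0 \<le> N_init" by (simp add: N_init_def)
  show 1: "0 \<le> C_vel" using P_tot_nonneg N d_lo by (simp add: C_vel_def)
  show 2: "0 \<le> C_inc" using P_tot_nonneg N d_lo T by (simp add: C_inc_def)
  show 3: "0 \<le> C_incx" using P_tot_nonneg 2 d_lo by (simp add: C_incx_def)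
  show 4: "0 \<le> C_step" using P_tot_nonneg 1 2 3 d_lo T K Rm_nonneg by (simp add: C_step_def)
  show 5: "0 \<le> C_fin" using 4 by (simp add: C_fin_def)
  show "0 \<le> C_int" using P_tot_nonneg 1 2 5 d_lo T K Rm_nonneg by (simp add: C_int_def)
qed

text \<open>\<open>\<gamma>\<close> and \<open>\<phi>\<close> are the defects left when the
  accumulated boundary lifting of the scheme replaces the exact one. They are required to be of
  order \<tau>, and their increments to be controlled like those of the data. \<open>Z 0\<close> is
  a convention: the scheme computes no flux at time 0, but increments at \<open>j = 1\<close> need
  one.\<close>

definition euler ::
  "nat \<Rightarrow> (nat \<Rightarrow> 'a) \<Rightarrow> (nat \<Rightarrow> 'a) \<Rightarrow> (nat \<Rightarrow> 'a) \<Rightarrow> (nat \<Rightarrow> 'a) \<Rightarrow> (nat \<Rightarrow> 'a) \<Rightarrow> bool" where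
  "euler n \<gamma> \<phi> U Ux Z \<longleftrightarrow> (let \<tau> = T / real n in
     U 0 = u0 \<and> Ux 0 = ux0 \<and> Z 0 = v0 \<and> \<gamma> 0 = 0 \<and> \<phi> 0 = 0 \<and>
     (\<forall>j\<le>n. (U j, Ux j) \<in> V \<and> (norm (\<gamma> j))\<^sup>2 \<le> K * \<tau>\<^sup>2 \<and> (norm (\<phi> j))\<^sup>2 \<le> K * \<tau>\<^sup>2) \<and>
     (\<forall>j\<in>{1..n}.
        (norm (\<gamma> j - \<gamma> (j - 1)))\<^sup>2 \<le> \<tau> * (\<Phi> (real j * \<tau>) - \<Phi> (real (j - 1) * \<tau>)) \<and>
        (norm (\<phi> j - \<phi> (j - 1)))\<^sup>2 \<le> \<tau> * (\<Phi> (real j * \<tau>) - \<Phi> (real (j - 1) * \<tau>)) \<and>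
        (\<forall>q qx. (q, qx) \<in> V \<longrightarrow>
           (1 / \<tau>) *\<^sub>R (U j - U (j - 1)) \<bullet> q + A (U j) \<bullet> q - Z j \<bullet> qx = (G (real j * \<tau>) - \<gamma> j) \<bullet> q) \<and>
        Ux j + D (Z j) = F (real j * \<tau>) - \<phi> j))"

context
  fixes n :: nat and \<tau> :: real and \<gamma> \<phi> U Ux Z :: "nat \<Rightarrow> 'a"
  assumes n: "0 < n" and \<tau>: "\<tau> = T / real n" and eu: "euler n \<gamma> \<phi> U Ux Z"
begin

abbreviation "W j \<equiv> U j - U (j - 1)"
abbreviation "Wx j \<equiv> Ux j - Ux (j - 1)"
abbreviation "\<Delta>\<Phi> j \<equiv> \<Phi> (real j * \<tau>) - \<Phi> (real (j - 1) * \<tau>)"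

lemma \<tau>_pos: "0 < \<tau>" and n\<tau>: "real n * \<tau> = T"
  using n T by (auto simp: \<tau>)

lemma grid: "j \<le> n \<Longrightarrow> real j * \<tau> \<in> {0..T}"
  using \<tau>_pos n\<tau> mult_right_mono[of "real j" "real n" \<tau>] by auto

lemma grid_step: "j \<in> {1..n} \<Longrightarrow> real j * \<tau> - real (j - 1) * \<tau> = \<tau>"
  by (simp add: of_nat_diff algebra_simps)

lemma euD:
  "U 0 = u0" "Ux 0 = ux0" "Z 0 = v0" "\<gamma> 0 = 0" "\<phi> 0 = 0"
  "j \<le> n \<Longrightarrow> (U j, Ux j) \<in> V"
  "j \<le> n \<Longrightarrow> (norm (\<gamma> j))\<^sup>2 \<le> K * \<tau>\<^sup>2"
  "j \<le> n \<Longrightarrow> (norm (\<phi> j))\<^sup>2 \<le> K * \<tau>\<^sup>2"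
  "j \<in> {1..n} \<Longrightarrow> (norm (\<gamma> j - \<gamma> (j - 1)))\<^sup>2 \<le> \<tau> * \<Delta>\<Phi> j"
  "j \<in> {1..n} \<Longrightarrow> (norm (\<phi> j - \<phi> (j - 1)))\<^sup>2 \<le> \<tau> * \<Delta>\<Phi> j"
  "j \<in> {1..n} \<Longrightarrow> (q, qx) \<in> V \<Longrightarrow>
     (1 / \<tau>) *\<^sub>R W j \<bullet> q + A (U j) \<bullet> q - Z j \<bullet> qx = (G (real j * \<tau>) - \<gamma> j) \<bullet> q"
  "j \<in> {1..n} \<Longrightarrow> Ux j + D (Z j) = F (real j * \<tau>) - \<phi> j"
  using eu unfolding euler_def Let_def \<tau>[symmetric] by blast+

text \<open>Compatibility of the initial values is exactly the flux equation at index 0, where the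
  defect vanishes.\<close>

lemma eq2: "j \<le> n \<Longrightarrow> Ux j + D (Z j) = F (real j * \<tau>) - \<phi> j"
  using euD(12)[of j] euD(2,3,5) compat by (cases "j = 0") auto

lemma \<Delta>\<Phi>_nonneg: "j \<in> {1..n} \<Longrightarrow> 0 \<le> \<Delta>\<Phi> j"
  using time_modulus_mono[OF \<Phi>(1), of "real (j - 1) * \<tau>" "real j * \<tau>"] grid[of j] grid[of "j - 1"] \<tau>_pos
  by (auto intro!: mult_right_mono)

lemma sum_\<Delta>\<Phi>: "(\<Sum>j=1..n. \<Delta>\<Phi> j) = P_tot"
  using sum_telescope''[of 0 n "\<lambda>j. \<Phi> (real j * \<tau>)"] by (simp add: n\<tau> P_tot_def)

lemma mod_step:
  assumes X: "has_modulus T \<Phi> X" and j: "j \<in> {1..n}" and t: "t \<in> cell \<tau> j"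
  shows "(norm (X t - X (real j * \<tau>)))\<^sup>2 \<le> \<tau> * \<Delta>\<Phi> j"
proof -
  have g: "0 \<le> real (j - 1) * \<tau>" "real j * \<tau> \<le> T" using grid[of j] grid[of "j - 1"] j by auto
  have "(norm (X (real j * \<tau>) - X t))\<^sup>2 \<le> (real j * \<tau> - t) * (\<Phi> (real j * \<tau>) - \<Phi> t)"
    using t g by (intro has_modulusD[OF X]) auto
  also have "\<dots> \<le> \<tau> * \<Delta>\<Phi> j"
    using t g order_trans[OF g(1), of t] order_trans[OF _ g(2), of t] grid_step[OF j] \<tau>_pos
      time_modulus_mono[OF \<Phi>(1), of "real (j - 1) * \<tau>" t] time_modulus_mono[OF \<Phi>(1), of t "real j * \<tau>"]
    by (intro mult_mono) auto
  finally show ?thesis by (simp add: norm_minus_commute)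
qed

lemma mod_step':
  "has_modulus T \<Phi> X \<Longrightarrow> j \<in> {1..n} \<Longrightarrow>
    (norm (X (real j * \<tau>) - X (real (j - 1) * \<tau>)))\<^sup>2 \<le> \<tau> * \<Delta>\<Phi> j"
  using mod_step[of X j "real (j - 1) * \<tau>"] \<tau>_pos
  by (auto simp: norm_minus_commute mult_right_mono)

text \<open>The differenced scheme is an implicit Euler step for the increments, tested with the new
  increment. \<open>W' 0\<close> is a fictitious increment before the first one: \<tau> times the
  initial velocity suggested by the equation, so that the first equation also holds at index 0 and
  differencing is possible at \<open>j = 1\<close>.\<close>

lemma increment_energy:
  assumes j: "j \<in> {1..n}"
  defines "W' i \<equiv> if i = 0 then \<tau> *\<^sub>R (G 0 - A u0 + s) else W i"
  shows "(norm (W' j))\<^sup>2 - (norm (W' (j - 1)))\<^sup>2 + \<tau> * d_lo * (norm (Z j - Z (j - 1)))\<^sup>2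
    \<le> (norm (W' j))\<^sup>2 / (2 * real n) + \<tau>\<^sup>2 * (8 * T + 4 / d_lo) * \<Delta>\<Phi> j"
proof -
  define X where "X = (G (real j * \<tau>) - G (real (j - 1) * \<tau>)) - (\<gamma> j - \<gamma> (j - 1))"
  define Y where "Y = (F (real j * \<tau>) - F (real (j - 1) * \<tau>)) - (\<phi> j - \<phi> (j - 1))"
  define N where "N = Z j - Z (j - 1)"
  have jn: "j \<le> n" "j - 1 \<le> n" and W'j: "W' j = W j" using j by (auto simp: W'_def)
  have WV: "(W j, Wx j) \<in> V" by (intro V_diff euD jn)
  have X4: "(norm X)\<^sup>2 \<le> 4 * (\<tau> * \<Delta>\<Phi> j)"
    unfolding X_def
    using norm_diff_power2_le[of "G (real j * \<tau>) - G (real (j - 1) * \<tau>)" "\<gamma> j - \<gamma> (j - 1)"]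
      mod_step'[OF \<Phi>(3) j] euD(9)[OF j] by linarith
  have Y4: "(norm Y)\<^sup>2 \<le> 4 * (\<tau> * \<Delta>\<Phi> j)"
    unfolding Y_def
    using norm_diff_power2_le[of "F (real j * \<tau>) - F (real (j - 1) * \<tau>)" "\<phi> j - \<phi> (j - 1)"]
      mod_step'[OF \<Phi>(2) j] euD(10)[OF j] by linarith
  \<comment> \<open>For \<open>j = 1\<close> this is the definition of \<open>W' 0\<close>, with
    \<open>s\<close> standing for \<open>v0\<close> tested against derivatives; otherwise it is the
    scheme at the previous index.\<close>
  have prev: "(1 / \<tau>) *\<^sub>R W' (j - 1) \<bullet> q + A (U (j - 1)) \<bullet> q - Z (j - 1) \<bullet> qx
      = (G (real (j - 1) * \<tau>) - \<gamma> (j - 1)) \<bullet> q" if "(q, qx) \<in> V" for q qx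
  proof (cases "j = 1")
    case True
    then show ?thesis
      using s[OF that] \<tau>_pos
      by (simp add: W'_def euD(1,3,4) inner_add_left inner_diff_left)
  next
    case False
    then have "j - 1 \<in> {1..n}" using j by auto
    then show ?thesis using euD(11)[OF _ that, of "j - 1"] by (auto simp: W'_def)
  qed
  have "(1 / \<tau>) *\<^sub>R (W j - W' (j - 1)) \<bullet> W j + A (W j) \<bullet> W j - N \<bullet> Wx j = X \<bullet> W j"
    using euD(11)[OF j WV] prev[OF WV]
    by (simp add: X_def N_def linear_diff[OF A] inner_diff_left scaleR_diff_right diff_divide_distrib)
  moreover have eqx: "Wx j = Y - D N"
    using eq2[OF jn(1)] eq2[OF jn(2)] by (simp add: Y_def N_def linear_diff[OF D] algebra_simps)
  moreover have "N \<bullet> Wx j = Y \<bullet> N - D N \<bullet> N"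
    unfolding eqx by (simp add: inner_diff_right inner_commute[of N])
  ultimately have "((W j - W' (j - 1)) \<bullet> W j) / \<tau>
      = X \<bullet> W j + Y \<bullet> N - A (W j) \<bullet> W j - D N \<bullet> N"
    unfolding inner_scaleR_left by simp
  then have "(W j - W' (j - 1)) \<bullet> W j = \<tau> * (X \<bullet> W j + Y \<bullet> N - A (W j) \<bullet> W j - D N \<bullet> N)"
    using \<tau>_pos by (simp add: nonzero_divide_eq_eq mult.commute)
  then have "2 * ((W j - W' (j - 1)) \<bullet> W j)
      = \<tau> * (2 * (X \<bullet> W j) + 2 * (Y \<bullet> N) - 2 * (A (W j) \<bullet> W j) - 2 * (D N \<bullet> N))"
    by (simp only: distrib_left right_diff_distrib mult.left_commute)
  \<comment> \<open>With the weight \<open>1 / (2 * T)\<close> and the factor \<tau> =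
    \<open>T / n\<close> the term in \<open>W j\<close> becomes the \<open>1 / (2 * n)\<close> of
    the discrete Gronwall inequality.\<close>
  also have "\<dots> \<le> \<tau> * ((norm X)\<^sup>2 / (1 / (2 * T)) + (1 / (2 * T)) * (norm (W j))\<^sup>2
      + ((norm Y)\<^sup>2 / d_lo + d_lo * (norm N)\<^sup>2) - 2 * (d_lo * (norm N)\<^sup>2))"
    using two_inner_le[of "1 / (2 * T)" X "W j"] two_inner_le[OF d_lo, of Y N] A_nonneg[of "W j"]
      D_lower[of N] T \<tau>_pos by (intro mult_left_mono) auto
  also have "\<dots> = (norm (W j))\<^sup>2 / (2 * real n) + \<tau> * (2 * T * (norm X)\<^sup>2 + (norm Y)\<^sup>2 / d_lo)
      - \<tau> * d_lo * (norm N)\<^sup>2"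
    using T n by (simp add: \<tau> field_simps)
  also have "\<tau> * (2 * T * (norm X)\<^sup>2 + (norm Y)\<^sup>2 / d_lo)
      \<le> \<tau> * (2 * T * (4 * (\<tau> * \<Delta>\<Phi> j)) + 4 * (\<tau> * \<Delta>\<Phi> j) / d_lo)"
    using X4 Y4 \<tau>_pos T d_lo by (intro mult_left_mono add_mono divide_right_mono) auto
  also have "\<dots> = \<tau>\<^sup>2 * (8 * T + 4 / d_lo) * \<Delta>\<Phi> j"
    by (simp add: algebra_simps power2_eq_square add_divide_distrib diff_divide_distrib)
  finally have "2 * ((W j - W' (j - 1)) \<bullet> W j) \<le> (norm (W j))\<^sup>2 / (2 * real n)
      + \<tau>\<^sup>2 * (8 * T + 4 / d_lo) * \<Delta>\<Phi> j - \<tau> * d_lo * (norm N)\<^sup>2" by simp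
  \<comment> \<open>From the square of the difference of consecutive increments, the numerical
    dissipation of implicit Euler.\<close>
  moreover have "(norm (W j))\<^sup>2 - (norm (W' (j - 1)))\<^sup>2 \<le> 2 * ((W j - W' (j - 1)) \<bullet> W j)"
    using zero_le_power2[of "norm (W j - W' (j - 1))"] unfolding power2_norm_eq_inner
    by (simp add: inner_diff_left inner_diff_right inner_commute)
  ultimately show ?thesis unfolding W'j N_def by linarith
qed

text \<open>Start value and data are both of order \<tau> squared, the latter after telescoping
  \<open>\<Delta>\<Phi>\<close>. The first Gronwall conclusion bounds \<open>W\<close>, the second
  the increments of the flux; those of \<open>Ux\<close> follow from the differenced flux
  equation.\<close>

lemma increments:
  shows "\<And>j. j \<in> {1..n} \<Longrightarrow> (norm (W j))\<^sup>2 \<le> \<tau>\<^sup>2 * C_inc"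
    and "(\<Sum>j=1..n. \<tau> * (norm (Wx j))\<^sup>2) \<le> \<tau>\<^sup>2 * C_incx"
proof -
  define W' where "W' i = (if i = 0 then \<tau> *\<^sub>R (G 0 - A u0 + s) else W i)" for i
  define c where "c = 8 * T + 4 / d_lo"
  have c: "0 \<le> c" using T d_lo by (simp add: c_def)
  have W'0: "(norm (W' 0))\<^sup>2 = \<tau>\<^sup>2 * N_init"
    by (simp add: W'_def N_init_def power_mult_distrib)
  have tot: "2 * ((norm (W' 0))\<^sup>2 + (\<Sum>i=1..n. \<tau>\<^sup>2 * c * \<Delta>\<Phi> i)) = \<tau>\<^sup>2 * C_inc"
    unfolding sum_distrib_left[symmetric] sum_\<Delta>\<Phi> W'0
    by (simp add: C_inc_def c_def algebra_simps)
  note gr = discrete_gronwall[OF n, of "\<lambda>j. (norm (W' j))\<^sup>2" "\<lambda>i. \<tau>\<^sup>2 * c * \<Delta>\<Phi> i"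
      "\<lambda>i. \<tau> * d_lo * (norm (Z i - Z (i - 1)))\<^sup>2", unfolded tot]
  have a: "0 \<le> \<tau>\<^sup>2 * c * \<Delta>\<Phi> i" if "i \<in> {1..n}" for i
    using \<Delta>\<Phi>_nonneg[OF that] c by simp
  have b: "0 \<le> \<tau> * d_lo * (norm (Z i - Z (i - 1)))\<^sup>2" for i
    using \<tau>_pos d_lo by simp
  note st = increment_energy[folded c_def W'_def]
  show "(norm (W j))\<^sup>2 \<le> \<tau>\<^sup>2 * C_inc" if "j \<in> {1..n}" for j
    using gr(1)[of j] a b st that by (auto simp: W'_def)
  have "(\<Sum>i=1..n. \<tau> * d_lo * (norm (Z i - Z (i - 1)))\<^sup>2) \<le> \<tau>\<^sup>2 * C_inc"
    using gr(2) a b st by auto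
  then have Zs: "(\<Sum>i=1..n. \<tau> * (norm (Z i - Z (i - 1)))\<^sup>2) \<le> \<tau>\<^sup>2 * C_inc / d_lo"
    using d_lo by (simp add: field_simps sum_distrib_left)
  have "(norm (Wx j))\<^sup>2 \<le> 8 * (\<tau> * \<Delta>\<Phi> j) + 2 * d_up\<^sup>2 * (norm (Z j - Z (j - 1)))\<^sup>2"
    if j: "j \<in> {1..n}" for j
  proof -
    define Y where "Y = (F (real j * \<tau>) - F (real (j - 1) * \<tau>)) - (\<phi> j - \<phi> (j - 1))"
    have Y4: "(norm Y)\<^sup>2 \<le> 4 * (\<tau> * \<Delta>\<Phi> j)"
      unfolding Y_def
      using norm_diff_power2_le[of "F (real j * \<tau>) - F (real (j - 1) * \<tau>)" "\<phi> j - \<phi> (j - 1)"]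
        mod_step'[OF \<Phi>(2) j] euD(10)[OF j] by linarith
    have jn: "j \<le> n" "j - 1 \<le> n" using j by auto
    have "Wx j = Y - D (Z j - Z (j - 1))"
      using eq2[OF jn(1)] eq2[OF jn(2)] by (simp add: Y_def linear_diff[OF D] algebra_simps)
    then show ?thesis
      using norm_diff_power2_le[of Y "D (Z j - Z (j - 1))"] Y4 D_bound_power2[of "Z j - Z (j - 1)"]
      by simp
  qed
  then have "(\<Sum>j=1..n. \<tau> * (norm (Wx j))\<^sup>2)
      \<le> (\<Sum>j=1..n. \<tau> * (8 * (\<tau> * \<Delta>\<Phi> j) + 2 * d_up\<^sup>2 * (norm (Z j - Z (j - 1)))\<^sup>2))"
    using \<tau>_pos by (intro sum_mono mult_left_mono) auto
  also have "\<dots> = 8 * \<tau>\<^sup>2 * (\<Sum>j=1..n. \<Delta>\<Phi> j) + 2 * d_up\<^sup>2 * (\<Sum>j=1..n. \<tau> * (norm (Z j - Z (j - 1)))\<^sup>2)"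
    unfolding sum_distrib_left sum.distrib[symmetric]
    by (intro sum.cong) (auto simp: algebra_simps power2_eq_square)
  also have "\<dots> \<le> 8 * \<tau>\<^sup>2 * P_tot + 2 * d_up\<^sup>2 * (\<tau>\<^sup>2 * C_inc / d_lo)"
    unfolding sum_\<Delta>\<Phi> by (intro add_mono mult_left_mono Zs) auto
  also have "\<dots> = \<tau>\<^sup>2 * C_incx" by (simp add: C_incx_def algebra_simps)
  finally show "(\<Sum>j=1..n. \<tau> * (norm (Wx j))\<^sup>2) \<le> \<tau>\<^sup>2 * C_incx" .
qed

section \<open>Error between the scheme and the hyperbolic solution\<close>

context
  fixes \<epsilon> :: real and u ux v u' v' :: "real \<Rightarrow> 'a"
  assumes \<epsilon>: "0 < \<epsilon>" "\<epsilon> \<le> 1" and hyp: "hyperbolic T \<epsilon> F G R u ux v u' v'"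
    and init: "u 0 = u0" "ux 0 = ux0" "v 0 = v0"
begin

lemma hypD:
  assumes "t \<in> {0..T}"
  shows "(u has_vector_derivative u' t) (at t within {0..T})"
    "(v has_vector_derivative v' t) (at t within {0..T})" "(u t, ux t) \<in> V"
    "(q, qx) \<in> V \<Longrightarrow> u' t \<bullet> q + A (u t) \<bullet> q - v t \<bullet> qx = G t \<bullet> q"
    "\<epsilon> *\<^sub>R v' t + ux t + D (v t) = F t - \<epsilon> *\<^sub>R R t"
  using hyp assms unfolding hyperbolic_def by blast+

lemma cont_v': "continuous_on {0..T} v'"
  using hyp unfolding hyperbolic_def by blast

lemma cont_v: "continuous_on {0..T} v"
  using hypD(2) has_vector_derivative_continuous continuous_on_eq_continuous_within by blast

lemma integral_v': "integral {0..T} (\<lambda>t. (norm (v' t))\<^sup>2) \<le> C_vel"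
  using hyperbolic_regularity[OF T \<epsilon> \<Phi> hyp] compat s
  by (simp add: init C_vel_def N_init_def P_tot_def)

text \<open>The part of the squared remainders of \<open>euler_step\<close> that is constant on a
  cell. \<open>omg\<close> is the integral of the whole bound over the cell, including the
  contribution of \<open>v'\<close>. The factor 4 comes from splitting a norm into three or four
  summands, \<open>T\<close> and \<open>1 / d_lo\<close> from the Young weights.\<close>

definition "kap j = 4 * T * (a_up\<^sup>2 * (norm (W j))\<^sup>2 + \<tau> * \<Delta>\<Phi> j + K * \<tau>\<^sup>2)
  + 4 / d_lo * (\<tau> * \<Delta>\<Phi> j + K * \<tau>\<^sup>2 + 2 * \<epsilon>\<^sup>2 * Rm + (norm (Wx j))\<^sup>2)"

definition "omg j = \<tau> * kap j
  + 8 / d_lo * \<epsilon>\<^sup>2 * integral (cell \<tau> j) (\<lambda>t. (norm (v' t))\<^sup>2)"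

lemma interval_subset:
  assumes "j \<in> {1..n}" shows "cell \<tau> j \<subseteq> {0..T}"
proof -
  have "0 \<le> real (j - 1) * \<tau>" "real j * \<tau> \<le> T" using grid[of j] grid[of "j - 1"] assms by auto
  then show ?thesis by (auto intro: order_trans)
qed

lemma kap_nonneg: "j \<in> {1..n} \<Longrightarrow> 0 \<le> kap j"
  using T d_lo K Rm_nonneg \<Delta>\<Phi>_nonneg[of j] \<tau>_pos unfolding kap_def
  by (intro add_nonneg_nonneg mult_nonneg_nonneg) auto

lemma velocity_term: "t \<in> {0..T} \<Longrightarrow>
    (norm (\<epsilon> *\<^sub>R (R t + v' t)))\<^sup>2 \<le> 2 * \<epsilon>\<^sup>2 * Rm + 2 * \<epsilon>\<^sup>2 * (norm (v' t))\<^sup>2"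
proof -
  assume "t \<in> {0..T}"
  then have "(norm (R t + v' t))\<^sup>2 \<le> 2 * Rm + 2 * (norm (v' t))\<^sup>2"
    using norm_add_power2_le[of "R t" "v' t"] Rm by fastforce
  then have "\<epsilon>\<^sup>2 * (norm (R t + v' t))\<^sup>2 \<le> \<epsilon>\<^sup>2 * (2 * Rm + 2 * (norm (v' t))\<^sup>2)"
    by (intro mult_left_mono) auto
  moreover have "(norm (\<epsilon> *\<^sub>R (R t + v' t)))\<^sup>2 = \<epsilon>\<^sup>2 * (norm (R t + v' t))\<^sup>2"
    by (simp add: power_mult_distrib)
  ultimately show ?thesis by (simp only: distrib_left mult.left_commute mult.assoc)
qed

lemma flux_error:
  assumes j: "j \<in> {1..n}" and t: "t \<in> cell \<tau> j"
  shows "ux t - Ux j = (F t - F (real j * \<tau>)) + \<phi> j + (- (\<epsilon> *\<^sub>R (R t + v' t))) - D (v t - Z j)"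
proof -
  have "t \<in> {0..T}" using t interval_subset[OF j] by blast
  then show ?thesis
    using hypD(5)[of t] euD(12)[OF j] by (simp add: linear_diff[OF D] algebra_simps)
qed

text \<open>The error against the interpolant belongs to \<open>V\<close>, since the nodal values
  do, and is tested with itself. The Gronwall rate \<open>1 / T\<close> on a cell of length
  \<open>T / n\<close> costs the factor \<open>exp (1 / n)\<close>, so that all cells together cost
  at most \<open>e\<close>.\<close>

lemma euler_step:
  assumes j: "j \<in> {1..n}" and t: "t \<in> cell \<tau> j"
  shows "(norm (u t - (U j - ((real j * \<tau> - t) / \<tau>) *\<^sub>R W j)))\<^sup>2
      + d_lo * integral {real (j - 1) * \<tau>..t} (\<lambda>t. (norm (v t - Z j))\<^sup>2)
    \<le> exp (1 / real n) * ((norm (u (real (j - 1) * \<tau>) - U (j - 1)))\<^sup>2 + omg j)"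
proof -
  define t0 where "t0 = real (j - 1) * \<tau>"
  define t1 where "t1 = real j * \<tau>"
  \<comment> \<open>The weight is 1 at the left and 0 at the right node, so
    \<open>U j - \<theta> W j\<close> runs from \<open>U (j - 1)\<close> to
    \<open>U j\<close>.\<close>
  define \<theta> where "\<theta> t = (t1 - t) / \<tau>" for t
  define E where "E t = u t - (U j - \<theta> t *\<^sub>R W j)" for t
  define Ex where "Ex t = ux t - (Ux j - \<theta> t *\<^sub>R Wx j)" for t
  define E' where "E' t = u' t - (1 / \<tau>) *\<^sub>R W j" for t
  \<comment> \<open>The flux is compared with the constant \<open>Z j\<close>, not with an
    interpolant: the scheme ties \<open>Z j\<close> to the slope \<open>W j / \<tau>\<close> of the
    interpolant on the whole cell.\<close>
  define N where "N t = v t - Z j" for t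
  define k where "k t = kap j + 8 / d_lo * \<epsilon>\<^sup>2 * (norm (v' t))\<^sup>2" for t
  define w where "w t = d_lo * (norm (N t))\<^sup>2" for t
  have tt: "t0 \<le> t" "t \<le> t1" and step: "t1 - t0 = \<tau>"
    using t grid_step[OF j] by (auto simp: t0_def t1_def)
  have sub1: "{t0..t1} \<subseteq> {0..T}" using interval_subset[OF j] by (simp add: t0_def t1_def)
  have sub: "{t0..t} \<subseteq> {0..T}" and sub2: "{t0..t} \<subseteq> {t0..t1}" using sub1 tt by auto
  have \<theta>: "0 \<le> \<theta> r" "\<theta> r \<le> 1" if "r \<in> {t0..t}" for r
    using that tt step \<tau>_pos by (auto simp: \<theta>_def field_simps)
  have \<theta>0: "\<theta> t0 = 1" using step \<tau>_pos by (simp add: \<theta>_def)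
  have der: "((\<lambda>r. (norm (E r))\<^sup>2) has_real_derivative 2 * (E' r \<bullet> E r)) (at r within {t0..t})"
    if r: "r \<in> {t0..t}" for r
  proof (rule has_real_derivative_norm_power2)
    have "(u has_vector_derivative u' r) (at r within {t0..t})"
      using r sub by (intro has_vector_derivative_within_subset[OF hypD(1)]) auto
    moreover have "(\<theta> has_real_derivative - 1 / \<tau>) (at r within {t0..t})"
      unfolding \<theta>_def using \<tau>_pos by (auto intro!: derivative_eq_intros)
    then have "((\<lambda>r. \<theta> r *\<^sub>R W j) has_vector_derivative (\<theta> r *\<^sub>R 0 + (- 1 / \<tau>) *\<^sub>R W j)) (at r within {t0..t})"
      by (intro has_vector_derivative_scaleR has_vector_derivative_const)
    ultimately have "(E has_vector_derivative (u' r - (0 - (\<theta> r *\<^sub>R 0 + (- 1 / \<tau>) *\<^sub>R W j)))) (at r within {t0..t})"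
      unfolding E_def by (intro has_vector_derivative_diff has_vector_derivative_const)
    then show "(E has_vector_derivative E' r) (at r within {t0..t})" by (simp add: E'_def)
  qed
  have est: "2 * (E' r \<bullet> E r) \<le> 1 / T * (norm (E r))\<^sup>2 + k r - w r" if r: "r \<in> {t0..t}" for r
  proof -
    have rT: "r \<in> {0..T}" and rI: "r \<in> cell \<tau> j"
      using r sub sub2 by (auto simp: t0_def t1_def)
    \<comment> \<open>\<open>X\<close> and \<open>Y\<close> collect the remainders: the scheme holds
      at \<open>U j\<close> instead of the interpolant, hence the terms in \<open>\<theta>\<close>;
      its data are frozen at the right node; its boundary values carry defects; and it drops the
      velocity term of weight \<epsilon>.\<close>
    define X where "X = \<theta> r *\<^sub>R A (W j) + (G r - G t1) + \<gamma> j"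
    define Y where "Y = (F r - F t1) + \<phi> j + (- (\<epsilon> *\<^sub>R (R r + v' r))) + \<theta> r *\<^sub>R Wx j"
    have jn: "j \<le> n" "j - 1 \<le> n" using j by auto
    have EV: "(E r, Ex r) \<in> V"
      unfolding E_def Ex_def by (intro V_diff V_scale hypD(3) euD(6) rT jn)
    have AE: "A (E r) = A (u r) - A (U j) + \<theta> r *\<^sub>R A (W j)"
      by (simp add: E_def linear_diff[OF A] linear_cmul[OF A])
    have "E' r \<bullet> E r + (A (u r) - A (U j)) \<bullet> E r - N r \<bullet> Ex r = (G r - G t1 + \<gamma> j) \<bullet> E r"
      using hypD(4)[OF rT EV] euD(11)[OF j EV]
      by (simp add: E'_def N_def inner_diff_left inner_add_left t1_def)
    then have 1: "E' r \<bullet> E r = X \<bullet> E r - A (E r) \<bullet> E r + N r \<bullet> Ex r"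
      by (simp add: X_def AE inner_add_left inner_diff_left)
    have "Ex r = Y - D (N r)"
      using flux_error[OF j rI] unfolding Ex_def Y_def N_def t1_def by (simp add: algebra_simps)
    then have "N r \<bullet> Ex r = Y \<bullet> N r - D (N r) \<bullet> N r"
      by (simp add: inner_diff_right inner_commute[of "N r"])
    with 1 have "2 * (E' r \<bullet> E r) = 2 * (X \<bullet> E r) - 2 * (A (E r) \<bullet> E r) + 2 * (Y \<bullet> N r) - 2 * (D (N r) \<bullet> N r)"
      by linarith
    also have "\<dots> \<le> ((norm X)\<^sup>2 / (1 / T) + 1 / T * (norm (E r))\<^sup>2)
        + ((norm Y)\<^sup>2 / d_lo + d_lo * (norm (N r))\<^sup>2) - 2 * (d_lo * (norm (N r))\<^sup>2)"
      using two_inner_le[of "1 / T" X "E r"] T two_inner_le[OF d_lo, of Y "N r"]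
        A_nonneg[of "E r"] D_lower[of "N r"] by auto
    finally have 2: "2 * (E' r \<bullet> E r) \<le> 1 / T * (norm (E r))\<^sup>2 + (T * (norm X)\<^sup>2 + (norm Y)\<^sup>2 / d_lo) - w r"
      by (simp add: w_def algebra_simps)
    have scl: "(norm (\<theta> r *\<^sub>R x))\<^sup>2 \<le> (norm x)\<^sup>2" for x :: 'a
      using \<theta>[OF r] by (intro power_mono) (auto intro: mult_left_le_one_le)
    have "(norm X)\<^sup>2 \<le> 4 * ((norm (\<theta> r *\<^sub>R A (W j)))\<^sup>2 + (norm (G r - G t1))\<^sup>2 + (norm (\<gamma> j))\<^sup>2)"
      unfolding X_def by (rule norm_add3_power2_le)
    also have "\<dots> \<le> 4 * (a_up\<^sup>2 * (norm (W j))\<^sup>2 + \<tau> * \<Delta>\<Phi> j + K * \<tau>\<^sup>2)"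
      using order_trans[OF scl A_bound_power2] mod_step[OF \<Phi>(3) j rI] euD(7)[OF jn(1)]
      by (intro mult_left_mono add_mono) (auto simp: t1_def)
    finally have X: "T * (norm X)\<^sup>2 \<le> T * (4 * (a_up\<^sup>2 * (norm (W j))\<^sup>2 + \<tau> * \<Delta>\<Phi> j + K * \<tau>\<^sup>2))"
      using T by (intro mult_left_mono) auto
    have "(norm Y)\<^sup>2 \<le> 4 * ((norm (F r - F t1))\<^sup>2 + (norm (\<phi> j))\<^sup>2
        + (norm (- (\<epsilon> *\<^sub>R (R r + v' r))))\<^sup>2 + (norm (\<theta> r *\<^sub>R Wx j))\<^sup>2)"
      unfolding Y_def by (rule norm_add4_power2_le)
    also have "\<dots> \<le> 4 * (\<tau> * \<Delta>\<Phi> j + K * \<tau>\<^sup>2 + (2 * \<epsilon>\<^sup>2 * Rm + 2 * \<epsilon>\<^sup>2 * (norm (v' r))\<^sup>2) + (norm (Wx j))\<^sup>2)"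
      unfolding norm_minus_cancel
      using scl mod_step[OF \<Phi>(2) j rI] euD(8)[OF jn(1)] velocity_term[OF rT]
      by (intro mult_left_mono add_mono) (auto simp: t1_def)
    finally have "(norm Y)\<^sup>2 / d_lo \<le> 4 * (\<tau> * \<Delta>\<Phi> j + K * \<tau>\<^sup>2
        + (2 * \<epsilon>\<^sup>2 * Rm + 2 * \<epsilon>\<^sup>2 * (norm (v' r))\<^sup>2) + (norm (Wx j))\<^sup>2) / d_lo"
      using d_lo by (intro divide_right_mono) auto
    with X have "T * (norm X)\<^sup>2 + (norm Y)\<^sup>2 / d_lo \<le> T * (4 * (a_up\<^sup>2 * (norm (W j))\<^sup>2 + \<tau> * \<Delta>\<Phi> j + K * \<tau>\<^sup>2))
      + 4 * (\<tau> * \<Delta>\<Phi> j + K * \<tau>\<^sup>2 + (2 * \<epsilon>\<^sup>2 * Rm + 2 * \<epsilon>\<^sup>2 * (norm (v' r))\<^sup>2) + (norm (Wx j))\<^sup>2) / d_lo"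
      by (rule add_mono)
    also have "\<dots> = k r"
      using d_lo unfolding k_def kap_def by (simp add: field_simps)
    finally show ?thesis using 2 by linarith
  qed
  have contk: "continuous_on {0..T} k"
    unfolding k_def by (intro continuous_intros cont_v')
  have k0: "0 \<le> k r" for r
    using kap_nonneg[OF j] d_lo by (simp add: k_def)
  have "exp (- (1 / T) * (t - t0)) * ((norm (E t))\<^sup>2 + integral {t0..t} w) \<le> (norm (E t0))\<^sup>2 + integral {t0..t} k"
  proof (rule energy_gronwall[OF _ _ der est])
    show "continuous_on {t0..t} k" using contk sub by (rule continuous_on_subset)
    show "continuous_on {t0..t} w"
      unfolding w_def N_def by (intro continuous_intros continuous_on_subset[OF cont_v sub])
  qed (use tt T d_lo k0 in \<open>auto simp: w_def\<close>)
  also have "integral {t0..t} k \<le> integral {t0..t1} k"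
    using k0 sub2 contk sub sub1
    by (intro integral_subset_le integrable_continuous_real) (auto elim: continuous_on_subset)
  also have "integral {t0..t1} k = omg j"
  proof -
    have "(\<lambda>t. (norm (v' t))\<^sup>2) integrable_on {t0..t1}"
      by (intro integrable_continuous_real continuous_intros continuous_on_subset[OF cont_v' sub1])
    then have "integral {t0..t1} k = integral {t0..t1} (\<lambda>_. kap j)
        + integral {t0..t1} (\<lambda>t. 8 / d_lo * \<epsilon>\<^sup>2 * (norm (v' t))\<^sup>2)"
      unfolding k_def by (intro integral_add integrable_const_ivl) (rule integrable_on_mult_right)
    then show ?thesis using tt step by (simp add: omg_def t0_def t1_def)
  qed
  also have "E t0 = u t0 - U (j - 1)" by (simp add: E_def \<theta>0)
  finally have fin: "exp (- (1 / T) * (t - t0)) * ((norm (E t))\<^sup>2 + integral {t0..t} w)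
      \<le> (norm (u t0 - U (j - 1)))\<^sup>2 + omg j" by simp
  have wi: "0 \<le> integral {t0..t} w"
    using d_lo by (intro integral_nonneg integrable_continuous_real)
      (auto simp: w_def N_def intro!: continuous_intros continuous_on_subset[OF cont_v sub])
  have "(t - t0) / T \<le> \<tau> / T" using tt step T by (intro divide_right_mono) auto
  then have "(t - t0) / T \<le> 1 / real n" using T n by (simp add: \<tau>)
  then have "exp (- (1 / real n)) \<le> exp (- (1 / T) * (t - t0))" by simp
  then have "exp (- (1 / real n)) * ((norm (E t))\<^sup>2 + integral {t0..t} w)
      \<le> exp (- (1 / T) * (t - t0)) * ((norm (E t))\<^sup>2 + integral {t0..t} w)"
    using wi by (intro mult_right_mono) auto
  with fin have "exp (- (1 / real n)) * ((norm (E t))\<^sup>2 + integral {t0..t} w)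
      \<le> (norm (u t0 - U (j - 1)))\<^sup>2 + omg j" by linarith
  then have "(norm (E t))\<^sup>2 + integral {t0..t} w
      \<le> exp (1 / real n) * ((norm (u t0 - U (j - 1)))\<^sup>2 + omg j)"
    by (simp add: exp_minus field_simps)
  moreover have "integral {t0..t} w = d_lo * integral {t0..t} (\<lambda>t. (norm (v t - Z j))\<^sup>2)"
    unfolding w_def N_def by simp
  ultimately show ?thesis by (simp add: E_def \<theta>_def t0_def t1_def)
qed

lemma sum_integral_v':
  "(\<Sum>j=1..n. integral (cell \<tau> j) (\<lambda>t. (norm (v' t))\<^sup>2))
    = integral {0..T} (\<lambda>t. (norm (v' t))\<^sup>2)"
proof -
  have "continuous_on {0..T} (\<lambda>t. (norm (v' t))\<^sup>2)" by (intro continuous_intros cont_v')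
  from sum_integral_grid[OF this, of \<tau> n] show ?thesis
    using \<tau>_pos unfolding n\<tau> by simp
qed

lemma sum_omg: "(\<Sum>j=1..n. omg j) \<le> C_step * (\<tau>\<^sup>2 + \<epsilon>\<^sup>2)"
proof -
  have W: "(\<Sum>j=1..n. \<tau> * (norm (W j))\<^sup>2) \<le> \<tau>\<^sup>2 * (T * C_inc)"
  proof -
    have "(\<Sum>j=1..n. \<tau> * (norm (W j))\<^sup>2) \<le> (\<Sum>j=1..n. \<tau> * (\<tau>\<^sup>2 * C_inc))"
      using \<tau>_pos by (intro sum_mono mult_left_mono increments(1)) auto
    also have "\<dots> = (real n * \<tau>) * (\<tau>\<^sup>2 * C_inc)" by simp
    also have "\<dots> = \<tau>\<^sup>2 * (T * C_inc)" unfolding n\<tau> by simp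
    finally show ?thesis .
  qed
  have eq: "\<tau> * kap j = 4 * T * (a_up\<^sup>2 * (\<tau> * (norm (W j))\<^sup>2) + \<tau>\<^sup>2 * \<Delta>\<Phi> j + \<tau> * (K * \<tau>\<^sup>2))
    + 4 / d_lo * (\<tau>\<^sup>2 * \<Delta>\<Phi> j + \<tau> * (K * \<tau>\<^sup>2) + \<tau> * (2 * \<epsilon>\<^sup>2 * Rm) + \<tau> * (norm (Wx j))\<^sup>2)" for j
  proof -
    have "\<tau> * (4 * T * (a * w + \<tau> * p + x) + q * (\<tau> * p + x + y + z))
      = 4 * T * (a * (\<tau> * w) + \<tau>\<^sup>2 * p + \<tau> * x) + q * (\<tau>\<^sup>2 * p + \<tau> * x + \<tau> * y + \<tau> * z)"
      for a w p x q y z :: real by (simp add: algebra_simps power2_eq_square)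
    then show ?thesis unfolding kap_def .
  qed
  have "(\<Sum>j=1..n. \<tau> * kap j)
      = 4 * T * (a_up\<^sup>2 * (\<Sum>j=1..n. \<tau> * (norm (W j))\<^sup>2) + \<tau>\<^sup>2 * P_tot + T * (K * \<tau>\<^sup>2))
      + 4 / d_lo * (\<tau>\<^sup>2 * P_tot + T * (K * \<tau>\<^sup>2) + T * (2 * \<epsilon>\<^sup>2 * Rm) + (\<Sum>j=1..n. \<tau> * (norm (Wx j))\<^sup>2))"
    unfolding eq sum.distrib sum_distrib_left[symmetric] sum_\<Delta>\<Phi>[symmetric]
    by (simp add: n\<tau>[symmetric] algebra_simps)
  also have "\<dots> \<le> 4 * T * (a_up\<^sup>2 * (\<tau>\<^sup>2 * (T * C_inc)) + \<tau>\<^sup>2 * P_tot + T * (K * \<tau>\<^sup>2))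
      + 4 / d_lo * (\<tau>\<^sup>2 * P_tot + T * (K * \<tau>\<^sup>2) + T * (2 * \<epsilon>\<^sup>2 * Rm) + \<tau>\<^sup>2 * C_incx)"
    using T d_lo K W increments(2) by (intro add_mono mult_left_mono) auto
  also have "\<dots> = \<tau>\<^sup>2 * (4 * T * (a_up\<^sup>2 * (T * C_inc) + P_tot + K * T) + 4 / d_lo * (P_tot + K * T + C_incx))
      + \<epsilon>\<^sup>2 * (4 / d_lo * (2 * Rm * T))"
    by (simp add: algebra_simps add_divide_distrib)
  \<comment> \<open>Both coefficients are enlarged to \<open>C_step - 8 / d_lo * C_vel\<close>; the
    part held back pays for the integrals of \<open>v'\<close> in \<open>omg\<close>.\<close>
  also have "\<dots> \<le> \<tau>\<^sup>2 * (C_step - 8 / d_lo * C_vel) + \<epsilon>\<^sup>2 * (C_step - 8 / d_lo * C_vel)"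
  proof -
    have "0 \<le> 4 / d_lo * (2 * Rm * T)" "0 \<le> 4 / d_lo * (P_tot + K * T + C_incx)"
      "0 \<le> 4 * T * (a_up\<^sup>2 * (T * C_inc) + P_tot + K * T)"
      using T d_lo Rm_nonneg C_nonneg P_tot_nonneg K by auto
    then show ?thesis
      unfolding C_step_def
      by (intro add_mono mult_left_mono) (auto simp: algebra_simps add_divide_distrib)
  qed
  finally have kap: "(\<Sum>j=1..n. \<tau> * kap j) \<le> (C_step - 8 / d_lo * C_vel) * (\<tau>\<^sup>2 + \<epsilon>\<^sup>2)"
    by (simp add: algebra_simps add_divide_distrib)
  have "(\<Sum>j=1..n. omg j) = (\<Sum>j=1..n. \<tau> * kap j)
      + 8 / d_lo * \<epsilon>\<^sup>2 * integral {0..T} (\<lambda>t. (norm (v' t))\<^sup>2)"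
    unfolding omg_def sum.distrib sum_distrib_left[symmetric] sum_integral_v' by simp
  also have "\<dots> \<le> (C_step - 8 / d_lo * C_vel) * (\<tau>\<^sup>2 + \<epsilon>\<^sup>2) + 8 / d_lo * \<epsilon>\<^sup>2 * C_vel"
    using d_lo integral_v' kap by (intro add_mono mult_left_mono) auto
  also have "\<dots> = C_step * (\<tau>\<^sup>2 + \<epsilon>\<^sup>2) - 8 / d_lo * C_vel * \<tau>\<^sup>2"
    by (simp add: algebra_simps add_divide_distrib)
  also have "\<dots> \<le> C_step * (\<tau>\<^sup>2 + \<epsilon>\<^sup>2)" using C_nonneg d_lo by simp
  finally show ?thesis .
qed

lemma omg_nonneg: "j \<in> {1..n} \<Longrightarrow> 0 \<le> omg j"
  unfolding omg_def using kap_nonneg[of j] \<tau>_pos d_lo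
  by (intro add_nonneg_nonneg mult_nonneg_nonneg integral_nonneg integrable_continuous_real
      continuous_intros continuous_on_subset[OF cont_v' interval_subset]) auto

text \<open>Each cell multiplies the accumulated bound by the same factor. Applying it also to the
  earlier dissipation and to the new \<open>omg\<close>, which only enlarges nonnegative quantities,
  keeps the bound in closed form.\<close>

lemma node_error:
  assumes "j \<le> n"
  shows "(norm (u (real j * \<tau>) - U j))\<^sup>2
      + (\<Sum>i=1..j. d_lo * integral (cell \<tau> i) (\<lambda>t. (norm (v t - Z i))\<^sup>2))
    \<le> exp (1 / real n) ^ j * (\<Sum>i=1..j. omg i)"
  using assms
proof (induction j)
  case 0
  then show ?case by (simp add: init euD(1))
next
  case (Suc j)
  let ?I = "\<lambda>i. d_lo * integral (cell \<tau> i) (\<lambda>t. (norm (v t - Z i))\<^sup>2)"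
  let ?E = "exp (1 / real n)"
  have E1: "1 \<le> ?E" by simp
  have S: "Suc j \<in> {1..n}" using Suc.prems by simp
  have I0: "0 \<le> ?I i" if "i \<in> {1..j}" for i
    using d_lo that Suc.prems
    by (intro mult_nonneg_nonneg integral_nonneg integrable_continuous_real
      continuous_intros continuous_on_subset[OF cont_v interval_subset]) auto
  have st: "(norm (u (real (Suc j) * \<tau>) - U (Suc j)))\<^sup>2 + ?I (Suc j)
      \<le> ?E * ((norm (u (real j * \<tau>) - U j))\<^sup>2 + omg (Suc j))"
    using euler_step[OF S, of "real (Suc j) * \<tau>"] \<tau>_pos by (simp add: mult_right_mono)
  have "(\<Sum>i=1..j. ?I i) \<le> ?E * (\<Sum>i=1..j. ?I i)"
    using mult_right_mono[OF E1 sum_nonneg[of "{1..j}" ?I]] I0 by simp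
  moreover have "?E * ((norm (u (real j * \<tau>) - U j))\<^sup>2 + (\<Sum>i=1..j. ?I i)) \<le> ?E * (?E ^ j * (\<Sum>i=1..j. omg i))"
    using Suc by (intro mult_left_mono) auto
  moreover have "?E * omg (Suc j) \<le> ?E * (?E ^ j * omg (Suc j))"
    using mult_right_mono[OF one_le_power[OF E1, of j] omg_nonneg[OF S]]
    by (intro mult_left_mono) auto
  ultimately have "?E * ((norm (u (real j * \<tau>) - U j))\<^sup>2 + omg (Suc j)) + ?E * (\<Sum>i=1..j. ?I i)
      \<le> ?E * (?E ^ j * (\<Sum>i=1..j. omg i)) + ?E * (?E ^ j * omg (Suc j))"
    unfolding distrib_left by linarith
  also have "\<dots> = ?E ^ Suc j * (\<Sum>i=1..Suc j. omg i)"
    by (simp add: distrib_left)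
  finally show ?case using st \<open>(\<Sum>i=1..j. ?I i) \<le> ?E * (\<Sum>i=1..j. ?I i)\<close> by simp
qed

lemma exp_n_power: "j \<le> n \<Longrightarrow> exp (1 / real n) ^ j \<le> exp (1::real)"
  using n by (simp flip: exp_of_nat_mult add: field_simps)

lemma weighted_sum_omg:
  assumes "j \<le> n" shows "exp (1 / real n) ^ j * (\<Sum>i=1..j. omg i) \<le> C_fin * (\<tau>\<^sup>2 + \<epsilon>\<^sup>2)"
proof -
  have "(\<Sum>i=1..j. omg i) \<le> (\<Sum>i=1..n. omg i)"
    using assms omg_nonneg by (intro sum_mono2) auto
  moreover have "0 \<le> (\<Sum>i=1..j. omg i)"
    using assms omg_nonneg by (intro sum_nonneg) auto
  ultimately have "exp (1 / real n) ^ j * (\<Sum>i=1..j. omg i) \<le> exp 1 * (C_step * (\<tau>\<^sup>2 + \<epsilon>\<^sup>2))"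
    using sum_omg exp_n_power[OF assms] by (intro mult_mono) auto
  then show ?thesis by (simp add: C_fin_def)
qed

text \<open>The node bound at the left end, followed by one possibly incomplete step.\<close>

lemma interpolant_error:
  assumes j: "j \<in> {1..n}" and t: "t \<in> cell \<tau> j"
  shows "(norm (u t - (U j - ((real j * \<tau> - t) / \<tau>) *\<^sub>R W j)))\<^sup>2 \<le> C_fin * (\<tau>\<^sup>2 + \<epsilon>\<^sup>2)"
proof -
  let ?I = "\<lambda>i. d_lo * integral (cell \<tau> i) (\<lambda>t. (norm (v t - Z i))\<^sup>2)"
  let ?E = "exp (1 / real n)"
  obtain i where i: "j = Suc i" using j by (cases j) auto
  have I0: "0 \<le> ?I k" if "k \<in> {1..i}" for k
    using d_lo that j i
    by (intro mult_nonneg_nonneg integral_nonneg integrable_continuous_real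
      continuous_intros continuous_on_subset[OF cont_v interval_subset]) auto
  have "0 \<le> d_lo * integral {real (j - 1) * \<tau>..t} (\<lambda>t. (norm (v t - Z j))\<^sup>2)"
    using d_lo t
    by (intro mult_nonneg_nonneg integral_nonneg integrable_continuous_real
      continuous_intros continuous_on_subset[OF cont_v order_trans[OF _ interval_subset[OF j]]]) auto
  then have "(norm (u t - (U j - ((real j * \<tau> - t) / \<tau>) *\<^sub>R W j)))\<^sup>2
      \<le> ?E * ((norm (u (real i * \<tau>) - U i))\<^sup>2 + omg j)"
    using euler_step[OF j t] i by simp
  also have "\<dots> \<le> ?E * (?E ^ i * (\<Sum>k=1..i. omg k) + ?E ^ i * omg j)"
  proof (intro mult_left_mono add_mono)
    show "(norm (u (real i * \<tau>) - U i))\<^sup>2 \<le> ?E ^ i * (\<Sum>k=1..i. omg k)"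
      using node_error[of i] sum_nonneg[of "{1..i}" ?I] I0 i j by simp
    show "omg j \<le> ?E ^ i * omg j"
      using mult_right_mono[OF one_le_power[of ?E i] omg_nonneg[OF j]] by simp
  qed simp
  also have "\<dots> = ?E ^ j * (\<Sum>k=1..j. omg k)" by (simp add: i algebra_simps)
  also have "\<dots> \<le> C_fin * (\<tau>\<^sup>2 + \<epsilon>\<^sup>2)" using j by (intro weighted_sum_omg) auto
  finally show ?thesis .
qed

text \<open>A majorant that is constant on the cell except for two terms whose integrals are already
  known: \<open>v'\<close> from the regularity estimate, \<open>v - Z j\<close> from the dissipation
  in \<open>node_error\<close>.\<close>

definition "bnd j t = 2 * C_fin * (\<tau>\<^sup>2 + \<epsilon>\<^sup>2) + 2 * \<tau>\<^sup>2 * C_inc + 8 * (\<tau> * \<Delta>\<Phi> j) + 8 * K * \<tau>\<^sup>2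
  + 16 * \<epsilon>\<^sup>2 * Rm + 16 * \<epsilon>\<^sup>2 * (norm (v' t))\<^sup>2 + (2 * d_up\<^sup>2 + 1) * (norm (v t - Z j))\<^sup>2"

text \<open>The energy does not control derivatives. They are recovered from the flux equation,
  which expresses \<open>ux - Ux j\<close> by the flux error, the velocity term and oscillations of
  the data. Passing from the interpolant to \<open>U j\<close> costs one increment.\<close>

lemma pointwise_error:
  assumes j: "j \<in> {1..n}" and t: "t \<in> cell \<tau> j"
  shows "(norm (u t - U j))\<^sup>2 + (norm (ux t - Ux j))\<^sup>2 + (norm (v t - Z j))\<^sup>2 \<le> bnd j t"
proof -
  define \<theta> where "\<theta> = (real j * \<tau> - t) / \<tau>"
  have tT: "t \<in> {0..T}" using t interval_subset[OF j] by blast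
  have jn: "j \<le> n" using j by auto
  have \<theta>: "0 \<le> \<theta>" "\<theta> \<le> 1"
    using t grid_step[OF j] \<tau>_pos by (auto simp: \<theta>_def field_simps)
  have "(norm (u t - U j))\<^sup>2 = (norm ((u t - (U j - \<theta> *\<^sub>R W j)) - \<theta> *\<^sub>R W j))\<^sup>2" by simp
  also have "\<dots> \<le> 2 * (norm (u t - (U j - \<theta> *\<^sub>R W j)))\<^sup>2 + 2 * (norm (\<theta> *\<^sub>R W j))\<^sup>2"
    by (rule norm_diff_power2_le)
  also have "(norm (\<theta> *\<^sub>R W j))\<^sup>2 \<le> (norm (W j))\<^sup>2"
    using \<theta> by (intro power_mono) (auto intro: mult_left_le_one_le)
  also have "\<dots> \<le> \<tau>\<^sup>2 * C_inc" by (rule increments(1)[OF j])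
  finally have 1: "(norm (u t - U j))\<^sup>2 \<le> 2 * (C_fin * (\<tau>\<^sup>2 + \<epsilon>\<^sup>2)) + 2 * (\<tau>\<^sup>2 * C_inc)"
    using interpolant_error[OF j t] by (simp add: \<theta>_def)
  define Y where "Y = (F t - F (real j * \<tau>)) + \<phi> j + (- (\<epsilon> *\<^sub>R (R t + v' t)))"
  have "(norm Y)\<^sup>2 \<le> 4 * ((norm (F t - F (real j * \<tau>)))\<^sup>2 + (norm (\<phi> j))\<^sup>2 + (norm (- (\<epsilon> *\<^sub>R (R t + v' t))))\<^sup>2)"
    unfolding Y_def by (rule norm_add3_power2_le)
  also have "\<dots> \<le> 4 * (\<tau> * \<Delta>\<Phi> j + K * \<tau>\<^sup>2 + (2 * \<epsilon>\<^sup>2 * Rm + 2 * \<epsilon>\<^sup>2 * (norm (v' t))\<^sup>2))"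
    unfolding norm_minus_cancel
    using mod_step[OF \<Phi>(2) j t] euD(8)[OF jn] velocity_term[OF tT]
    by (intro mult_left_mono add_mono) auto
  finally have "(norm Y)\<^sup>2 \<le> 4 * (\<tau> * \<Delta>\<Phi> j + K * \<tau>\<^sup>2 + (2 * \<epsilon>\<^sup>2 * Rm + 2 * \<epsilon>\<^sup>2 * (norm (v' t))\<^sup>2))" .
  moreover have "(norm (ux t - Ux j))\<^sup>2 \<le> 2 * (norm Y)\<^sup>2 + 2 * (d_up\<^sup>2 * (norm (v t - Z j))\<^sup>2)"
    using flux_error[OF j t] norm_diff_power2_le[of Y "D (v t - Z j)"] D_bound_power2[of "v t - Z j"]
    by (simp add: Y_def)
  ultimately show ?thesis using 1 unfolding bnd_def distrib_left distrib_right by simp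
qed

lemma bnd_continuous: "j \<in> {1..n} \<Longrightarrow> continuous_on (cell \<tau> j) (bnd j)"
  unfolding bnd_def
  by (intro continuous_intros continuous_on_subset[OF cont_v interval_subset]
      continuous_on_subset[OF cont_v' interval_subset])

lemma sum_integral_bnd:
  "(\<Sum>j=1..n. integral (cell \<tau> j) (bnd j)) \<le> 2 * C_int * (\<tau>\<^sup>2 + \<epsilon>\<^sup>2)"
proof -
  let ?J = "\<lambda>j. (cell \<tau> j)"
  let ?c = "2 * C_fin * (\<tau>\<^sup>2 + \<epsilon>\<^sup>2) + 2 * \<tau>\<^sup>2 * C_inc + 8 * K * \<tau>\<^sup>2 + 16 * \<epsilon>\<^sup>2 * Rm"
  let ?d = "2 * d_up\<^sup>2 + 1"
  have int: "integral (?J j) (bnd j) = \<tau> * ?c + 8 * \<tau>\<^sup>2 * \<Delta>\<Phi> j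
      + 16 * \<epsilon>\<^sup>2 * integral (?J j) (\<lambda>t. (norm (v' t))\<^sup>2)
      + ?d * integral (?J j) (\<lambda>t. (norm (v t - Z j))\<^sup>2)" if j: "j \<in> {1..n}" for j
  proof -
    have i1: "(\<lambda>t. (norm (v' t))\<^sup>2) integrable_on ?J j" and i2: "(\<lambda>t. (norm (v t - Z j))\<^sup>2) integrable_on ?J j"
      by (intro integrable_continuous_real continuous_intros
          continuous_on_subset[OF cont_v' interval_subset[OF j]]
          continuous_on_subset[OF cont_v interval_subset[OF j]])+
    have "((\<lambda>t. (?c + 8 * (\<tau> * \<Delta>\<Phi> j)) + 16 * \<epsilon>\<^sup>2 * (norm (v' t))\<^sup>2 + ?d * (norm (v t - Z j))\<^sup>2) has_integral
        ((real j * \<tau> - real (j - 1) * \<tau>) *\<^sub>R (?c + 8 * (\<tau> * \<Delta>\<Phi> j))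
         + 16 * \<epsilon>\<^sup>2 * integral (?J j) (\<lambda>t. (norm (v' t))\<^sup>2)
         + ?d * integral (?J j) (\<lambda>t. (norm (v t - Z j))\<^sup>2))) (?J j)"
      using grid_step[OF j] \<tau>_pos
      by (intro has_integral_add has_integral_const_real has_integral_mult_right integrable_integral i1 i2)
        (auto intro!: has_integral_const_real[THEN has_integral_eq_rhs])
    then have "integral (?J j) (\<lambda>t. (?c + 8 * (\<tau> * \<Delta>\<Phi> j)) + 16 * \<epsilon>\<^sup>2 * (norm (v' t))\<^sup>2 + ?d * (norm (v t - Z j))\<^sup>2)
      = \<tau> * (?c + 8 * (\<tau> * \<Delta>\<Phi> j)) + 16 * \<epsilon>\<^sup>2 * integral (?J j) (\<lambda>t. (norm (v' t))\<^sup>2)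
         + ?d * integral (?J j) (\<lambda>t. (norm (v t - Z j))\<^sup>2)"
      unfolding grid_step[OF j] by (simp add: integral_unique)
    moreover have "bnd j = (\<lambda>t. (?c + 8 * (\<tau> * \<Delta>\<Phi> j)) + 16 * \<epsilon>\<^sup>2 * (norm (v' t))\<^sup>2 + ?d * (norm (v t - Z j))\<^sup>2)"
      unfolding bnd_def fun_eq_iff by simp
    ultimately show ?thesis by (simp add: distrib_left power2_eq_square)
  qed
  have "d_lo * (\<Sum>j=1..n. integral (?J j) (\<lambda>t. (norm (v t - Z j))\<^sup>2)) \<le> C_fin * (\<tau>\<^sup>2 + \<epsilon>\<^sup>2)"
    using node_error[of n] weighted_sum_omg[of n] zero_le_power2[of "norm (u (real n * \<tau>) - U n)"]
    unfolding sum_distrib_left by linarith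
  then have v: "(\<Sum>j=1..n. integral (?J j) (\<lambda>t. (norm (v t - Z j))\<^sup>2)) \<le> C_fin / d_lo * (\<tau>\<^sup>2 + \<epsilon>\<^sup>2)"
    using d_lo by (simp add: field_simps)
  have "(\<Sum>j=1..n. integral (?J j) (bnd j)) = (\<Sum>j=1..n. \<tau> * ?c + 8 * \<tau>\<^sup>2 * \<Delta>\<Phi> j
      + 16 * \<epsilon>\<^sup>2 * integral (?J j) (\<lambda>t. (norm (v' t))\<^sup>2)
      + ?d * integral (?J j) (\<lambda>t. (norm (v t - Z j))\<^sup>2))"
    by (intro sum.cong int) auto
  also have "\<dots> = T * ?c + 8 * \<tau>\<^sup>2 * P_tot + 16 * \<epsilon>\<^sup>2 * integral {0..T} (\<lambda>t. (norm (v' t))\<^sup>2)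
      + ?d * (\<Sum>j=1..n. integral (?J j) (\<lambda>t. (norm (v t - Z j))\<^sup>2))"
    unfolding sum.distrib sum_distrib_left[symmetric] sum_integral_v' sum_\<Delta>\<Phi>
    by (simp add: n\<tau>[symmetric] algebra_simps)
  also have "\<dots> \<le> T * ?c + 8 * \<tau>\<^sup>2 * P_tot + 16 * \<epsilon>\<^sup>2 * C_vel + ?d * (C_fin / d_lo * (\<tau>\<^sup>2 + \<epsilon>\<^sup>2))"
    using integral_v' v by (intro add_mono mult_left_mono order_refl) auto
  \<comment> \<open>The factor 2 is needed by the terms with \<open>16 * \<epsilon>\<^sup>2\<close>,
    whose constants enter \<open>C_int\<close> with 8. The slack is a sum of nonnegative
    terms.\<close>
  also have "\<dots> \<le> 2 * C_int * (\<tau>\<^sup>2 + \<epsilon>\<^sup>2)"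
  proof -
    have "2 * C_int * (\<tau>\<^sup>2 + \<epsilon>\<^sup>2) - (T * ?c + 8 * \<tau>\<^sup>2 * P_tot + 16 * \<epsilon>\<^sup>2 * C_vel + ?d * (C_fin / d_lo * (\<tau>\<^sup>2 + \<epsilon>\<^sup>2)))
      = T * (2 * C_fin) * (\<tau>\<^sup>2 + \<epsilon>\<^sup>2) + T * (2 * \<tau>\<^sup>2 + 4 * \<epsilon>\<^sup>2) * C_inc
        + T * (8 * \<tau>\<^sup>2 + 16 * \<epsilon>\<^sup>2) * K + 16 * T * \<tau>\<^sup>2 * Rm + (8 * \<tau>\<^sup>2 + 16 * \<epsilon>\<^sup>2) * P_tot
        + ?d * (C_fin / d_lo * (\<tau>\<^sup>2 + \<epsilon>\<^sup>2)) + 16 * \<tau>\<^sup>2 * C_vel"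
      unfolding C_int_def by (simp add: algebra_simps)
    moreover have "0 \<le> \<dots>"
      using T d_lo Rm_nonneg C_nonneg P_tot_nonneg K by (intro add_nonneg_nonneg mult_nonneg_nonneg) auto
    ultimately show ?thesis by linarith
  qed
  finally show ?thesis .
qed

end

end

end

section \<open>Calculus of H^1 functions of time\<close>

definition H1_time :: "real \<Rightarrow> (real \<Rightarrow> 'a::real_normed_vector) \<Rightarrow> bool" where
  "H1_time T X \<longleftrightarrow> (\<exists>\<Phi>. time_modulus T \<Phi> \<and> has_modulus T \<Phi> X)"

lemma time_modulus_add: "time_modulus T \<Phi> \<Longrightarrow> time_modulus T \<Psi> \<Longrightarrow> time_modulus T (\<lambda>t. \<Phi> t + \<Psi> t)"
  unfolding time_modulus_def mono_on_def by (auto intro!: continuous_intros add_mono)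

lemma time_modulus_cmult: "time_modulus T \<Phi> \<Longrightarrow> 0 \<le> c \<Longrightarrow> time_modulus T (\<lambda>t. c * \<Phi> t)"
  unfolding time_modulus_def mono_on_def by (auto intro!: continuous_intros mult_left_mono)

lemma has_modulus_weaken:
  assumes "has_modulus T \<Phi> X"
    and "\<And>s t. 0 \<le> s \<Longrightarrow> s \<le> t \<Longrightarrow> t \<le> T \<Longrightarrow> \<Phi> t - \<Phi> s \<le> \<Psi> t - \<Psi> s"
  shows "has_modulus T \<Psi> X"
  unfolding has_modulus_def
proof (intro allI impI)
  fix s t :: real assume st: "0 \<le> s" "s \<le> t" "t \<le> T"
  have "(norm (X t - X s))\<^sup>2 \<le> (t - s) * (\<Phi> t - \<Phi> s)" using has_modulusD[OF assms(1) st] .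
  also have "\<dots> \<le> (t - s) * (\<Psi> t - \<Psi> s)" using assms(2)[OF st] st by (intro mult_left_mono) auto
  finally show "(norm (X t - X s))\<^sup>2 \<le> (t - s) * (\<Psi> t - \<Psi> s)" .
qed

text \<open>Adding a monotone function to a modulus leaves a modulus, and its increments dominate
  both. Iteration produces one modulus for several functions.\<close>

lemma H1_time_common:
  assumes "H1_time T X" "time_modulus T \<Psi>"
  obtains \<Phi> where "time_modulus T \<Phi>" "has_modulus T \<Phi> X"
    "\<And>s t. 0 \<le> s \<Longrightarrow> s \<le> t \<Longrightarrow> t \<le> T \<Longrightarrow> \<Psi> t - \<Psi> s \<le> \<Phi> t - \<Phi> s"
proof -
  obtain \<Phi> where \<Phi>: "time_modulus T \<Phi>" "has_modulus T \<Phi> X" using assms(1) by (auto simp: H1_time_def)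
  show ?thesis
  proof (rule that[of "\<lambda>t. \<Phi> t + \<Psi> t"])
    show "time_modulus T (\<lambda>t. \<Phi> t + \<Psi> t)" using \<Phi>(1) assms(2) by (rule time_modulus_add)
    show "has_modulus T (\<lambda>t. \<Phi> t + \<Psi> t) X"
      using \<Phi>(2) by (rule has_modulus_weaken) (use time_modulus_mono[OF assms(2)] in auto)
  qed (use time_modulus_mono[OF \<Phi>(1)] in auto)
qed

lemma H1_time_continuous_on: "H1_time T X \<Longrightarrow> continuous_on {0..T} X"
  unfolding H1_time_def using has_modulus_continuous_on by blast

lemma H1_time_add:
  assumes "H1_time T X" "H1_time T Y"
  shows "H1_time T (\<lambda>t. X t + Y t)"
proof -
  obtain \<Phi> where \<Phi>: "time_modulus T \<Phi>" "has_modulus T \<Phi> X" using assms(1) by (auto simp: H1_time_def)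
  obtain \<Psi> where \<Psi>: "time_modulus T \<Psi>" "has_modulus T \<Psi> Y" using assms(2) by (auto simp: H1_time_def)
  have "has_modulus T (\<lambda>t. 2 * \<Phi> t + 2 * \<Psi> t) (\<lambda>t. X t + Y t)"
    unfolding has_modulus_def
  proof (intro allI impI)
    fix s t :: real assume st: "0 \<le> s" "s \<le> t" "t \<le> T"
    have "(norm (X t + Y t - (X s + Y s)))\<^sup>2 \<le> 2 * (norm (X t - X s))\<^sup>2 + 2 * (norm (Y t - Y s))\<^sup>2"
      using norm_add_power2_le[of "X t - X s" "Y t - Y s"] by (simp add: algebra_simps)
    also have "\<dots> \<le> 2 * ((t - s) * (\<Phi> t - \<Phi> s)) + 2 * ((t - s) * (\<Psi> t - \<Psi> s))"
      using has_modulusD[OF \<Phi>(2) st] has_modulusD[OF \<Psi>(2) st] by linarith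
    also have "\<dots> = (t - s) * (2 * \<Phi> t + 2 * \<Psi> t - (2 * \<Phi> s + 2 * \<Psi> s))" by (simp add: algebra_simps)
    finally show "(norm (X t + Y t - (X s + Y s)))\<^sup>2 \<le> (t - s) * (2 * \<Phi> t + 2 * \<Psi> t - (2 * \<Phi> s + 2 * \<Psi> s))" .
  qed
  moreover have "time_modulus T (\<lambda>t. 2 * \<Phi> t + 2 * \<Psi> t)"
    by (intro time_modulus_add time_modulus_cmult \<Phi> \<Psi>) auto
  ultimately show ?thesis unfolding H1_time_def by blast
qed

lemma H1_time_bounded_increments:
  fixes X :: "real \<Rightarrow> 'a::real_normed_vector" and Y :: "real \<Rightarrow> 'b::real_normed_vector"
  assumes "H1_time T X"
    and "\<And>s t. s \<in> {0..T} \<Longrightarrow> t \<in> {0..T} \<Longrightarrow> norm (Y t - Y s) \<le> c * norm (X t - X s)"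
  shows "H1_time T Y"
proof -
  obtain \<Phi> where \<Phi>: "time_modulus T \<Phi>" "has_modulus T \<Phi> X" using assms(1) by (auto simp: H1_time_def)
  have "has_modulus T (\<lambda>t. c\<^sup>2 * \<Phi> t) Y"
    unfolding has_modulus_def
  proof (intro allI impI)
    fix s t :: real assume st: "0 \<le> s" "s \<le> t" "t \<le> T"
    have "(norm (Y t - Y s))\<^sup>2 \<le> (c * norm (X t - X s))\<^sup>2"
      using assms(2)[of s t] st by (intro power_mono) auto
    also have "\<dots> \<le> c\<^sup>2 * ((t - s) * (\<Phi> t - \<Phi> s))"
      unfolding power_mult_distrib by (intro mult_left_mono has_modulusD[OF \<Phi>(2)] st) auto
    finally show "(norm (Y t - Y s))\<^sup>2 \<le> (t - s) * (c\<^sup>2 * \<Phi> t - c\<^sup>2 * \<Phi> s)" by (simp add: algebra_simps)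
  qed
  then show ?thesis unfolding H1_time_def using time_modulus_cmult[OF \<Phi>(1), of "c\<^sup>2"] by auto
qed

lemma H1_time_minus: "H1_time T X \<Longrightarrow> H1_time T (\<lambda>t. - X t)"
  by (rule H1_time_bounded_increments[where c = 1]) (auto simp: norm_minus_commute)

lemma H1_time_diff: "H1_time T X \<Longrightarrow> H1_time T Y \<Longrightarrow> H1_time T (\<lambda>t. X t - Y t)"
  using H1_time_add[of T X "\<lambda>t. - Y t"] H1_time_minus[of T Y] by simp

lemma H1_time_id: "H1_time T (\<lambda>t::real. t)"
proof -
  have "time_modulus T (\<lambda>t. t)" by (auto simp: time_modulus_def mono_on_def)
  moreover have "has_modulus T (\<lambda>t. t) (\<lambda>t. t)" by (auto simp: has_modulus_def power2_eq_square)
  ultimately show ?thesis unfolding H1_time_def by blast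
qed

lemma H1_time_const: "H1_time T (\<lambda>t. c)"
  by (rule H1_time_bounded_increments[OF H1_time_id, where c = 0]) auto

lemma H1_time_sum: "(\<And>i. i \<in> I \<Longrightarrow> H1_time T (X i)) \<Longrightarrow> H1_time T (\<lambda>t. \<Sum>i\<in>I. X i t)"
  by (induction I rule: infinite_finite_induct) (auto intro: H1_time_const H1_time_add)

lemma H1_time_scaleR_left: "H1_time T x \<Longrightarrow> H1_time T (\<lambda>t. x t *\<^sub>R v)"
  by (rule H1_time_bounded_increments[where c = "norm v"]) (auto simp flip: scaleR_left_diff_distrib)

text \<open>The base point \<open>c\<close> is free: the left end gives Lipschitz bounds, the right
  end gives the error of the right endpoint rule on one interval.\<close>

lemma derivative_linearization:
  fixes X :: "real \<Rightarrow> 'a::real_normed_vector"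
  assumes X: "\<And>t. t \<in> {0..T} \<Longrightarrow> (X has_vector_derivative X' t) (at t within {0..T})"
    and st: "0 \<le> s" "s \<le> t" "t \<le> T"
    and c: "c \<in> {s..t}" "\<And>r. r \<in> {s..t} \<Longrightarrow> norm (X' r - X' c) \<le> B"
  shows "norm (X t - X s - (t - s) *\<^sub>R X' c) \<le> (t - s) * B"
proof -
  have "norm (X t - X s - (t - s) *\<^sub>R X' c) \<le> norm (t - s) * B"
  proof (rule vector_differentiable_bound_linearization[where S = "{s..t}"])
    show "(X has_vector_derivative X' r) (at r within {s..t})" if "r \<in> {s..t}" for r
      using that st by (intro has_vector_derivative_within_subset[OF X]) auto
  qed (use st c in \<open>auto simp: closed_segment_eq_real_ivl\<close>)
  then show ?thesis using st by simp
qed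

text \<open>In the factor 3, 2 bounds the oscillation of the derivative about its value at
  \<open>s\<close> and 1 comes from the linear term.\<close>

lemma Lipschitz_of_derivative:
  fixes X :: "real \<Rightarrow> 'a::real_normed_vector"
  assumes X: "\<And>t. t \<in> {0..T} \<Longrightarrow> (X has_vector_derivative X' t) (at t within {0..T})"
    and L: "\<And>t. t \<in> {0..T} \<Longrightarrow> norm (X' t) \<le> L"
    and st: "s \<in> {0..T}" "t \<in> {0..T}"
  shows "norm (X t - X s) \<le> 3 * L * \<bar>t - s\<bar>"
proof -
  have *: "norm (X t - X s) \<le> 3 * L * \<bar>t - s\<bar>" if "0 \<le> s" "s \<le> t" "t \<le> T" for s t
  proof -
    have "norm (X t - X s - (t - s) *\<^sub>R X' s) \<le> (t - s) * (2 * L)"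
    proof (rule derivative_linearization[OF X that])
      show "norm (X' r - X' s) \<le> 2 * L" if "r \<in> {s..t}" for r
        using norm_triangle_ineq4[of "X' r" "X' s"] L[of r] L[of s] that \<open>0 \<le> s\<close> \<open>t \<le> T\<close> by auto
    qed (use that in auto)
    moreover have "norm ((t - s) *\<^sub>R X' s) \<le> (t - s) * L"
      using L[of s] that by (auto intro: mult_left_mono)
    ultimately show ?thesis
      using norm_triangle_ineq[of "X t - X s - (t - s) *\<^sub>R X' s" "(t - s) *\<^sub>R X' s"] that
      by (simp add: algebra_simps)
  qed
  show ?thesis
    using *[of s t] *[of t s] st
    by (cases "s \<le> t") (auto simp: norm_minus_commute abs_minus_commute)
qed

lemma bounded_of_H1_time:
  fixes X :: "real \<Rightarrow> 'a::real_normed_vector"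
  assumes "H1_time T X"
  obtains L where "0 \<le> L" "\<And>t. t \<in> {0..T} \<Longrightarrow> norm (X t) \<le> L"
proof -
  have "bounded (X ` {0..T})"
    using H1_time_continuous_on[OF assms] compact_continuous_image compact_imp_bounded by blast
  then obtain L where "\<forall>x\<in>X ` {0..T}. norm x \<le> L" unfolding bounded_iff by blast
  then show ?thesis using that[of "max L 0"] by (auto simp: le_max_iff_disj)
qed

text \<open>The derivative is continuous, hence bounded, and a Lipschitz function has a multiple of
  the identity as modulus.\<close>

lemma H1_time_of_derivative:
  fixes X :: "real \<Rightarrow> 'a::real_normed_vector"
  assumes "\<And>t. t \<in> {0..T} \<Longrightarrow> (X has_vector_derivative X' t) (at t within {0..T})" "H1_time T X'"
  shows "H1_time T X"
proof -
  obtain L where "\<And>t. t \<in> {0..T} \<Longrightarrow> norm (X' t) \<le> L" using bounded_of_H1_time[OF assms(2)] by metis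
  from Lipschitz_of_derivative[OF assms(1) this]
  show ?thesis by (intro H1_time_bounded_increments[OF H1_time_id, where c = "3 * L"]) auto
qed

text \<open>The right endpoint rule is first order accurate because the defects are increments of \<open>\<Psi>\<close>.\<close>

lemma right_endpoint_rule:
  fixes b :: "real \<Rightarrow> 'a::real_normed_vector"
  assumes b: "\<And>t. t \<in> {0..T} \<Longrightarrow> (b has_vector_derivative b' t) (at t within {0..T})"
    and \<Psi>: "time_modulus T \<Psi>" "has_modulus T \<Psi> b'"
    and n: "0 < n" and T: "0 < T"
  defines "\<tau> \<equiv> T / real n"
  defines "e j \<equiv> b 0 + \<tau> *\<^sub>R (\<Sum>i=1..j. b' (real i * \<tau>)) - b (real j * \<tau>)"
  shows "j \<in> {1..n} \<Longrightarrow> (norm (e j - e (j - 1)))\<^sup>2 \<le> T\<^sup>2 * (\<tau> * (\<Psi> (real j * \<tau>) - \<Psi> (real (j - 1) * \<tau>)))"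
    and "j \<le> n \<Longrightarrow> norm (e j) \<le> \<tau> * (T + (\<Psi> T - \<Psi> 0))"
proof -
  have \<tau>: "0 < \<tau>" "real n * \<tau> = T" "\<tau> \<le> T" using n T by (auto simp: \<tau>_def field_simps)
  have g: "real j * \<tau> \<le> T" "0 \<le> real j * \<tau>" if "j \<le> n" for j
    using \<tau> mult_right_mono[of "real j" "real n" \<tau>] that by auto
  let ?\<Delta> = "\<lambda>j. \<Psi> (real j * \<tau>) - \<Psi> (real (j - 1) * \<tau>)"
  have \<Delta>0: "0 \<le> ?\<Delta> j" if "j \<in> {1..n}" for j
    using time_modulus_mono[OF \<Psi>(1), of "real (j - 1) * \<tau>" "real j * \<tau>"] g[of j] g[of "j - 1"] \<tau> that
    by (auto intro!: mult_right_mono)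
  have inc: "norm (e j - e (j - 1)) \<le> \<tau> * sqrt (\<tau> * ?\<Delta> j)" if j: "j \<in> {1..n}" for j
  proof -
    obtain i where i: "j = Suc i" using j by (cases j) auto
    have le: "real i * \<tau> \<le> real j * \<tau>" using \<tau> i by simp
    have "norm (b (real j * \<tau>) - b (real i * \<tau>) - (real j * \<tau> - real i * \<tau>) *\<^sub>R b' (real j * \<tau>))
        \<le> (real j * \<tau> - real i * \<tau>) * sqrt (\<tau> * ?\<Delta> j)"
    proof (rule derivative_linearization[OF b _ le])
      fix r assume r: "r \<in> {real i * \<tau>..real j * \<tau>}"
      have r0: "0 \<le> r" using r g(2)[of i] i j by (auto intro: order_trans)
      have "(norm (b' (real j * \<tau>) - b' r))\<^sup>2 \<le> (real j * \<tau> - r) * (\<Psi> (real j * \<tau>) - \<Psi> r)"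
        using r r0 g(1)[of j] j by (intro has_modulusD[OF \<Psi>(2)]) auto
      also have "\<dots> \<le> \<tau> * ?\<Delta> j"
        using r r0 g(1)[of j] g(2)[of i] j i \<tau> order_trans[of r "real j * \<tau>" T]
          time_modulus_mono[OF \<Psi>(1), of "real i * \<tau>" r] time_modulus_mono[OF \<Psi>(1), of r "real j * \<tau>"]
        by (intro mult_mono) (auto simp: algebra_simps)
      finally show "norm (b' r - b' (real j * \<tau>)) \<le> sqrt (\<tau> * ?\<Delta> j)"
        by (intro real_le_rsqrt) (simp add: norm_minus_commute)
    qed (use g[of i] g[of j] i j le in auto)
    moreover have "real j * \<tau> - real i * \<tau> = \<tau>" using i by (simp add: algebra_simps)
    moreover have "e j - e (j - 1) = - (b (real j * \<tau>) - b (real i * \<tau>) - \<tau> *\<^sub>R b' (real j * \<tau>))"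
      unfolding e_def i by (simp add: algebra_simps)
    ultimately show ?thesis by (simp add: norm_minus_commute)
  qed
  show "(norm (e j - e (j - 1)))\<^sup>2 \<le> T\<^sup>2 * (\<tau> * ?\<Delta> j)" if j: "j \<in> {1..n}"
  proof -
    have "(norm (e j - e (j - 1)))\<^sup>2 \<le> (\<tau> * sqrt (\<tau> * ?\<Delta> j))\<^sup>2"
      using inc[OF j] by (intro power_mono) auto
    also have "\<dots> = \<tau>\<^sup>2 * (\<tau> * ?\<Delta> j)" using \<Delta>0[OF j] \<tau> by (simp add: power_mult_distrib)
    \<comment> \<open>The spare factor \<tau> squared is given away so that the bound takes the form
      required of the increments of data.\<close>
    also have "\<dots> \<le> T\<^sup>2 * (\<tau> * ?\<Delta> j)"
      using \<tau> \<Delta>0[OF j] by (intro mult_right_mono power_mono) auto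
    finally show ?thesis .
  qed
  have main: "norm (e j) \<le> \<tau> * (real j * \<tau> + (\<Psi> (real j * \<tau>) - \<Psi> 0))" if "j \<le> n" for j
    using that
  proof (induction j)
    case (Suc j)
    have S: "Suc j \<in> {1..n}" using Suc.prems by simp
    \<comment> \<open>The square root cannot be summed directly; this elementary bound replaces it
      by terms that add up to \<open>T\<close> and to the total increment of
      \<open>\<Psi>\<close>.\<close>
    have "sqrt (\<tau> * ?\<Delta> (Suc j)) \<le> \<tau> + ?\<Delta> (Suc j)"
    proof (rule real_le_lsqrt)
      show "\<tau> * ?\<Delta> (Suc j) \<le> (\<tau> + ?\<Delta> (Suc j))\<^sup>2"
      proof -
        have "x * y \<le> (x + y)\<^sup>2" if "0 \<le> x" "0 \<le> y" for x y :: real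
          using mult_nonneg_nonneg[OF that] by (simp add: power2_sum)
        then show ?thesis using \<tau> \<Delta>0[OF S] by simp
      qed
    qed (use \<tau> \<Delta>0[OF S] in auto)
    then have "\<tau> * sqrt (\<tau> * ?\<Delta> (Suc j)) \<le> \<tau> * (\<tau> + ?\<Delta> (Suc j))"
      using \<tau> by (intro mult_left_mono) auto
    then have "norm (e (Suc j)) \<le> norm (e j) + \<tau> * (\<tau> + ?\<Delta> (Suc j))"
      using inc[OF S] norm_triangle_ineq[of "e j" "e (Suc j) - e j"] by simp
    also have "\<dots> \<le> \<tau> * (real j * \<tau> + (\<Psi> (real j * \<tau>) - \<Psi> 0)) + \<tau> * (\<tau> + ?\<Delta> (Suc j))"
      using Suc by simp
    also have "\<dots> = \<tau> * (real (Suc j) * \<tau> + (\<Psi> (real (Suc j) * \<tau>) - \<Psi> 0))"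
      by (simp add: algebra_simps)
    finally show ?case .
  qed (simp add: e_def)
  show "norm (e j) \<le> \<tau> * (T + (\<Psi> T - \<Psi> 0))" if "j \<le> n"
  proof -
    have "real j * \<tau> + (\<Psi> (real j * \<tau>) - \<Psi> 0) \<le> T + (\<Psi> T - \<Psi> 0)"
      using g[OF that] time_modulus_mono[OF \<Psi>(1), of "real j * \<tau>" T] by auto
    then show ?thesis using main[OF that] \<tau>(1) by (smt (verit) mult_left_mono)
  qed
qed

text \<open>The square integral of the piecewise constant error is bounded through a majorant \<open>B\<close>, so that no
  measurability in time is required of the error itself.\<close>

definition error_estimate ::
  "real \<Rightarrow> real \<Rightarrow> real \<Rightarrow> nat \<Rightarrow> (real \<Rightarrow> 'a::real_inner) \<Rightarrow> (real \<Rightarrow> 'a) \<Rightarrow> (real \<Rightarrow> 'a) \<Rightarrow>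
   (nat \<Rightarrow> 'a) \<Rightarrow> (nat \<Rightarrow> 'a) \<Rightarrow> (nat \<Rightarrow> 'a) \<Rightarrow> bool" where
  "error_estimate T C \<epsilon> n p px m P Px Q \<longleftrightarrow> (let \<tau> = T / real n in
      (\<forall>j\<in>{1..n}. \<forall>t\<in>cell \<tau> j.
         (norm (p t - (P j - ((real j * \<tau> - t) / \<tau>) *\<^sub>R (P j - P (j - 1)))))\<^sup>2 \<le> C * (\<tau>\<^sup>2 + \<epsilon>\<^sup>2)) \<and>
      (\<exists>B. (\<forall>j\<in>{1..n}. continuous_on (cell \<tau> j) (B j) \<and>
          (\<forall>t\<in>cell \<tau> j.
            (norm (p t - P j))\<^sup>2 + (norm (px t - Px j))\<^sup>2 + (norm (m t - Q j))\<^sup>2 \<le> B j t)) \<and>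
        (\<Sum>j=1..n. integral (cell \<tau> j) (B j)) \<le> C * (\<tau>\<^sup>2 + \<epsilon>\<^sup>2)))"

section \<open>Reduction of inhomogeneous boundary data to the homogeneous estimate\<close>

context energy_space
begin

text \<open>The boundary condition is membership of \<open>p - b\<close> in the homogeneous space.
  The vertex load acts as the functional with \<open>\<rho>\<close> paired with the derivative and
  \<open>\<sigma>\<close> with the test function itself.\<close>

definition hyperbolic_inhom ::
  "real \<Rightarrow> real \<Rightarrow> (real \<Rightarrow> 'a) \<Rightarrow> (real \<Rightarrow> 'a) \<Rightarrow> (real \<Rightarrow> 'a) \<Rightarrow> (real \<Rightarrow> 'a) \<Rightarrow> (real \<Rightarrow> 'a) \<Rightarrow> (real \<Rightarrow> 'a) \<Rightarrow>
   (real \<Rightarrow> 'a) \<Rightarrow> (real \<Rightarrow> 'a) \<Rightarrow> (real \<Rightarrow> 'a) \<Rightarrow> (real \<Rightarrow> 'a) \<Rightarrow> (real \<Rightarrow> 'a) \<Rightarrow> bool" where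
  "hyperbolic_inhom T \<epsilon> f g \<rho> \<sigma> b bx p px m p' m' \<longleftrightarrow> continuous_on {0..T} m' \<and>
     (\<forall>t\<in>{0..T}. (p has_vector_derivative p' t) (at t within {0..T}) \<and>
        (m has_vector_derivative m' t) (at t within {0..T}) \<and> (p t - b t, px t - bx t) \<in> V \<and>
        (\<forall>q qx. (q, qx) \<in> V \<longrightarrow>
           p' t \<bullet> q + A (p t) \<bullet> q - m t \<bullet> qx = g t \<bullet> q - (\<rho> t \<bullet> qx + \<sigma> t \<bullet> q)) \<and>
        \<epsilon> *\<^sub>R m' t + px t + D (m t) = f t)"

text \<open>The scheme prescribes only increments of the boundary values, so its lifting is an
  accumulated sum of samples of \<open>b'\<close>, which drifts from \<open>b\<close> at the grid
  point by the quadrature error.\<close>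

definition euler_inhom ::
  "real \<Rightarrow> nat \<Rightarrow> (real \<Rightarrow> 'a) \<Rightarrow> (real \<Rightarrow> 'a) \<Rightarrow> (real \<Rightarrow> 'a) \<Rightarrow> (real \<Rightarrow> 'a) \<Rightarrow> 'a \<Rightarrow> 'a \<Rightarrow> (real \<Rightarrow> 'a) \<Rightarrow> (real \<Rightarrow> 'a) \<Rightarrow>
   (nat \<Rightarrow> 'a) \<Rightarrow> (nat \<Rightarrow> 'a) \<Rightarrow> (nat \<Rightarrow> 'a) \<Rightarrow> bool" where
  "euler_inhom T n f g \<rho> \<sigma> b0 bx0 b' bx' P Px Q \<longleftrightarrow> (let \<tau> = T / real n in \<forall>j\<in>{1..n}.
     (P j - (b0 + \<tau> *\<^sub>R (\<Sum>i=1..j. b' (real i * \<tau>))), Px j - (bx0 + \<tau> *\<^sub>R (\<Sum>i=1..j. bx' (real i * \<tau>)))) \<in> V \<and>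
     (\<forall>q qx. (q, qx) \<in> V \<longrightarrow> (1 / \<tau>) *\<^sub>R (P j - P (j - 1)) \<bullet> q + A (P j) \<bullet> q - Q j \<bullet> qx
        = g (real j * \<tau>) \<bullet> q - (\<rho> (real j * \<tau>) \<bullet> qx + \<sigma> (real j * \<tau>) \<bullet> q)) \<and>
     Px j + D (Q j) = f (real j * \<tau>))"

text \<open>\<open>b\<close> is a lifting of the boundary values and \<open>\<rho>\<close>, \<open>\<sigma>\<close> represent the functional \<open>\<C>\<^sup>* r\<close>. Passing to
  \<open>p - b\<close> and \<open>m - \<rho>\<close> turns both problems into homogeneous ones.\<close>

theorem euler_error_bound:
  assumes T: "0 < T"
    and f: "H1_time T f" and g: "H1_time T g" and \<sigma>: "H1_time T \<sigma>"
    and \<rho>: "\<And>t. t \<in> {0..T} \<Longrightarrow> (\<rho> has_vector_derivative \<rho>' t) (at t within {0..T})" "H1_time T \<rho>'"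
    and b: "\<And>t. t \<in> {0..T} \<Longrightarrow> (b has_vector_derivative b' t) (at t within {0..T})" "H1_time T b'"
    and bx: "\<And>t. t \<in> {0..T} \<Longrightarrow> (bx has_vector_derivative bx' t) (at t within {0..T})" "H1_time T bx'"
    and compat: "D m0 = f 0 - px0"
    and s0: "\<And>q qx. (q, qx) \<in> V \<Longrightarrow> s0 \<bullet> q = m0 \<bullet> qx - (\<rho> 0 \<bullet> qx + \<sigma> 0 \<bullet> q)"
  shows "\<exists>C\<ge>0. \<forall>\<epsilon> n p px m p' m' P Px Q. 0 < \<epsilon> \<longrightarrow> \<epsilon> \<le> 1 \<longrightarrow> 0 < n \<longrightarrow>
    hyperbolic_inhom T \<epsilon> f g \<rho> \<sigma> b bx p px m p' m' \<longrightarrow>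
    p 0 = p0 \<longrightarrow> px 0 = px0 \<longrightarrow> m 0 = m0 \<longrightarrow>
    P 0 = p0 \<longrightarrow> Px 0 = px0 \<longrightarrow>
    euler_inhom T n f g \<rho> \<sigma> (b 0) (bx 0) b' bx' P Px Q \<longrightarrow>
    error_estimate T C \<epsilon> n p px m P Px Q"
proof -
  \<comment> \<open>\<open>F\<close> and \<open>G\<close> result from inserting
    \<open>p = u + b\<close> and \<open>m = v + \<rho>\<close>; the term
    \<open>\<epsilon> \<rho>'\<close> is kept apart as \<open>R\<close>.\<close>
  define F where "F t = f t - D (\<rho> t) - bx t" for t
  define G where "G t = g t - \<sigma> t - A (b t) - b' t" for t
  have Dm: "H1_time T (\<lambda>t. D (\<rho> t))"
    by (rule H1_time_bounded_increments[OF H1_time_of_derivative[OF \<rho>], where c = d_up])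
      (simp_all add: D_bound flip: linear_diff[OF D])
  have Am: "H1_time T (\<lambda>t. A (b t))"
    by (rule H1_time_bounded_increments[OF H1_time_of_derivative[OF b], where c = a_up])
      (simp_all add: A_bound flip: linear_diff[OF A])
  have F: "H1_time T F"
    unfolding F_def by (intro H1_time_diff f Dm H1_time_of_derivative[OF bx])
  have G: "H1_time T G"
    unfolding G_def by (intro H1_time_diff g \<sigma> Am b(2))
  obtain \<Psi> where \<Psi>: "time_modulus T \<Psi>" "has_modulus T \<Psi> b'" "has_modulus T \<Psi> bx'"
  proof -
    obtain \<Psi>1 where 1: "time_modulus T \<Psi>1" "has_modulus T \<Psi>1 b'" using b(2) by (auto simp: H1_time_def)
    obtain \<Psi>2 where 2: "time_modulus T \<Psi>2" "has_modulus T \<Psi>2 bx'"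
      "\<And>s t. 0 \<le> s \<Longrightarrow> s \<le> t \<Longrightarrow> t \<le> T \<Longrightarrow> \<Psi>1 t - \<Psi>1 s \<le> \<Psi>2 t - \<Psi>2 s"
      using H1_time_common[OF bx(2) 1(1)] by metis
    show ?thesis by (rule that[OF 2(1) has_modulus_weaken[OF 1(2) 2(3)] 2(2)])
  qed
  \<comment> \<open>The increments of the two defects are bounded by the squared
    \<open>a_up * T\<close>, respectively \<open>T\<close>, times those of \<open>\<Psi>\<close>.
    The common modulus \<open>\<Phi>\<close> has to dominate \<open>c * \<Psi>\<close>, which covers
    both.\<close>
  define c where "c = (1 + a_up\<^sup>2) * T\<^sup>2"
  have c0: "0 \<le> c" and c1: "T\<^sup>2 \<le> c" and c2: "a_up\<^sup>2 * T\<^sup>2 \<le> c"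
    unfolding c_def by (auto simp: algebra_simps)
  obtain \<Phi> where \<Phi>: "time_modulus T \<Phi>" "has_modulus T \<Phi> F" "has_modulus T \<Phi> G" "has_modulus T \<Phi> \<rho>'"
    "\<And>s t. 0 \<le> s \<Longrightarrow> s \<le> t \<Longrightarrow> t \<le> T \<Longrightarrow> c * \<Psi> t - c * \<Psi> s \<le> \<Phi> t - \<Phi> s"
  proof -
    obtain \<Phi>1 where 1: "time_modulus T \<Phi>1" "has_modulus T \<Phi>1 F"
      "\<And>s t. 0 \<le> s \<Longrightarrow> s \<le> t \<Longrightarrow> t \<le> T \<Longrightarrow> c * \<Psi> t - c * \<Psi> s \<le> \<Phi>1 t - \<Phi>1 s"
      using H1_time_common[OF F time_modulus_cmult[OF \<Psi>(1) c0]] by metis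
    obtain \<Phi>2 where 2: "time_modulus T \<Phi>2" "has_modulus T \<Phi>2 G"
      "\<And>s t. 0 \<le> s \<Longrightarrow> s \<le> t \<Longrightarrow> t \<le> T \<Longrightarrow> \<Phi>1 t - \<Phi>1 s \<le> \<Phi>2 t - \<Phi>2 s"
      using H1_time_common[OF G 1(1)] by metis
    obtain \<Phi>3 where 3: "time_modulus T \<Phi>3" "has_modulus T \<Phi>3 \<rho>'"
      "\<And>s t. 0 \<le> s \<Longrightarrow> s \<le> t \<Longrightarrow> t \<le> T \<Longrightarrow> \<Phi>2 t - \<Phi>2 s \<le> \<Phi>3 t - \<Phi>3 s"
      using H1_time_common[OF \<rho>(2) 2(1)] by metis
    show ?thesis
    proof (rule that[OF 3(1) _ has_modulus_weaken[OF 2(2) 3(3)] 3(2)])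
      show "has_modulus T \<Phi>3 F"
        using 1(2) by (rule has_modulus_weaken) (meson 2(3) 3(3) order_trans)
      show "c * \<Psi> t - c * \<Psi> s \<le> \<Phi>3 t - \<Phi>3 s" if "0 \<le> s" "s \<le> t" "t \<le> T" for s t
        using 1(3)[OF that] 2(3)[OF that] 3(3)[OF that] by linarith
    qed
  qed
  obtain L\<rho> where L\<rho>: "0 \<le> L\<rho>" "\<And>t. t \<in> {0..T} \<Longrightarrow> norm (\<rho>' t) \<le> L\<rho>"
    using bounded_of_H1_time[OF \<rho>(2)] by blast
  obtain Lb where Lb: "0 \<le> Lb" "\<And>t. t \<in> {0..T} \<Longrightarrow> norm (b' t) \<le> Lb"
    using bounded_of_H1_time[OF b(2)] by blast
  obtain Lbx where Lbx: "0 \<le> Lbx" "\<And>t. t \<in> {0..T} \<Longrightarrow> norm (bx' t) \<le> Lbx"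
    using bounded_of_H1_time[OF bx(2)] by blast
  define Kb where "Kb = T + (\<Psi> T - \<Psi> 0)"
  have Kb: "0 \<le> Kb" using T time_modulus_mono[OF \<Psi>(1), of 0 T] by (simp add: Kb_def)
  \<comment> \<open>\<open>\<tau> * Kb\<close> bounds the quadrature error of either lifting;
    \<open>K\<close> covers it with and without the operator \<open>A\<close>.\<close>
  define K where "K = (1 + a_up\<^sup>2) * Kb\<^sup>2"
  have K0: "0 \<le> K" and K1: "Kb\<^sup>2 \<le> K" and K2: "a_up\<^sup>2 * Kb\<^sup>2 \<le> K"
    unfolding K_def by (auto simp: algebra_simps)
  \<comment> \<open>Adding \<open>\<sigma> 0\<close> to \<open>s0\<close> removes the part of the
    load paired with the test function, so that \<open>m0 - \<rho> 0\<close> tested against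
    derivatives remains.\<close>
  interpret ed: evolution_data V A D a_up d_lo d_up T \<Phi> F G \<rho>' "p0 - b 0" "px0 - bx 0" "m0 - \<rho> 0"
    "s0 + \<sigma> 0" "L\<rho>\<^sup>2" K
  proof
    show "D (m0 - \<rho> 0) = F 0 - (px0 - bx 0)" using compat by (simp add: F_def linear_diff[OF D])
    show "(s0 + \<sigma> 0) \<bullet> q = (m0 - \<rho> 0) \<bullet> qx" if "(q, qx) \<in> V" for q qx
      using s0[OF that] by (simp add: inner_add_left inner_diff_left)
    show "(norm (\<rho>' t))\<^sup>2 \<le> L\<rho>\<^sup>2" if "t \<in> {0..T}" for t using L\<rho>(2)[OF that] by (intro power_mono) auto
  qed (use T \<Phi> K0 in auto)
  \<comment> \<open>\<open>\<tau> * M\<close> bounds what the liftings add to the error: three times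
    the Lipschitz constants for the move to the grid point, \<open>Kb\<close> for the quadrature
    error, and one further \<open>Lb\<close> for the interpolated increment of the lifting.\<close>
  define M where "M = 3 * Lb + 3 * Lbx + 3 * L\<rho> + Kb + Lb"
  have M0: "0 \<le> M" using Lb Lbx L\<rho> Kb by (simp add: M_def)
  \<comment> \<open>The sum of what the pointwise estimate
    (\<open>2 * C_fin + 2 * M\<^sup>2\<close>) and the integrated one
    (\<open>4 * C_int + 6 * T * M\<^sup>2\<close>) require.\<close>
  define C where "C = 2 * ed.C_fin + 4 * ed.C_int + 6 * T * M\<^sup>2 + 2 * M\<^sup>2"
  show ?thesis
  proof (intro exI[of _ C] conjI allI impI)
    show "0 \<le> C" using ed.C_nonneg T by (simp add: C_def)
    fix \<epsilon> n p px m p' m' P Px Q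
    assume \<epsilon>: "0 < \<epsilon>" "\<epsilon> \<le> 1" and n: "0 < n"
      and hyp: "hyperbolic_inhom T \<epsilon> f g \<rho> \<sigma> b bx p px m p' m'"
      and init: "p 0 = p0" "px 0 = px0" "m 0 = m0" "P 0 = p0" "Px 0 = px0"
      and eu: "euler_inhom T n f g \<rho> \<sigma> (b 0) (bx 0) b' bx' P Px Q"
    define \<tau> where "\<tau> = T / real n"
    have \<tau>: "0 < \<tau>" "real n * \<tau> = T" using n T by (auto simp: \<tau>_def)
    have g: "real j * \<tau> \<in> {0..T}" if "j \<le> n" for j
      using \<tau> mult_right_mono[of "real j" "real n" \<tau>] that by auto
    have sub: "cell \<tau> j \<subseteq> {0..T}" if "j \<in> {1..n}" for j
    proof -
      have "0 \<le> real (j - 1) * \<tau>" "real j * \<tau> \<le> T" using g[of j] g[of "j - 1"] that by auto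
      then show ?thesis by (auto intro: order_trans)
    qed
    define B where "B j = b 0 + \<tau> *\<^sub>R (\<Sum>i=1..j. b' (real i * \<tau>))" for j
    define Bx where "Bx j = bx 0 + \<tau> *\<^sub>R (\<Sum>i=1..j. bx' (real i * \<tau>))" for j
    define u where "u t = p t - b t" for t
    define ux where "ux t = px t - bx t" for t
    define v where "v t = m t - \<rho> t" for t
    define U where "U j = P j - B j" for j
    define Ux where "Ux j = Px j - Bx j" for j
    \<comment> \<open>\<open>Q 0\<close> is not determined by the scheme and is replaced by
      \<open>m0\<close>.\<close>
    define Z where "Z j = (if j = 0 then m0 else Q j) - \<rho> (real j * \<tau>)" for j
    \<comment> \<open>\<open>G\<close> and \<open>F\<close> contain the exact lifting at the grid
      point while the scheme carries \<open>B j\<close> and \<open>Bx j\<close>; the discrepancies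
      are \<open>\<gamma>\<close> and \<open>\<phi>\<close>.\<close>
    define \<gamma> where "\<gamma> j = A (B j - b (real j * \<tau>))" for j
    define \<phi> where "\<phi> j = Bx j - bx (real j * \<tau>)" for j
    have hypc: "continuous_on {0..T} m'" using hyp unfolding hyperbolic_inhom_def by blast
    have hypD: "(p has_vector_derivative p' t) (at t within {0..T})"
        "(m has_vector_derivative m' t) (at t within {0..T})" "(p t - b t, px t - bx t) \<in> V"
        "\<And>q qx. (q, qx) \<in> V \<Longrightarrow> p' t \<bullet> q + A (p t) \<bullet> q - m t \<bullet> qx = g t \<bullet> q - (\<rho> t \<bullet> qx + \<sigma> t \<bullet> q)"
        "\<epsilon> *\<^sub>R m' t + px t + D (m t) = f t" if "t \<in> {0..T}" for t
      using hyp that unfolding hyperbolic_inhom_def by blast+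
    have euD: "(U j, Ux j) \<in> V"
      "\<And>q qx. (q, qx) \<in> V \<Longrightarrow> (1 / \<tau>) *\<^sub>R (P j - P (j - 1)) \<bullet> q + A (P j) \<bullet> q - Q j \<bullet> qx
        = g (real j * \<tau>) \<bullet> q - (\<rho> (real j * \<tau>) \<bullet> qx + \<sigma> (real j * \<tau>) \<bullet> q)"
      "Px j + D (Q j) = f (real j * \<tau>)" if "j \<in> {1..n}" for j
      using eu that unfolding euler_inhom_def Let_def \<tau>_def[symmetric] U_def Ux_def B_def Bx_def by blast+
    have hyp': "hyperbolic T \<epsilon> F G \<rho>' u ux v (\<lambda>t. p' t - b' t) (\<lambda>t. m' t - \<rho>' t)"
      unfolding hyperbolic_def
    proof (intro conjI ballI allI impI)
      show "continuous_on {0..T} (\<lambda>t. m' t - \<rho>' t)"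
        by (intro continuous_intros hypc H1_time_continuous_on \<rho>)
      fix t assume t: "t \<in> {0..T}"
      show "(u has_vector_derivative p' t - b' t) (at t within {0..T})"
        unfolding u_def by (intro has_vector_derivative_diff hypD b t)
      show "(v has_vector_derivative m' t - \<rho>' t) (at t within {0..T})"
        unfolding v_def by (intro has_vector_derivative_diff hypD \<rho> t)
      show "(u t, ux t) \<in> V" unfolding u_def ux_def using hypD(3)[OF t] .
      show "(p' t - b' t) \<bullet> q + A (u t) \<bullet> q - v t \<bullet> qx = G t \<bullet> q" if "(q, qx) \<in> V" for q qx
        using hypD(4)[OF t that]
        by (simp add: u_def v_def G_def linear_diff[OF A] inner_diff_left)
      show "\<epsilon> *\<^sub>R (m' t - \<rho>' t) + ux t + D (v t) = F t - \<epsilon> *\<^sub>R \<rho>' t"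
        using hypD(5)[OF t] by (simp add: ux_def v_def F_def linear_diff[OF D] algebra_simps)
    qed
    have reb1: "(norm ((B j - b (real j * \<tau>)) - (B (j - 1) - b (real (j - 1) * \<tau>))))\<^sup>2
        \<le> T\<^sup>2 * (\<tau> * (\<Psi> (real j * \<tau>) - \<Psi> (real (j - 1) * \<tau>)))" if "j \<in> {1..n}" for j
      using right_endpoint_rule(1)[of T b b' \<Psi> n j] b(1) \<Psi>(1,2) n T that
      unfolding B_def \<tau>_def[symmetric] by blast
    have reb2: "norm (B j - b (real j * \<tau>)) \<le> \<tau> * Kb" if "j \<le> n" for j
      using right_endpoint_rule(2)[of T b b' \<Psi> n j] b(1) \<Psi>(1,2) n T that
      unfolding B_def \<tau>_def[symmetric] Kb_def by blast
    have rebx1: "(norm ((Bx j - bx (real j * \<tau>)) - (Bx (j - 1) - bx (real (j - 1) * \<tau>))))\<^sup>2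
        \<le> T\<^sup>2 * (\<tau> * (\<Psi> (real j * \<tau>) - \<Psi> (real (j - 1) * \<tau>)))" if "j \<in> {1..n}" for j
      using right_endpoint_rule(1)[of T bx bx' \<Psi> n j] bx(1) \<Psi>(1,3) n T that
      unfolding Bx_def \<tau>_def[symmetric] by blast
    have rebx2: "norm (Bx j - bx (real j * \<tau>)) \<le> \<tau> * Kb" if "j \<le> n" for j
      using right_endpoint_rule(2)[of T bx bx' \<Psi> n j] bx(1) \<Psi>(1,3) n T that
      unfolding Bx_def \<tau>_def[symmetric] Kb_def by blast
    let ?\<Delta> = "\<lambda>j. \<Phi> (real j * \<tau>) - \<Phi> (real (j - 1) * \<tau>)"
    have cpsi: "c * (\<tau> * (\<Psi> (real j * \<tau>) - \<Psi> (real (j - 1) * \<tau>))) \<le> \<tau> * ?\<Delta> j"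
      and psi0: "0 \<le> \<tau> * (\<Psi> (real j * \<tau>) - \<Psi> (real (j - 1) * \<tau>))" if j: "j \<in> {1..n}" for j
    proof -
      have le: "0 \<le> real (j - 1) * \<tau>" "real (j - 1) * \<tau> \<le> real j * \<tau>" "real j * \<tau> \<le> T"
        using g[of j] g[of "j - 1"] \<tau> j by (auto intro: mult_right_mono)
      have "\<tau> * (c * \<Psi> (real j * \<tau>) - c * \<Psi> (real (j - 1) * \<tau>)) \<le> \<tau> * ?\<Delta> j"
        using \<Phi>(5)[OF le] \<tau> by (intro mult_left_mono) auto
      then show "c * (\<tau> * (\<Psi> (real j * \<tau>) - \<Psi> (real (j - 1) * \<tau>))) \<le> \<tau> * ?\<Delta> j"
        by (simp add: algebra_simps)
      show "0 \<le> \<tau> * (\<Psi> (real j * \<tau>) - \<Psi> (real (j - 1) * \<tau>))"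
        using time_modulus_mono[OF \<Psi>(1) le] \<tau> by simp
    qed
    have eu': "ed.euler n \<gamma> \<phi> U Ux Z"
      unfolding ed.euler_def Let_def \<tau>_def[symmetric]
    proof (intro conjI ballI allI impI)
      show "U 0 = p0 - b 0" "Ux 0 = px0 - bx 0" "Z 0 = m0 - \<rho> 0" "\<gamma> 0 = 0" "\<phi> 0 = 0"
        by (simp_all add: U_def Ux_def Z_def \<gamma>_def \<phi>_def B_def Bx_def init linear_0[OF A])
    next
      fix j assume j: "j \<le> n"
      show "(U j, Ux j) \<in> V"
      proof (cases "j = 0")
        case True
        then show ?thesis
          using hypD(3)[of 0] T by (simp add: U_def Ux_def B_def Bx_def init)
      next
        case False
        then show ?thesis using euD(1)[of j] j by simp
      qed
      have "(norm (\<gamma> j))\<^sup>2 \<le> a_up\<^sup>2 * (norm (B j - b (real j * \<tau>)))\<^sup>2"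
        unfolding \<gamma>_def by (rule A_bound_power2)
      also have "\<dots> \<le> a_up\<^sup>2 * (\<tau> * Kb)\<^sup>2"
        using reb2[OF j] by (intro mult_left_mono power_mono) auto
      also have "\<dots> \<le> K * \<tau>\<^sup>2"
        using mult_right_mono[OF K2, of "\<tau>\<^sup>2"] by (simp add: power_mult_distrib algebra_simps)
      finally show "(norm (\<gamma> j))\<^sup>2 \<le> K * \<tau>\<^sup>2" .
      have "(norm (\<phi> j))\<^sup>2 \<le> (\<tau> * Kb)\<^sup>2"
        unfolding \<phi>_def using rebx2[OF j] by (intro power_mono) auto
      also have "\<dots> \<le> K * \<tau>\<^sup>2"
        using mult_right_mono[OF K1, of "\<tau>\<^sup>2"] by (simp add: power_mult_distrib algebra_simps)
      finally show "(norm (\<phi> j))\<^sup>2 \<le> K * \<tau>\<^sup>2" .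
    next
      fix j assume j: "j \<in> {1..n}"
      have "\<gamma> j - \<gamma> (j - 1) = A ((B j - b (real j * \<tau>)) - (B (j - 1) - b (real (j - 1) * \<tau>)))"
        by (simp add: \<gamma>_def linear_diff[OF A])
      then have "(norm (\<gamma> j - \<gamma> (j - 1)))\<^sup>2
          \<le> a_up\<^sup>2 * (norm ((B j - b (real j * \<tau>)) - (B (j - 1) - b (real (j - 1) * \<tau>))))\<^sup>2"
        using A_bound_power2 by metis
      also have "\<dots> \<le> a_up\<^sup>2 * (T\<^sup>2 * (\<tau> * (\<Psi> (real j * \<tau>) - \<Psi> (real (j - 1) * \<tau>))))"
        using reb1[OF j] by (intro mult_left_mono) auto
      also have "\<dots> \<le> c * (\<tau> * (\<Psi> (real j * \<tau>) - \<Psi> (real (j - 1) * \<tau>)))"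
        using mult_right_mono[OF c2 psi0[OF j]] by (simp only: mult.assoc)
      also have "\<dots> \<le> \<tau> * ?\<Delta> j" by (rule cpsi[OF j])
      finally show "(norm (\<gamma> j - \<gamma> (j - 1)))\<^sup>2 \<le> \<tau> * ?\<Delta> j" .
      have "(norm (\<phi> j - \<phi> (j - 1)))\<^sup>2 \<le> T\<^sup>2 * (\<tau> * (\<Psi> (real j * \<tau>) - \<Psi> (real (j - 1) * \<tau>)))"
        unfolding \<phi>_def by (rule rebx1[OF j])
      also have "\<dots> \<le> c * (\<tau> * (\<Psi> (real j * \<tau>) - \<Psi> (real (j - 1) * \<tau>)))"
        using mult_right_mono[OF c1 psi0[OF j]] .
      also have "\<dots> \<le> \<tau> * ?\<Delta> j" by (rule cpsi[OF j])
      finally show "(norm (\<phi> j - \<phi> (j - 1)))\<^sup>2 \<le> \<tau> * ?\<Delta> j" .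
      obtain i where i: "j = Suc i" using j by (cases j) auto
      \<comment> \<open>The difference quotient of the accumulated lifting is exactly
        \<open>b'\<close> at the grid point, as in \<open>G\<close>; the time derivative therefore
        leaves no defect.\<close>
      have UU: "(1 / \<tau>) *\<^sub>R (U j - U (j - 1)) = (1 / \<tau>) *\<^sub>R (P j - P (j - 1)) - b' (real j * \<tau>)"
      proof -
        have "U j - U (j - 1) = (P j - P (j - 1)) - \<tau> *\<^sub>R b' (real j * \<tau>)"
          unfolding U_def B_def i by (simp add: scaleR_add_right)
        then show ?thesis using \<tau> by (simp add: scaleR_diff_right)
      qed
      show "(1 / \<tau>) *\<^sub>R (U j - U (j - 1)) \<bullet> q + A (U j) \<bullet> q - Z j \<bullet> qx
          = (G (real j * \<tau>) - \<gamma> j) \<bullet> q" if "(q, qx) \<in> V" for q qx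
        using euD(2)[OF j that] j unfolding UU
        by (simp add: U_def Z_def G_def \<gamma>_def linear_diff[OF A] inner_diff_left)
      show "Ux j + D (Z j) = F (real j * \<tau>) - \<phi> j"
        using euD(3)[OF j] j by (simp add: Ux_def Z_def F_def \<phi>_def linear_diff[OF D] algebra_simps)
    qed
    have init': "u 0 = p0 - b 0" "ux 0 = px0 - bx 0" "v 0 = m0 - \<rho> 0"
      by (simp_all add: u_def ux_def v_def init)
    note args = n \<tau>_def eu' \<epsilon> hyp' init'
    have Lip: "norm (X t - X (real j * \<tau>)) \<le> 3 * L * \<tau>"
      if "\<And>t. t \<in> {0..T} \<Longrightarrow> (X has_vector_derivative X' t) (at t within {0..T})"
        "\<And>t. t \<in> {0..T} \<Longrightarrow> norm (X' t) \<le> L" "0 \<le> L" and j: "j \<in> {1..n}"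
        and t: "t \<in> cell \<tau> j" for X X' and L t :: real and j
    proof -
      have "norm (X t - X (real j * \<tau>)) \<le> 3 * L * \<bar>t - real j * \<tau>\<bar>"
        using j g[of j] sub[OF j] t that(1,2) by (intro Lipschitz_of_derivative[where X' = X']) auto
      also have "\<dots> \<le> 3 * L * \<tau>"
        using t j \<open>0 \<le> L\<close> by (intro mult_left_mono) (auto simp: of_nat_diff algebra_simps)
      finally show ?thesis .
    qed
    have tau_le: "\<tau> * x \<le> \<tau> * M \<Longrightarrow> norm y \<le> \<tau> * x \<Longrightarrow> (norm y)\<^sup>2 \<le> M\<^sup>2 * \<tau>\<^sup>2" for x and y :: 'a
      using power_mono[of "norm y" "\<tau> * M" 2] by (simp add: power_mult_distrib mult.commute)
    have eb: "norm (b t - B j) \<le> \<tau> * (3 * Lb + Kb)" and ebx: "norm (bx t - Bx j) \<le> \<tau> * (3 * Lbx + Kb)"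
      and er: "norm (\<rho> t - \<rho> (real j * \<tau>)) \<le> \<tau> * (3 * L\<rho>)"
      if j: "j \<in> {1..n}" and t: "t \<in> cell \<tau> j" for j t
    proof -
      have "norm (b t - B j) \<le> norm (b t - b (real j * \<tau>)) + norm (B j - b (real j * \<tau>))"
        using norm_triangle_ineq4[of "b t - b (real j * \<tau>)" "B j - b (real j * \<tau>)"] by simp
      also have "\<dots> \<le> 3 * Lb * \<tau> + \<tau> * Kb"
        using Lip[of b b' Lb j t] b(1) Lb t reb2[of j] j by (intro add_mono) auto
      finally show "norm (b t - B j) \<le> \<tau> * (3 * Lb + Kb)" by (simp add: algebra_simps)
      have "norm (bx t - Bx j) \<le> norm (bx t - bx (real j * \<tau>)) + norm (Bx j - bx (real j * \<tau>))"
        using norm_triangle_ineq4[of "bx t - bx (real j * \<tau>)" "Bx j - bx (real j * \<tau>)"] by simp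
      also have "\<dots> \<le> 3 * Lbx * \<tau> + \<tau> * Kb"
        using Lip[of bx bx' Lbx j t] bx(1) Lbx t rebx2[of j] j by (intro add_mono) auto
      finally show "norm (bx t - Bx j) \<le> \<tau> * (3 * Lbx + Kb)" by (simp add: algebra_simps)
      show "norm (\<rho> t - \<rho> (real j * \<tau>)) \<le> \<tau> * (3 * L\<rho>)"
        using Lip[of \<rho> \<rho>' L\<rho> j t] \<rho>(1) L\<rho> j t by (simp add: algebra_simps)
    qed
    have Mle: "\<tau> * (3 * Lb + Kb + Lb) \<le> \<tau> * M" "\<tau> * (3 * Lb + Kb) \<le> \<tau> * M"
      "\<tau> * (3 * Lbx + Kb) \<le> \<tau> * M" "\<tau> * (3 * L\<rho>) \<le> \<tau> * M"
      using \<tau> Lb Lbx L\<rho> Kb by (intro mult_left_mono; simp add: M_def)+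
    have first: "(norm (p t - (P j - ((real j * \<tau> - t) / \<tau>) *\<^sub>R (P j - P (j - 1)))))\<^sup>2 \<le> C * (\<tau>\<^sup>2 + \<epsilon>\<^sup>2)"
      if j: "j \<in> {1..n}" and t: "t \<in> cell \<tau> j" for j t
    proof -
      define \<theta> where "\<theta> = (real j * \<tau> - t) / \<tau>"
      have \<theta>: "0 \<le> \<theta>" "\<theta> \<le> 1"
        using t \<tau> j by (auto simp: \<theta>_def field_simps of_nat_diff)
      obtain i where i: "j = Suc i" using j by (cases j) auto
      have BB: "B j - B (j - 1) = \<tau> *\<^sub>R b' (real j * \<tau>)"
        unfolding B_def i by (simp add: scaleR_add_right)
      define y where "y = (b t - B j) + \<theta> *\<^sub>R (B j - B (j - 1))"
      have eq: "p t - (P j - \<theta> *\<^sub>R (P j - P (j - 1))) = (u t - (U j - \<theta> *\<^sub>R (U j - U (j - 1)))) + y"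
        by (simp add: u_def U_def y_def algebra_simps)
      have "norm (\<theta> *\<^sub>R (B j - B (j - 1))) \<le> 1 * (\<tau> * Lb)"
        unfolding BB norm_scaleR using \<theta> \<tau> Lb(2)[of "real j * \<tau>"] g[of j] j
        by (intro mult_mono) auto
      then have "norm y \<le> \<tau> * (3 * Lb + Kb + Lb)"
        using eb[OF j t] norm_triangle_ineq[of "b t - B j" "\<theta> *\<^sub>R (B j - B (j - 1))"]
        unfolding y_def by (simp add: algebra_simps)
      then have "(norm y)\<^sup>2 \<le> M\<^sup>2 * \<tau>\<^sup>2" by (rule tau_le[OF Mle(1)])
      moreover have "(norm (u t - (U j - \<theta> *\<^sub>R (U j - U (j - 1)))))\<^sup>2 \<le> ed.C_fin * (\<tau>\<^sup>2 + \<epsilon>\<^sup>2)"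
        unfolding \<theta>_def by (rule ed.interpolant_error[OF args j t])
      ultimately have "(norm (p t - (P j - \<theta> *\<^sub>R (P j - P (j - 1)))))\<^sup>2
          \<le> 2 * (ed.C_fin * (\<tau>\<^sup>2 + \<epsilon>\<^sup>2)) + 2 * (M\<^sup>2 * \<tau>\<^sup>2)"
        unfolding eq using norm_add_power2_le[of "u t - (U j - \<theta> *\<^sub>R (U j - U (j - 1)))" y] by linarith
      also have "\<dots> \<le> C * (\<tau>\<^sup>2 + \<epsilon>\<^sup>2)"
      proof -
        have "C * (\<tau>\<^sup>2 + \<epsilon>\<^sup>2) - (2 * (ed.C_fin * (\<tau>\<^sup>2 + \<epsilon>\<^sup>2)) + 2 * (M\<^sup>2 * \<tau>\<^sup>2))
            = (4 * ed.C_int + 6 * T * M\<^sup>2) * (\<tau>\<^sup>2 + \<epsilon>\<^sup>2) + 2 * M\<^sup>2 * \<epsilon>\<^sup>2"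
          by (simp add: C_def algebra_simps)
        moreover have "0 \<le> \<dots>" using ed.C_nonneg T by simp
        ultimately show ?thesis by linarith
      qed
      finally show ?thesis by (simp add: \<theta>_def)
    qed
    define bnd where "bnd = ed.bnd \<tau> Z \<epsilon> v (\<lambda>t. m' t - \<rho>' t)"
    \<comment> \<open>Each of the three lifting contributions is at most the square of
      \<open>M * \<tau>\<close> and is doubled by the splitting, hence 6.\<close>
    define BB where "BB j t = 2 * bnd j t + 6 * (M\<^sup>2 * \<tau>\<^sup>2)" for j t
    have bndc: "continuous_on (cell \<tau> j) (bnd j)" if "j \<in> {1..n}" for j
      unfolding bnd_def by (rule ed.bnd_continuous[OF args that])
    have second: "(norm (p t - P j))\<^sup>2 + (norm (px t - Px j))\<^sup>2 + (norm (m t - Q j))\<^sup>2 \<le> BB j t"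
      if j: "j \<in> {1..n}" and t: "t \<in> cell \<tau> j" for j t
    proof -
      have "(norm (p t - P j))\<^sup>2 \<le> 2 * (norm (u t - U j))\<^sup>2 + 2 * (norm (b t - B j))\<^sup>2"
        using norm_add_power2_le[of "u t - U j" "b t - B j"] by (simp add: u_def U_def)
      moreover have "(norm (px t - Px j))\<^sup>2 \<le> 2 * (norm (ux t - Ux j))\<^sup>2 + 2 * (norm (bx t - Bx j))\<^sup>2"
        using norm_add_power2_le[of "ux t - Ux j" "bx t - Bx j"] by (simp add: ux_def Ux_def)
      moreover have "(norm (m t - Q j))\<^sup>2 \<le> 2 * (norm (v t - Z j))\<^sup>2 + 2 * (norm (\<rho> t - \<rho> (real j * \<tau>)))\<^sup>2"
        using norm_add_power2_le[of "v t - Z j" "\<rho> t - \<rho> (real j * \<tau>)"] j by (simp add: v_def Z_def)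
      moreover have "(norm (u t - U j))\<^sup>2 + (norm (ux t - Ux j))\<^sup>2 + (norm (v t - Z j))\<^sup>2 \<le> bnd j t"
        unfolding bnd_def by (rule ed.pointwise_error[OF args j t])
      ultimately show ?thesis
        using tau_le[OF Mle(2) eb[OF j t]] tau_le[OF Mle(3) ebx[OF j t]] tau_le[OF Mle(4) er[OF j t]]
        unfolding BB_def by linarith
    qed
    have "integral (cell \<tau> j) (BB j)
        = 2 * integral (cell \<tau> j) (bnd j) + \<tau> * (6 * (M\<^sup>2 * \<tau>\<^sup>2))"
      if j: "j \<in> {1..n}" for j
    proof -
      have "((\<lambda>t. 2 * bnd j t + 6 * (M\<^sup>2 * \<tau>\<^sup>2)) has_integral
          (2 * integral (cell \<tau> j) (bnd j)
            + measure lborel (cell \<tau> j) *\<^sub>R (6 * (M\<^sup>2 * \<tau>\<^sup>2)))) (cell \<tau> j)"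
        by (intro has_integral_add has_integral_mult_right integrable_integral has_integral_const_real
            integrable_continuous_real bndc j)
      moreover have "measure lborel (cell \<tau> j) = \<tau>"
        using j \<tau> by (simp add: of_nat_diff algebra_simps)
      ultimately show ?thesis unfolding BB_def by (simp add: integral_unique)
    qed
    then have "(\<Sum>j=1..n. integral (cell \<tau> j) (BB j))
        = (\<Sum>j=1..n. 2 * integral (cell \<tau> j) (bnd j) + \<tau> * (6 * (M\<^sup>2 * \<tau>\<^sup>2)))"
      by (intro sum.cong) auto
    also have "\<dots> = 2 * (\<Sum>j=1..n. integral (cell \<tau> j) (bnd j))
        + (real n * \<tau>) * (6 * (M\<^sup>2 * \<tau>\<^sup>2))"
      by (simp add: sum.distrib sum_distrib_left)
    also have "\<dots> \<le> 2 * (2 * ed.C_int * (\<tau>\<^sup>2 + \<epsilon>\<^sup>2)) + T * (6 * (M\<^sup>2 * \<tau>\<^sup>2))"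
      using ed.sum_integral_bnd[OF args, folded bnd_def] T unfolding \<tau>(2)
      by (intro add_mono mult_left_mono) auto
    also have "\<dots> \<le> C * (\<tau>\<^sup>2 + \<epsilon>\<^sup>2)"
    proof -
      have "C * (\<tau>\<^sup>2 + \<epsilon>\<^sup>2) - (2 * (2 * ed.C_int * (\<tau>\<^sup>2 + \<epsilon>\<^sup>2)) + T * (6 * (M\<^sup>2 * \<tau>\<^sup>2)))
          = (2 * ed.C_fin + 2 * M\<^sup>2) * (\<tau>\<^sup>2 + \<epsilon>\<^sup>2) + 6 * T * M\<^sup>2 * \<epsilon>\<^sup>2"
        by (simp add: C_def algebra_simps)
      moreover have "0 \<le> \<dots>" using ed.C_nonneg T by simp
      ultimately show ?thesis by linarith
    qed
    finally have third: "(\<Sum>j=1..n. integral (cell \<tau> j) (BB j)) \<le> C * (\<tau>\<^sup>2 + \<epsilon>\<^sup>2)" .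
    have BBc: "continuous_on (cell \<tau> j) (BB j)" if "j \<in> {1..n}" for j
      unfolding BB_def by (intro continuous_intros bndc that)
    show "error_estimate T C \<epsilon> n p px m P Px Q"
      unfolding error_estimate_def Let_def \<tau>_def[symmetric]
      by (intro conjI ballI exI[of _ BB] first second third BBc)
  qed
qed


end

section \<open>Indefinite integrals\<close>

lemma borel_measurable_lebesgue_on_borel:
  "w \<in> borel_measurable borel \<Longrightarrow> w \<in> borel_measurable (lebesgue_on S)"
  by (intro measurable_restrict_space1 measurable_completion) simp

text \<open>By completeness of Lebesgue measure, preimages that differ by a null set are measurable
  together.\<close>

lemma borel_measurable_lebesgue_AE:
  fixes f g :: "real \<Rightarrow> real"
  assumes f: "f \<in> borel_measurable lebesgue" and ae: "AE x in lebesgue. f x = g x"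
  shows "g \<in> borel_measurable lebesgue"
proof (rule measurableI)
  fix B :: "real set" assume B: "B \<in> sets borel"
  show "g -` B \<inter> space lebesgue \<in> sets lebesgue"
  proof (rule completion.in_sets_AE)
    show "f -` B \<inter> space lebesgue \<in> sets lebesgue" using measurable_sets[OF f B] .
    show "AE x in lebesgue. (x \<in> f -` B \<inter> space lebesgue) = (x \<in> g -` B \<inter> space lebesgue)"
      using ae by eventually_elim simp
  qed simp
qed simp

lemma borel_measurable_lebesgue_on_AE:
  fixes f g :: "real \<Rightarrow> real"
  assumes S: "S \<in> sets lebesgue" and f: "f \<in> borel_measurable (lebesgue_on S)"
    and ae: "AE x in lebesgue_on S. f x = g x"
  shows "g \<in> borel_measurable (lebesgue_on S)"
proof -
  have "AE x in lebesgue. x \<in> S \<longrightarrow> f x = g x"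
    using ae S by (simp add: AE_restrict_space_iff)
  then have "AE x in lebesgue. (if x \<in> S then f x else 0) = (if x \<in> S then g x else 0)"
    by eventually_elim auto
  then have "(\<lambda>x. if x \<in> S then g x else 0) \<in> borel_measurable lebesgue"
    using borel_measurable_if_I[OF f S] by (rule borel_measurable_lebesgue_AE[rotated])
  then show ?thesis by (rule borel_measurable_if_D)
qed

lemma sq_integrable_lebesgue_on:
  assumes "S \<in> sets lebesgue"
  shows "sq_integrable (lebesgue_on S) u \<longleftrightarrow> sq_integrable lebesgue (\<lambda>x. if x \<in> S then u x else (0::real))"
proof -
  have "(\<lambda>x. (if x \<in> S then u x else 0)\<^sup>2) = (\<lambda>x. if x \<in> S then (u x)\<^sup>2 else 0)" by auto
  then show ?thesis
    using Lebesgue_Measure.integrable_restrict_UNIV[OF assms, of "\<lambda>x. (u x)\<^sup>2"] borel_measurable_if[OF assms, of u]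
    by (simp add: sq_integrable_def)
qed

lemma integrable_indicator_Icc: "integrable lborel (indicator {a..b} :: real \<Rightarrow> real)"
  by (rule integrable_real_indicator) (auto simp: emeasure_lborel_Icc_eq)

lemma sq_integrable_integrable_finite:
  fixes a b :: real
  assumes u: "sq_integrable (lebesgue_on {a..b}) u"
  shows "integrable (lebesgue_on {a..b}) u"
proof -
  have "sq_integrable (lebesgue_on {a..b}) (\<lambda>_. 1)"
  proof -
    have "integrable lebesgue (\<lambda>x. if x \<in> {a..b} then 1 else 0 :: real)"
    proof -
      have "(indicator {a..b} :: real \<Rightarrow> real) = (\<lambda>x. if x \<in> {a..b} then 1 else 0)"
        by (auto simp: indicator_def)
      then show ?thesis using integrable_indicator_Icc[of a b] by (subst integrable_completion) auto
    qed
    then show ?thesis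
      by (subst (asm) Lebesgue_Measure.integrable_restrict_UNIV) (auto simp: sq_integrable_def)
  qed
  from sq_integrable_mult_integrable[OF this u] show ?thesis by simp
qed

lemma LINT_lebesgue_on_borel:
  fixes w :: "real \<Rightarrow> real"
  assumes "w \<in> borel_measurable borel" "S \<in> sets borel"
  shows "(LINT x|lebesgue_on S. w x) = (LINT x|lborel. indicator S x * w x)"
proof -
  have "(LINT x|lebesgue_on S. w x) = (LINT x|lebesgue. (if x \<in> S then w x else 0))"
    using assms by (subst Lebesgue_Measure.integral_restrict_UNIV) auto
  also have "\<dots> = (LINT x|lebesgue. indicator S x * w x)"
    by (intro Bochner_Integration.integral_cong) (auto simp: indicator_def)
  also have "\<dots> = (LINT x|lborel. indicator S x * w x)"
    using assms by (intro integral_completion) (auto intro!: borel_measurable_times simp: measurable_lborel1)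
  finally show ?thesis .
qed

lemma borel_representative:
  fixes w :: "real \<Rightarrow> real"
  assumes w: "w \<in> borel_measurable (lebesgue_on {a..b})"
  obtains w' where "w' \<in> borel_measurable borel" "AE x in lebesgue_on {a..b}. w x = w' x"
proof -
  have "(\<lambda>x. if x \<in> {a..b} then w x else 0) \<in> borel_measurable lebesgue"
    using w by (intro borel_measurable_if_I) auto
  then obtain w' where w': "w' \<in> borel_measurable lborel"
    and ae: "AE x in lborel. (if x \<in> {a..b} then w x else 0) = w' x"
    using completion_ex_borel_measurable_real by blast
  have "AE x in lebesgue. (if x \<in> {a..b} then w x else 0) = w' x"
    using ae by (rule AE_completion)
  then have "AE x in lebesgue_on {a..b}. w x = w' x"
    by (simp add: AE_restrict_space_iff) (elim AE_mp, auto)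
  with w' show ?thesis by (intro that[of w']) auto
qed

text \<open>Weak derivatives are Lebesgue measurable, while Fubini is applied to Borel functions on
  products of \<open>lborel\<close>. Passing to a Borel representative changes none of the integrals
  over initial segments.\<close>

lemma sq_integrable_borel_representative:
  fixes w :: "real \<Rightarrow> real"
  assumes w: "sq_integrable (lebesgue_on {0..l}) w"
  obtains w' where "w' \<in> borel_measurable borel" "AE x in lebesgue_on {0..l}. w x = w' x"
    "sq_integrable lborel (\<lambda>y. indicator {0..l} y * w' y)"
    "integrable lborel (\<lambda>y. indicator {0..l} y * w' y)"
    "\<forall>x\<in>{0..l}. (LINT y|lebesgue_on {0..x}. w y) = (LINT y|lborel. indicator {0..x} y * w' y)"
proof -
  obtain w' where w': "w' \<in> borel_measurable borel" and ae: "AE x in lebesgue_on {0..l}. w x = w' x"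
    using borel_representative[OF sq_integrable_measurable[OF w]] .
  have ae': "AE x in lebesgue. x \<in> {0..l} \<longrightarrow> w x = w' x"
    using ae by (simp add: AE_restrict_space_iff)
  have eq: "(\<lambda>x. if x \<in> {0..l} then w' x else 0) = (\<lambda>y. indicator {0..l} y * w' y)"
    by (auto simp: indicator_def)
  have m: "(\<lambda>y. indicator {0..l} y * w' y) \<in> borel_measurable borel" using w' by measurable
  have sq: "sq_integrable (lebesgue_on {0..l}) w'"
    using sq_integrable_cong_AE[OF w borel_measurable_lebesgue_on_borel[OF w'] ae] .
  then have "sq_integrable lebesgue (\<lambda>y. indicator {0..l} y * w' y)"
    unfolding eq[symmetric] by (subst (asm) sq_integrable_lebesgue_on) auto
  then have 1: "sq_integrable lborel (\<lambda>y. indicator {0..l} y * w' y)"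
    using m unfolding sq_integrable_def by (subst (asm) integrable_completion) auto
  have "integrable lebesgue (\<lambda>y. indicator {0..l} y * w' y)"
    using sq_integrable_integrable_finite[OF sq] unfolding eq[symmetric]
    by (subst Lebesgue_Measure.integrable_restrict_UNIV) auto
  then have 2: "integrable lborel (\<lambda>y. indicator {0..l} y * w' y)"
    using m by (subst (asm) integrable_completion) auto
  have 3: "(LINT y|lebesgue_on {0..x}. w y) = (LINT y|lborel. indicator {0..x} y * w' y)"
    if x: "x \<in> {0..l}" for x
  proof -
    have "AE y in lebesgue_on {0..x}. w y = w' y"
      using ae' x by (simp add: AE_restrict_space_iff) (elim AE_mp, auto)
    moreover have "w \<in> borel_measurable (lebesgue_on {0..x})"
      using sq_integrable_measurable[OF w] x by (auto intro: measurable_restrict_mono[where A = "{0..l}"])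
    ultimately have "(LINT y|lebesgue_on {0..x}. w y) = (LINT y|lebesgue_on {0..x}. w' y)"
      using w' by (intro integral_cong_AE) (auto intro: borel_measurable_lebesgue_on_borel)
    then show ?thesis using LINT_lebesgue_on_borel[OF w', of "{0..x}"] by simp
  qed
  show ?thesis by (rule that[OF w' ae 1 2 ballI[OF 3]])
qed

text \<open>\<open>\<Phi>\<close> is the indefinite integral of \<open>H\<close>. Half-open
  intervals are used because adjacent ones are disjoint, so integrals over them add up without
  correction at the common end point.\<close>

lemma modulus_of_integrable:
  fixes H :: "real \<Rightarrow> real"
  assumes Hi: "integrable lborel H" and H0: "\<And>r. 0 \<le> H r"
  obtains \<Phi> where "time_modulus T \<Phi>"
    "\<And>s t. 0 \<le> s \<Longrightarrow> s \<le> t \<Longrightarrow> (LINT r|lborel. indicator {s<..t} r * H r) = \<Phi> t - \<Phi> s"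
proof -
  have Hon: "H integrable_on {a..b}" for a b
    using integrable_on_lborel[OF Hi] by (rule integrable_on_subinterval) simp
  define \<Phi> where "\<Phi> t = integral {0..t} H" for t
  have "time_modulus T \<Phi>"
    unfolding time_modulus_def
  proof
    show "continuous_on {0..T} \<Phi>" unfolding \<Phi>_def by (rule indefinite_integral_continuous_1[OF Hon])
    show "mono_on {0..T} \<Phi>"
      unfolding mono_on_def \<Phi>_def by (auto intro!: integral_subset_le Hon H0)
  qed
  moreover have "(LINT r|lborel. indicator {s<..t} r * H r) = \<Phi> t - \<Phi> s" if "0 \<le> s" "s \<le> t" for s t
  proof -
    have "(LINT r|lborel. indicator {s<..t} r * H r) = (LINT r|lborel. indicator {s..t} r * H r)"
    proof (rule integral_cong_AE)
      show "AE r in lborel. indicator {s<..t} r * H r = indicator {s..t} r * H r"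
        using AE_lborel_singleton[of s] by eventually_elim (auto simp: indicator_def)
    qed (use Hi in measurable)
    also have "\<dots> = integral {s..t} H"
      using set_borel_integral_eq_integral(2)[of "{s..t}" H] integrable_mult_indicator[of "{s..t}" lborel H] Hi
      by (simp add: set_integrable_def set_lebesgue_integral_def)
    also have "\<dots> = \<Phi> t - \<Phi> s"
      unfolding \<Phi>_def
      using Henstock_Kurzweil_Integration.integral_combine[OF that Hon] by simp
    finally show ?thesis .
  qed
  ultimately show ?thesis by (rule that)
qed

text \<open>Rays form an intersection-stable generator of the Borel sets, and the sets over which
  \<open>w\<close> integrates to zero form a Dynkin system. A density all of whose set integrals
  vanish is null.\<close>

lemma AE_zero_of_integrals_zero:
  fixes w :: "real \<Rightarrow> real"
  assumes w: "integrable lborel w" and zero: "\<And>x. (LINT y|lborel. indicator {..x} y * w y) = 0"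
  shows "AE x in lborel. w x = 0"
proof (rule sigma_finite_measure.density_zero[OF lborel.sigma_finite_measure_axioms w])
  have int: "integrable lborel (\<lambda>y. indicator A y * w y)" if "A \<in> sets borel" for A
    using integrable_mult_indicator[OF _ w, of A] that by simp
  \<comment> \<open>The whole line is the limit of rays; the complement case of the induction needs
    this.\<close>
  have tot: "(LINT y|lborel. w y) = 0"
  proof -
    have "(\<lambda>n::nat. LINT y|lborel. indicator {..real n} y * w y) \<longlonglongrightarrow> (LINT y|lborel. w y)"
    proof (rule integral_dominated_convergence[where w = "\<lambda>y. norm (w y)"])
      show "AE y in lborel. (\<lambda>n. indicator {..real n} y * w y) \<longlonglongrightarrow> w y"
      proof (rule AE_I2)
        fix y :: real
        obtain N :: nat where "y \<le> real N" using real_arch_simple by blast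
        then have "\<forall>\<^sub>F n in sequentially. indicator {..real n} y * w y = w y"
          by (intro eventually_sequentiallyI[of N]) (auto simp: indicator_def)
        then show "(\<lambda>n. indicator {..real n} y * w y) \<longlonglongrightarrow> w y" by (rule tendsto_eventually)
      qed
    qed (use w int in \<open>auto simp: indicator_def\<close>)
    then show ?thesis by (simp add: zero LIMSEQ_const_iff)
  qed
  fix A assume "A \<in> sets (lborel :: real measure)"
  then have A: "A \<in> sigma_sets UNIV (range (\<lambda>a::real. {..a}))"
    by (simp add: borel_eq_atMost)
  have "Int_stable (range (\<lambda>a::real. {..a}))"
    by (auto simp: Int_stable_def)
  moreover have "range (\<lambda>a::real. {..a}) \<subseteq> Pow UNIV" by simp
  ultimately have "(LINT y|lborel. indicator A y * w y) = 0"
    using A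
  proof (induction rule: sigma_sets_induct_disjoint)
    case (basic A)
    then show ?case using zero by auto
  next
    case (compl A)
    then have A: "A \<in> sets borel" by (simp add: borel_eq_atMost)
    have "(LINT y|lborel. indicator (UNIV - A) y * w y) = (LINT y|lborel. w y - indicator A y * w y)"
      by (intro Bochner_Integration.integral_cong) (auto simp: indicator_def)
    also have "\<dots> = 0" using compl tot w int[OF A] by simp
    finally show ?case .
  next
    case (union A)
    then have A: "\<And>i. A i \<in> sets borel" by (simp add: borel_eq_atMost range_subsetD)
    have "(\<integral>y\<in>(\<Union>i. A i). w y \<partial>lborel) = (\<Sum>i. (\<integral>y\<in>A i. w y \<partial>lborel))"
    proof (rule lebesgue_integral_countable_add)
      show "set_integrable lborel (\<Union>i. A i) w"
        unfolding set_integrable_def using A int[of "\<Union>i. A i"] by simp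
      show "\<And>i j. i \<noteq> j \<Longrightarrow> A i \<inter> A j = {}" using union(1) by (auto simp: disjoint_family_on_def)
    qed (use A in auto)
    then show ?case using union(3) by (simp add: set_lebesgue_integral_def)
  qed simp
  then show "set_lebesgue_integral lborel A w = 0" by (simp add: set_lebesgue_integral_def)
qed

text \<open>After extension by zero, a ray sees nothing, an initial segment or the whole interval,
  so vanishing over initial segments gives vanishing over all rays. This is the uniqueness of weak
  derivatives.\<close>

lemma sobolev_deriv_zero:
  fixes w :: "real \<Rightarrow> real"
  assumes l: "0 \<le> l" and w: "sq_integrable (lebesgue_on {0..l}) w"
    and zero: "\<And>x. x \<in> {0..l} \<Longrightarrow> (LINT y|lebesgue_on {0..x}. w y) = 0"
  shows "AE x in lebesgue_on {0..l}. w x = 0"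
proof -
  obtain w' where "w' \<in> borel_measurable borel" and ae: "AE x in lebesgue_on {0..l}. w x = w' x"
    and "sq_integrable lborel (\<lambda>y. indicator {0..l} y * w' y)"
    and int: "integrable lborel (\<lambda>y. indicator {0..l} y * w' y)"
    and rep: "\<forall>x\<in>{0..l}. (LINT y|lebesgue_on {0..x}. w y) = (LINT y|lborel. indicator {0..x} y * w' y)"
    using sq_integrable_borel_representative[OF w] .
  have ae': "AE x in lebesgue. x \<in> {0..l} \<longrightarrow> w x = w' x"
    using ae by (simp add: AE_restrict_space_iff)
  have seg: "(LINT y|lborel. indicator {0..x} y * w' y) = 0" if "x \<in> {0..l}" for x
    using bspec[OF rep that] zero[OF that] by simp
  have "AE x in lborel. indicator {0..l} x * w' x = 0"
  proof (rule AE_zero_of_integrals_zero[OF int])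
    fix x :: real
    consider "x < 0" | "x \<in> {0..l}" | "l < x" using l by fastforce
    then show "(LINT y|lborel. indicator {..x} y * (indicator {0..l} y * w' y)) = 0"
    proof cases
      case 1
      then have "(\<lambda>y. indicator {..x} y * (indicator {0..l} y * w' y)) = (\<lambda>y. 0)"
        by (auto simp: indicator_def)
      then show ?thesis by simp
    next
      case 2
      then have "(\<lambda>y. indicator {..x} y * (indicator {0..l} y * w' y)) = (\<lambda>y. indicator {0..x} y * w' y)"
        by (auto simp: indicator_def)
      then show ?thesis using seg[OF 2] by simp
    next
      case 3
      then have "(\<lambda>y. indicator {..x} y * (indicator {0..l} y * w' y)) = (\<lambda>y. indicator {0..l} y * w' y)"
        by (auto simp: indicator_def)
      then show ?thesis using seg[of l] l by simp
    qed
  qed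
  then have "AE x in lebesgue. indicator {0..l} x * w' x = 0" by (rule AE_completion)
  with ae' have "AE x in lebesgue. x \<in> {0..l} \<longrightarrow> w x = 0"
    by eventually_elim auto
  then show ?thesis by (simp add: AE_restrict_space_iff)
qed

text \<open>Fubini on the triangle \<open>0 \<le> y \<le> x \<le> l\<close>: the value at
  \<open>y\<close> is counted for all \<open>x\<close> from \<open>y\<close> to
  \<open>l\<close>.\<close>

lemma integral_indefinite_integral:
  fixes w :: "real \<Rightarrow> real"
  assumes l: "0 \<le> l" and w: "sq_integrable (lebesgue_on {0..l}) w"
  shows "(LINT x|lebesgue_on {0..l}. LINT y|lebesgue_on {0..x}. w y) = (LINT y|lebesgue_on {0..l}. (l - y) * w y)"
proof -
  obtain w1 where w1: "w1 \<in> borel_measurable borel" and ae: "AE x in lebesgue_on {0..l}. w x = w1 x"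
    and "sq_integrable lborel (\<lambda>y. indicator {0..l} y * w1 y)"
    and w1i: "integrable lborel (\<lambda>y. indicator {0..l} y * w1 y)"
    and seg: "\<forall>x\<in>{0..l}. (LINT y|lebesgue_on {0..x}. w y) = (LINT y|lborel. indicator {0..x} y * w1 y)"
    using sq_integrable_borel_representative[OF w] .
  have meas1: "w1 \<in> borel_measurable (lebesgue_on S)" for S
    using w1 by (auto intro: borel_measurable_lebesgue_on_borel)
  define F where "F x y = indicator {0..l} x * (indicator {0..x} y * w1 y)" for x y :: real
  have Fm: "case_prod F \<in> borel_measurable (lborel \<Otimes>\<^sub>M lborel)"
  proof -
    have "case_prod F = (\<lambda>z. if 0 \<le> fst z \<and> fst z \<le> l \<and> 0 \<le> snd z \<and> snd z \<le> fst z then w1 (snd z) else 0)"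
      by (auto simp: F_def indicator_def fun_eq_iff)
    then show ?thesis using w1 by simp
  qed
  have bnd: "norm (F x y) \<le> indicator {0..l} x * norm (indicator {0..l} y * w1 y)" for x y
    by (auto simp: F_def indicator_def)
  have slice: "integrable lborel (\<lambda>y. F x y)" for x
  proof (rule Bochner_Integration.integrable_bound[OF w1i])
    show "(\<lambda>y. F x y) \<in> borel_measurable lborel" unfolding F_def using w1 by measurable
    show "AE y in lborel. norm (F x y) \<le> norm (indicator {0..l} y * w1 y)"
      by (auto simp: F_def indicator_def)
  qed
  have Fi: "integrable (lborel \<Otimes>\<^sub>M lborel) (case_prod F)"
  proof (rule lborel_pair.Fubini_integrable[OF Fm])
    show "integrable lborel (\<lambda>x. LINT y|lborel. norm (case (x, y) of (x, y) \<Rightarrow> F x y))"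
    proof (rule Bochner_Integration.integrable_bound)
      show "integrable lborel (\<lambda>x. indicator {0..l} x * (LINT y|lborel. norm (indicator {0..l} y * w1 y)))"
        using integrable_indicator_Icc by simp
      show "(\<lambda>x. LINT y|lborel. norm (case (x, y) of (x, y) \<Rightarrow> F x y)) \<in> borel_measurable lborel"
        using Fm by (intro lborel.borel_measurable_lebesgue_integral) (simp add: case_prod_unfold)
      show "AE x in lborel. norm (LINT y|lborel. norm (case (x, y) of (x, y) \<Rightarrow> F x y))
          \<le> norm (indicator {0..l} x * (LINT y|lborel. norm (indicator {0..l} y * w1 y)))"
      proof (rule AE_I2)
        fix x :: real
        have "(LINT y|lborel. norm (F x y)) \<le> (LINT y|lborel. indicator {0..l} x * norm (indicator {0..l} y * w1 y))"
          using slice[of x] w1i bnd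
          by (intro integral_mono integrable_norm integrable_mult_right) auto
        also have "\<dots> = indicator {0..l} x * (LINT y|lborel. norm (indicator {0..l} y * w1 y))"
          by simp
        finally show "norm (LINT y|lborel. norm (case (x, y) of (x, y) \<Rightarrow> F x y))
          \<le> norm (indicator {0..l} x * (LINT y|lborel. norm (indicator {0..l} y * w1 y)))"
          by (simp add: abs_of_nonneg)
      qed
    qed
    show "AE x in lborel. integrable lborel (\<lambda>y. case (x, y) of (x, y) \<Rightarrow> F x y)"
      using slice by simp
  qed
  have "(LINT x|lebesgue_on {0..l}. LINT y|lebesgue_on {0..x}. w y)
      = (LINT x|lebesgue_on {0..l}. LINT y|lborel. F x y)"
    by (rule Bochner_Integration.integral_cong[OF refl]) (auto simp: seg F_def)
  also have "\<dots> = (LINT x|lborel. indicator {0..l} x * (LINT y|lborel. F x y))"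
    using Fm by (intro LINT_lebesgue_on_borel) (auto intro!: lborel.borel_measurable_lebesgue_integral simp: measurable_lborel1)
  also have "\<dots> = (LINT x|lborel. LINT y|lborel. F x y)"
    by (intro Bochner_Integration.integral_cong) (auto simp: F_def indicator_def)
  also have "\<dots> = (LINT y|lborel. LINT x|lborel. F x y)"
    using lborel_pair.Fubini_integral[OF Fi] by simp
  also have "\<dots> = (LINT y|lborel. indicator {0..l} y * ((l - y) * w1 y))"
  proof (intro Bochner_Integration.integral_cong refl)
    fix y :: real
    have "(LINT x|lborel. F x y) = (LINT x|lborel. indicator {y..l} x * (indicator {0..l} y * w1 y))"
      by (intro Bochner_Integration.integral_cong) (auto simp: F_def indicator_def)
    also have "\<dots> = measure lborel {y..l} * (indicator {0..l} y * w1 y)" by simp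
    also have "\<dots> = indicator {0..l} y * ((l - y) * w1 y)"
      by (auto simp: indicator_def)
    finally show "(LINT x|lborel. F x y) = indicator {0..l} y * ((l - y) * w1 y)" .
  qed
  also have "\<dots> = (LINT y|lebesgue_on {0..l}. (l - y) * w1 y)"
    using w1 by (intro LINT_lebesgue_on_borel[symmetric]) auto
  also have "\<dots> = (LINT y|lebesgue_on {0..l}. (l - y) * w y)"
  proof (rule integral_cong_AE)
    show "AE y in lebesgue_on {0..l}. (l - y) * w1 y = (l - y) * w y" using ae by eventually_elim simp
    have "(\<lambda>y. l - y) \<in> borel_measurable (lebesgue_on {0..l})"
      by (auto intro: borel_measurable_lebesgue_on_borel)
    then show "(\<lambda>y. (l - y) * w1 y) \<in> borel_measurable (lebesgue_on {0..l})"
      "(\<lambda>y. (l - y) * w y) \<in> borel_measurable (lebesgue_on {0..l})"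
      using meas1 sq_integrable_measurable[OF w] by auto
  qed
  finally show ?thesis .
qed

lemma sq_integrable_interval_Cauchy_Schwarz:
  fixes u :: "real \<Rightarrow> real"
  assumes u: "sq_integrable lborel u" and st: "s \<le> t"
  shows "integrable lborel (\<lambda>r. indicator {s<..t} r * u r)"
    and "integrable lborel (\<lambda>r. indicator {s<..t} r * (u r)\<^sup>2)"
    and "(LINT r|lborel. indicator {s<..t} r * u r)\<^sup>2 \<le> (t - s) * (LINT r|lborel. indicator {s<..t} r * (u r)\<^sup>2)"
proof -
  have ind: "integrable lborel (indicator {s<..t} :: real \<Rightarrow> real)"
    using st by (intro integrable_real_indicator) auto
  have sq: "sq_integrable lborel (indicator {s<..t} :: real \<Rightarrow> real)"
  proof -
    have "(\<lambda>x. (indicator {s<..t} x :: real)\<^sup>2) = indicator {s<..t}" by (auto simp: indicator_def)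
    then show ?thesis using ind by (simp add: sq_integrable_def)
  qed
  show i1: "integrable lborel (\<lambda>r. indicator {s<..t} r * u r)"
    by (rule sq_integrable_mult_integrable[OF sq u])
  show i2: "integrable lborel (\<lambda>r. indicator {s<..t} r * (u r)\<^sup>2)"
    using integrable_mult_indicator[of "{s<..t}" lborel "\<lambda>r. (u r)\<^sup>2"] u by (simp add: sq_integrable_def)
  let ?I = "LINT r|lborel. indicator {s<..t} r * u r"
  let ?J = "LINT r|lborel. indicator {s<..t} r * (u r)\<^sup>2"
  show "?I\<^sup>2 \<le> (t - s) * ?J"
  proof (cases "s = t")
    case True
    then show ?thesis by simp
  next
    case False
    then have pos: "0 < t - s" using st by simp
    \<comment> \<open>The mean of \<open>u\<close> over the interval: the integral of the squared
      deviation from it is nonnegative, and this is the claim.\<close>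
    define c where "c = ?I / (t - s)"
    have "0 \<le> (LINT r|lborel. indicator {s<..t} r * (u r - c)\<^sup>2)"
      by (intro integral_nonneg_AE) auto
    also have "\<dots> = (LINT r|lborel. indicator {s<..t} r * (u r)\<^sup>2 - 2 * c * (indicator {s<..t} r * u r)
        + c\<^sup>2 * indicator {s<..t} r)"
      by (intro Bochner_Integration.integral_cong) (auto simp: indicator_def power2_diff)
    also have "\<dots> = ?J - 2 * c * ?I + c\<^sup>2 * (t - s)"
      using i1 i2 ind st by simp
    also have "\<dots> = ?J - ?I\<^sup>2 / (t - s)"
    proof -
      have "J - 2 * (I / d) * I + (I / d)\<^sup>2 * d = J - I\<^sup>2 / d" if "0 < d" for I J d :: real
        using that by (simp add: field_simps power2_eq_square)
      then show ?thesis unfolding c_def using pos .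
    qed
    finally show ?thesis using pos by (simp add: field_simps)
  qed
qed

text \<open>For almost every \<open>x\<close>, Cauchy-Schwarz in time bounds the squared increment
  by \<open>t - s\<close> times the time integral of the squared derivative; integration in
  \<open>x\<close> and Fubini turn this into increments of \<open>\<Phi>\<close>, the indefinite
  integral of the squared spatial norm of \<open>F\<close>.\<close>

lemma time_H1_edge:
  fixes F f :: "real \<Rightarrow> real \<Rightarrow> real"
  assumes T: "0 \<le> T" and F: "(\<lambda>(t, x). F t x) \<in> borel_measurable borel"
    and F2: "set_integrable lborel ({0..T} \<times> {0..l}) (\<lambda>(t, x). (F t x)\<^sup>2)"
    and f0: "sq_integrable (lebesgue_on {0..l}) (f 0)"
    and f: "\<And>t. t \<in> {0..T} \<Longrightarrow>
      AE x in lebesgue_on {0..l}. f t x = f 0 x + (LINT s|lebesgue_on {0..t}. F s x)"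
  obtains \<Phi> where "time_modulus T \<Phi>"
    "\<And>t. t \<in> {0..T} \<Longrightarrow> sq_integrable (lebesgue_on {0..l}) (f t)"
    "\<And>s t. 0 \<le> s \<Longrightarrow> s \<le> t \<Longrightarrow> t \<le> T \<Longrightarrow>
      (LINT x|lebesgue_on {0..l}. (f t x - f s x)\<^sup>2) \<le> (t - s) * (\<Phi> t - \<Phi> s)"
proof -
  \<comment> \<open>Cut off to the rectangle, so that integrals over the whole plane can be
    used.\<close>
  define g where "g r x = indicator {0..T} r * (indicator {0..l} x * F r x)" for r x
  have Fm: "(\<lambda>z. F (fst z) (snd z)) \<in> borel_measurable (lborel \<Otimes>\<^sub>M lborel)"
    using F by (simp add: lborel_prod case_prod_unfold)
  have gm: "(\<lambda>z. g (fst z) (snd z)) \<in> borel_measurable (lborel \<Otimes>\<^sub>M lborel)"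
    unfolding g_def using Fm by measurable
  have g2: "integrable (lborel \<Otimes>\<^sub>M lborel) (\<lambda>(r, x). (g r x)\<^sup>2)"
  proof -
    have "(\<lambda>(r, x). (g r x)\<^sup>2)
        = (\<lambda>z. indicator ({0..T} \<times> {0..l}) z *\<^sub>R (case z of (t, x) \<Rightarrow> (F t x)\<^sup>2))"
      by (auto simp: g_def indicator_def fun_eq_iff)
    then show ?thesis using F2 by (simp add: lborel_prod set_integrable_def)
  qed
  have slice: "(\<lambda>r. g r x) \<in> borel_measurable lborel" "(\<lambda>r. F r x) \<in> borel_measurable lborel" for x
    using measurable_compose[OF measurable_Pair2'[of x lborel lborel] gm]
      measurable_compose[OF measurable_Pair2'[of x lborel lborel] Fm] by simp_all
  define H where "H r = (LINT x|lborel. (g r x)\<^sup>2)" for r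
  have Hi: "integrable lborel H" unfolding H_def using lborel_pair.integrable_fst[OF g2] .
  have H0: "0 \<le> H r" for r unfolding H_def by (intro integral_nonneg_AE) auto
  obtain \<Phi> where \<Phi>: "time_modulus T \<Phi>"
    and \<Phi>_diff: "\<And>s t. 0 \<le> s \<Longrightarrow> s \<le> t \<Longrightarrow> (LINT r|lborel. indicator {s<..t} r * H r) = \<Phi> t - \<Phi> s"
    using modulus_of_integrable[OF Hi H0] by blast
  \<comment> \<open>Only almost every \<open>x\<close> has a square integrable time slice;
    Cauchy-Schwarz and the splitting of the time integral are applied at these
    \<open>x\<close>.\<close>
  have ae: "AE x in lborel. sq_integrable lborel (\<lambda>r. g r x)"
    using lborel_pair.AE_integrable_snd[OF g2] by eventually_elim (use slice(1) in \<open>auto simp: sq_integrable_def\<close>)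
  define D where "D s t x = (LINT r|lborel. indicator {s<..t} r * g r x)" for s t x
  have Dm: "D s t \<in> borel_measurable borel" for s t
  proof -
    have "(\<lambda>z. indicator {s<..t} (snd z) * g (snd z) (fst z)) \<in> borel_measurable (lborel \<Otimes>\<^sub>M lborel)"
      using measurable_compose[OF measurable_pair_swap' gm] by (auto simp: case_prod_unfold)
    then have "D s t \<in> borel_measurable lborel"
      unfolding D_def[abs_def] by (intro lborel.borel_measurable_lebesgue_integral) (simp add: case_prod_unfold)
    then show ?thesis by simp
  qed
  have D2: "integrable lborel (\<lambda>x. (D s t x)\<^sup>2)"
    "(LINT x|lborel. (D s t x)\<^sup>2) \<le> (t - s) * (\<Phi> t - \<Phi> s)" if st: "0 \<le> s" "s \<le> t" for s t
  proof -
    have ki: "integrable (lborel \<Otimes>\<^sub>M lborel) (\<lambda>(r, x). indicator {s<..t} r * (g r x)\<^sup>2)"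
    proof (rule Bochner_Integration.integrable_bound[OF g2])
      show "(\<lambda>(r, x). indicator {s<..t} r * (g r x)\<^sup>2) \<in> borel_measurable (lborel \<Otimes>\<^sub>M lborel)"
        unfolding case_prod_unfold using gm by measurable
    qed (auto simp: indicator_def)
    have int: "integrable lborel (\<lambda>x. (t - s) * (LINT r|lborel. indicator {s<..t} r * (g r x)\<^sup>2))"
      using lborel_pair.integrable_snd[OF ki] by simp
    have le: "AE x in lborel. (D s t x)\<^sup>2 \<le> (t - s) * (LINT r|lborel. indicator {s<..t} r * (g r x)\<^sup>2)"
      using ae by eventually_elim (simp add: D_def sq_integrable_interval_Cauchy_Schwarz(3) st)
    show i: "integrable lborel (\<lambda>x. (D s t x)\<^sup>2)"
    proof (rule Bochner_Integration.integrable_bound[OF int])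
      show "AE x in lborel. norm ((D s t x)\<^sup>2) \<le> norm ((t - s) * (LINT r|lborel. indicator {s<..t} r * (g r x)\<^sup>2))"
        using le by eventually_elim simp
    qed (use Dm in measurable)
    have "(LINT x|lborel. (D s t x)\<^sup>2) \<le> (LINT x|lborel. (t - s) * (LINT r|lborel. indicator {s<..t} r * (g r x)\<^sup>2))"
      by (rule integral_mono_AE[OF i int le])
    also have "\<dots> = (t - s) * (LINT x|lborel. LINT r|lborel. indicator {s<..t} r * (g r x)\<^sup>2)" by simp
    also have "(LINT x|lborel. LINT r|lborel. indicator {s<..t} r * (g r x)\<^sup>2)
        = (LINT r|lborel. LINT x|lborel. indicator {s<..t} r * (g r x)\<^sup>2)"
      by (rule lborel_pair.Fubini_integral[OF ki])
    also have "\<dots> = (LINT r|lborel. indicator {s<..t} r * H r)" by (simp add: H_def)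
    also have "\<dots> = \<Phi> t - \<Phi> s" by (rule \<Phi>_diff[OF st])
    finally show "(LINT x|lborel. (D s t x)\<^sup>2) \<le> (t - s) * (\<Phi> t - \<Phi> s)" .
  qed
  have ae': "AE x in lebesgue_on {0..l}. sq_integrable lborel (\<lambda>r. g r x)"
    using AE_completion[OF ae] by (simp add: AE_restrict_space_iff) (elim AE_mp, auto)
  have rep: "(LINT s|lebesgue_on {0..t}. F s x) = D 0 t x" if "t \<in> {0..T}" "x \<in> {0..l}" for t x
  proof -
    have "(LINT s|lebesgue_on {0..t}. F s x) = (LINT r|lborel. indicator {0..t} r * F r x)"
      using slice(2)[of x] by (intro LINT_lebesgue_on_borel) auto
    also have "\<dots> = D 0 t x"
      unfolding D_def
    proof (rule integral_cong_AE)
      show "AE r in lborel. indicator {0..t} r * F r x = indicator {0<..t} r * g r x"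
        using AE_lborel_singleton[of 0] by eventually_elim (use that in \<open>auto simp: indicator_def g_def\<close>)
    qed (use slice in measurable)
    finally show ?thesis .
  qed
  have ft: "AE x in lebesgue_on {0..l}. f t x = f 0 x + D 0 t x" if "t \<in> {0..T}" for t
    using f[OF that] AE_space by eventually_elim (use rep[OF that] in auto)
  have Dsq: "sq_integrable (lebesgue_on {0..l}) (D s t)" if "0 \<le> s" "s \<le> t" for s t
  proof -
    have "integrable lebesgue (\<lambda>x. (D s t x)\<^sup>2)"
      using D2(1)[OF that] Dm by (subst integrable_completion) auto
    then have "integrable lebesgue (\<lambda>x. indicator {0..l} x *\<^sub>R (D s t x)\<^sup>2)"
      by (intro integrable_mult_indicator) auto
    also have "(\<lambda>x. indicator {0..l} x *\<^sub>R (D s t x)\<^sup>2) = (\<lambda>x. if x \<in> {0..l} then (D s t x)\<^sup>2 else 0)"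
      by (auto simp: indicator_def)
    finally have "integrable (lebesgue_on {0..l}) (\<lambda>x. (D s t x)\<^sup>2)"
      by (subst (asm) Lebesgue_Measure.integrable_restrict_UNIV) auto
    then show ?thesis unfolding sq_integrable_def using borel_measurable_lebesgue_on_borel[OF Dm] by auto
  qed
  have fsq: "sq_integrable (lebesgue_on {0..l}) (f t)" if "t \<in> {0..T}" for t
  proof (rule sq_integrable_cong_AE)
    show 1: "sq_integrable (lebesgue_on {0..l}) (\<lambda>x. f 0 x + D 0 t x)"
      using that by (intro sq_integrable_add f0 Dsq) auto
    show 2: "AE x in lebesgue_on {0..l}. f 0 x + D 0 t x = f t x"
      using ft[OF that] by eventually_elim simp
    show "f t \<in> borel_measurable (lebesgue_on {0..l})"
      by (rule borel_measurable_lebesgue_on_AE[OF _ sq_integrable_measurable[OF 1] 2]) simp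
  qed
  have "(LINT x|lebesgue_on {0..l}. (f t x - f s x)\<^sup>2) \<le> (t - s) * (\<Phi> t - \<Phi> s)"
    if st: "0 \<le> s" "s \<le> t" "t \<le> T" for s t
  proof -
    have mem: "s \<in> {0..T}" "t \<in> {0..T}" using st by auto
    have "AE x in lebesgue_on {0..l}. f t x - f s x = D s t x"
      using ft[OF mem(1)] ft[OF mem(2)] ae'
    proof eventually_elim
      case (elim x)
      have "D 0 t x = (LINT r|lborel. indicator {0<..s} r * g r x + indicator {s<..t} r * g r x)"
        unfolding D_def using st by (intro Bochner_Integration.integral_cong) (auto simp: indicator_def)
      also have "\<dots> = D 0 s x + D s t x"
        unfolding D_def using st
        by (intro Bochner_Integration.integral_add sq_integrable_interval_Cauchy_Schwarz(1)[OF elim(3)]) auto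
      finally show ?case using elim by simp
    qed
    then have "AE x in lebesgue_on {0..l}. (f t x - f s x)\<^sup>2 = (D s t x)\<^sup>2"
      by eventually_elim simp
    then have "(LINT x|lebesgue_on {0..l}. (f t x - f s x)\<^sup>2) = (LINT x|lebesgue_on {0..l}. (D s t x)\<^sup>2)"
      using sq_integrable_measurable[OF fsq[OF mem(1)]] sq_integrable_measurable[OF fsq[OF mem(2)]]
        borel_measurable_lebesgue_on_borel[OF Dm]
      by (intro integral_cong_AE) auto
    also have "\<dots> = (LINT x|lborel. indicator {0..l} x * (D s t x)\<^sup>2)"
      using Dm by (intro LINT_lebesgue_on_borel) auto
    also have "\<dots> \<le> (LINT x|lborel. (D s t x)\<^sup>2)"
      using D2(1)[OF st(1,2)] by (intro integral_mono') (auto simp: indicator_def)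
    also have "\<dots> \<le> (t - s) * (\<Phi> t - \<Phi> s)" using D2(2)[OF st(1,2)] .
    finally show ?thesis .
  qed
  with \<Phi> fsq show ?thesis using that by blast
qed

lemma L2_on_iff: "L2_on l u \<longleftrightarrow> sq_integrable (lebesgue_on {0..l}) u"
  by (simp add: L2_on_def sq_integrable_def)

lemma L2_net_iff: "u \<in> L2_net G len \<longleftrightarrow> (\<forall>e\<in>arcs G. sq_integrable (lebesgue_on {0..len e}) (u e))"
  by (simp add: L2_net_def L2_on_iff)

lemma L2_net_add: "u \<in> L2_net G len \<Longrightarrow> w \<in> L2_net G len \<Longrightarrow> (\<lambda>e x. u e x + w e x) \<in> L2_net G len"
  by (simp add: L2_net_iff sq_integrable_add)

lemma L2_net_cmult: "u \<in> L2_net G len \<Longrightarrow> (\<lambda>e x. c * u e x) \<in> L2_net G len"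
  by (simp add: L2_net_iff sq_integrable_cmult)

lemma L2_net_diff: "u \<in> L2_net G len \<Longrightarrow> w \<in> L2_net G len \<Longrightarrow> (\<lambda>e x. u e x - w e x) \<in> L2_net G len"
  using L2_net_add[of u G len "\<lambda>e x. - 1 * w e x"] L2_net_cmult[of w G len "- 1"] by simp

lemma L2_net_coeff_mult:
  assumes c: "coeff_bounds G len c lo up" and u: "u \<in> L2_net G len"
  shows "(\<lambda>e x. c e x * u e x) \<in> L2_net G len"
  unfolding L2_net_iff
proof
  fix e assume e: "e \<in> arcs G"
  have ae: "AE x in lebesgue_on {0..len e}. lo \<le> c e x \<and> c e x \<le> up"
    and m: "c e \<in> borel_measurable (lebesgue_on {0..len e})"
    using c e by (auto simp: coeff_bounds_def)
  have "AE x in lebesgue_on {0..len e}. \<bar>c e x\<bar> \<le> max \<bar>lo\<bar> \<bar>up\<bar>"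
    using ae by eventually_elim auto
  then show "sq_integrable (lebesgue_on {0..len e}) (\<lambda>x. c e x * u e x)"
    using u e m by (intro sq_integrable_bounded_mult) (auto simp: L2_net_iff)
qed

section \<open>Weak derivatives\<close>

lemma has_sobolev_deriv_lincomb:
  assumes "has_sobolev_deriv l q w" "has_sobolev_deriv l q' w'"
  shows "has_sobolev_deriv l (\<lambda>x. \<alpha> * q x + \<beta> * q' x) (\<lambda>x. \<alpha> * w x + \<beta> * w' x)"
proof -
  have w: "sq_integrable (lebesgue_on {0..l}) w" "sq_integrable (lebesgue_on {0..l}) w'"
    using assms by (auto simp: has_sobolev_deriv_def L2_on_iff)
  have "\<alpha> * q x + \<beta> * q' x = \<alpha> * q 0 + \<beta> * q' 0 + (LINT y|lebesgue_on {0..x}. \<alpha> * w y + \<beta> * w' y)"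
    if x: "x \<in> {0..l}" for x
  proof -
    have "integrable (lebesgue_on {0..x}) w" "integrable (lebesgue_on {0..x}) w'"
      using x integrable_subinterval[OF sq_integrable_integrable_finite[OF w(1)], of 0 x]
        integrable_subinterval[OF sq_integrable_integrable_finite[OF w(2)], of 0 x] by simp_all
    moreover have "q x = q 0 + (LINT y|lebesgue_on {0..x}. w y)" "q' x = q' 0 + (LINT y|lebesgue_on {0..x}. w' y)"
      using assms x unfolding has_sobolev_deriv_def by blast+
    then have "\<alpha> * q x + \<beta> * q' x = \<alpha> * q 0 + \<beta> * q' 0
        + (\<alpha> * (LINT y|lebesgue_on {0..x}. w y) + \<beta> * (LINT y|lebesgue_on {0..x}. w' y))"
      by (metis (no_types, opaque_lifting) add.assoc add.left_commute distrib_left)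
    ultimately show ?thesis by simp
  qed
  then show ?thesis
    unfolding has_sobolev_deriv_def L2_on_iff
    by (intro conjI ballI sq_integrable_add sq_integrable_cmult w)
qed

lemma has_sobolev_deriv_unique:
  assumes l: "0 \<le> l" and "has_sobolev_deriv l q w" "has_sobolev_deriv l q w'"
  shows "AE x in lebesgue_on {0..l}. w x = w' x"
proof -
  have *: "has_sobolev_deriv l (\<lambda>x. 1 * q x + (- 1) * q x) (\<lambda>x. 1 * w x + (- 1) * w' x)"
    by (rule has_sobolev_deriv_lincomb[OF assms(2,3)])
  then have "AE x in lebesgue_on {0..l}. 1 * w x + (- 1) * w' x = 0"
    by (intro sobolev_deriv_zero[OF l]) (auto simp: has_sobolev_deriv_def L2_on_iff)
  then show ?thesis by eventually_elim simp
qed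

lemma has_sobolev_deriv_continuous_on:
  assumes "has_sobolev_deriv l q w"
  shows "continuous_on {0..l} q"
proof -
  have "integrable (lebesgue_on {0..l}) w"
    using assms by (intro sq_integrable_integrable_finite) (simp add: has_sobolev_deriv_def L2_on_iff)
  then have "continuous_on {0..l} (\<lambda>x. q 0 + (LINT y|lebesgue_on {0..x}. w y))"
    by (intro continuous_intros indefinite_integral_continuous_real)
  moreover have "q 0 + (LINT y|lebesgue_on {0..x}. w y) = q x" if "x \<in> {0..l}" for x
    using assms that unfolding has_sobolev_deriv_def by metis
  ultimately show ?thesis by (rule continuous_on_eq)
qed

lemma sq_integrable_continuous:
  fixes q :: "real \<Rightarrow> real"
  assumes "continuous_on {a..b} q"
  shows "sq_integrable (lebesgue_on {a..b}) q"
  unfolding sq_integrable_def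
  using assms by (auto intro!: continuous_imp_measurable_on_sets_lebesgue continuous_imp_integrable_real continuous_intros)

text \<open>Integration by parts against \<open>x / l - 1\<close>, which vanishes at
  \<open>l\<close>, and \<open>x / l\<close>, which vanishes at 0; both have derivative
  \<open>1 / l\<close>. As \<open>q\<close> is an indefinite integral, this reduces to computing its
  mean by Fubini.\<close>

lemma has_sobolev_deriv_average:
  assumes l: "0 < l" and q: "has_sobolev_deriv l q w"
  shows "q 0 = (LINT x|lebesgue_on {0..l}. (x / l - 1) * w x) + (LINT x|lebesgue_on {0..l}. (1 / l) * q x)"
    and "q l = (LINT x|lebesgue_on {0..l}. (x / l) * w x) + (LINT x|lebesgue_on {0..l}. (1 / l) * q x)"
proof -
  have w: "sq_integrable (lebesgue_on {0..l}) w" using q by (simp add: has_sobolev_deriv_def L2_on_iff)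
  have wi: "integrable (lebesgue_on {0..l}) w" by (rule sq_integrable_integrable_finite[OF w])
  have ci: "integrable (lebesgue_on {0..l}) (\<lambda>x. x * w x)"
    by (rule sq_integrable_mult_integrable[OF sq_integrable_continuous w]) (intro continuous_intros)
  have Ai: "integrable (lebesgue_on {0..l}) (\<lambda>x. LINT y|lebesgue_on {0..x}. w y)"
    by (intro continuous_imp_integrable_real indefinite_integral_continuous_real wi)
  have one: "(LINT x|lebesgue_on {0..l}. c) = l * c" for c :: real
  proof -
    have "(LINT x|lebesgue_on {0..l}. c) = integral {0..l} (\<lambda>x. c)"
      by (intro lebesgue_integral_eq_integral continuous_imp_integrable_real) auto
    then show ?thesis using l by simp
  qed
  have "(LINT x|lebesgue_on {0..l}. q x) = (LINT x|lebesgue_on {0..l}. q 0 + (LINT y|lebesgue_on {0..x}. w y))"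
  proof (rule Bochner_Integration.integral_cong[OF refl])
    fix x assume "x \<in> space (lebesgue_on {0..l})"
    then have "x \<in> {0..l}" by simp
    then show "q x = q 0 + (LINT y|lebesgue_on {0..x}. w y)"
      using q unfolding has_sobolev_deriv_def by blast
  qed
  also have "\<dots> = l * q 0 + (LINT x|lebesgue_on {0..l}. LINT y|lebesgue_on {0..x}. w y)"
    unfolding one[of "q 0", symmetric]
    by (rule Bochner_Integration.integral_add[OF continuous_imp_integrable_real Ai]) simp
  also have "(LINT x|lebesgue_on {0..l}. LINT y|lebesgue_on {0..x}. w y) = (LINT y|lebesgue_on {0..l}. (l - y) * w y)"
    using l by (intro integral_indefinite_integral w) simp
  also have "\<dots> = l * (LINT y|lebesgue_on {0..l}. w y) - (LINT y|lebesgue_on {0..l}. y * w y)"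
    using wi ci by (simp add: left_diff_distrib)
  finally have avg: "(LINT x|lebesgue_on {0..l}. q x)
      = l * q 0 + (l * (LINT y|lebesgue_on {0..l}. w y) - (LINT y|lebesgue_on {0..l}. y * w y))" .
  have ql: "q l = q 0 + (LINT y|lebesgue_on {0..l}. w y)"
  proof -
    have "l \<in> {0..l}" using l by simp
    then show ?thesis using q unfolding has_sobolev_deriv_def by blast
  qed
  have e1: "(LINT x|lebesgue_on {0..l}. (x / l - 1) * w x)
      = (LINT y|lebesgue_on {0..l}. y * w y) / l - (LINT y|lebesgue_on {0..l}. w y)"
    using wi ci by (simp add: left_diff_distrib)
  have e2: "(LINT x|lebesgue_on {0..l}. (x / l) * w x) = (LINT y|lebesgue_on {0..l}. y * w y) / l"
    by simp
  have e3: "(LINT x|lebesgue_on {0..l}. (1 / l) * q x) = (LINT x|lebesgue_on {0..l}. q x) / l" by simp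
  show "q 0 = (LINT x|lebesgue_on {0..l}. (x / l - 1) * w x) + (LINT x|lebesgue_on {0..l}. (1 / l) * q x)"
    unfolding e1 e3 avg using l by (simp add: field_simps)
  show "q l = (LINT x|lebesgue_on {0..l}. (x / l) * w x) + (LINT x|lebesgue_on {0..l}. (1 / l) * q x)"
    unfolding e2 e3 avg ql using l by (simp add: field_simps)
qed

context network
begin

section \<open>The embedding of the network spaces\<close>

definition ext :: "'e edge_fun \<Rightarrow> 'e edge_fun" where
  "ext u e x = (if e \<in> arcs G then (if x \<in> {0..len e} then u e x else 0) else 0)"

definition emb :: "'e edge_fun \<Rightarrow> 'e l2" where
  "emb u = abs_l2 (ext u)"

lemma ext_support: "l2_support (ext u) \<subseteq> arcs G"
  by (auto simp: l2_support_def ext_def)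

lemma ext_raw:
  assumes "u \<in> L2_net G len"
  shows "l2_raw (ext u)"
  unfolding l2_raw_def
proof (intro conjI allI)
  show "finite (l2_support (ext u))" using ext_support finite_arcs by (rule finite_subset)
  fix e show "sq_integrable lebesgue (ext u e)"
    using assms sq_integrable_lebesgue_on[of "{0..len e}" "u e"]
    by (cases "e \<in> arcs G") (auto simp: L2_net_iff ext_def[abs_def] sq_integrable_zero)
qed

lemma emb_add: "u \<in> L2_net G len \<Longrightarrow> w \<in> L2_net G len \<Longrightarrow> emb (\<lambda>e x. u e x + w e x) = emb u + emb w"
proof -
  assume "u \<in> L2_net G len" "w \<in> L2_net G len"
  moreover have "(\<lambda>e x. ext u e x + ext w e x) = ext (\<lambda>e x. u e x + w e x)"
    by (auto simp: ext_def fun_eq_iff)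
  ultimately show ?thesis by (simp add: emb_def abs_l2_add ext_raw)
qed

lemma emb_cmult: "u \<in> L2_net G len \<Longrightarrow> emb (\<lambda>e x. c * u e x) = c *\<^sub>R emb u"
proof -
  assume "u \<in> L2_net G len"
  moreover have "(\<lambda>e x. c * ext u e x) = ext (\<lambda>e x. c * u e x)"
    by (auto simp: ext_def fun_eq_iff)
  ultimately show ?thesis by (simp add: emb_def abs_l2_scaleR ext_raw)
qed

lemma emb_diff: "u \<in> L2_net G len \<Longrightarrow> w \<in> L2_net G len \<Longrightarrow> emb (\<lambda>e x. u e x - w e x) = emb u - emb w"
proof -
  assume "u \<in> L2_net G len" "w \<in> L2_net G len"
  moreover have "(\<lambda>e x. ext u e x - ext w e x) = ext (\<lambda>e x. u e x - w e x)"
    by (auto simp: ext_def fun_eq_iff)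
  ultimately show ?thesis by (simp add: emb_def abs_l2_diff ext_raw)
qed

lemma inner_emb:
  assumes "u \<in> L2_net G len" "w \<in> L2_net G len"
  shows "emb u \<bullet> emb w = inner_L2 G len u w"
proof -
  have "emb u \<bullet> emb w = (\<Sum>e\<in>arcs G. LINT x|lebesgue. ext u e x * ext w e x)"
    unfolding emb_def by (simp add: inner_abs_l2 ext_raw assms l2_inner_raw_eq[OF finite_arcs ext_support])
  also have "\<dots> = inner_L2 G len u w"
    unfolding inner_L2_def
  proof (rule sum.cong[OF refl])
    fix e assume "e \<in> arcs G"
    then have "(\<lambda>x. ext u e x * ext w e x) = (\<lambda>x. if x \<in> {0..len e} then u e x * w e x else 0)"
      by (auto simp: ext_def)
    then show "(LINT x|lebesgue. ext u e x * ext w e x) = (LINT x|lebesgue_on {0..len e}. u e x * w e x)"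
      by (simp only:) (rule Lebesgue_Measure.integral_restrict_UNIV, simp)
  qed
  finally show ?thesis .
qed

lemma norm_emb: "u \<in> L2_net G len \<Longrightarrow> norm (emb u) = norm_L2 G len u"
  by (simp add: norm_eq_sqrt_inner inner_emb norm_L2_def)

lemma emb_eq_iff:
  assumes "u \<in> L2_net G len" "w \<in> L2_net G len"
  shows "emb u = emb w \<longleftrightarrow> ae_eq G len u w"
proof -
  have "(AE x in lebesgue. ext u e x = ext w e x) \<longleftrightarrow> (AE x in lebesgue_on {0..len e}. u e x = w e x)"
    if "e \<in> arcs G" for e
  proof -
    have "(AE x in lebesgue. ext u e x = ext w e x) \<longleftrightarrow> (AE x in lebesgue. x \<in> {0..len e} \<longrightarrow> u e x = w e x)"
      using that by (intro AE_cong) (auto simp: ext_def)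
    then show ?thesis by (simp add: AE_restrict_space_iff)
  qed
  moreover have "AE x in lebesgue. ext u e x = ext w e x" if "e \<notin> arcs G" for e
    using that by (simp add: ext_def)
  ultimately show ?thesis
    unfolding emb_def ae_eq_def using assms by (subst abs_l2_eq) (auto intro: ext_raw)
qed

text \<open>Extension by the lower bound rather than by 0, so that the operator stays coercive on
  the whole type \<open>l2\<close>, also off the network.\<close>

definition coeff_ext :: "real \<Rightarrow> 'e edge_fun \<Rightarrow> 'e edge_fun" where
  "coeff_ext lo c e x = (if e \<in> arcs G then (if x \<in> {0..len e} then c e x else lo) else lo)"

lemma coeff_ext_bounded:
  assumes c: "coeff_bounds G len c lo up"
  shows "l2_bounded (coeff_ext lo c) lo (max lo up)"
  unfolding l2_bounded_def
proof (intro allI conjI)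
  fix e
  show "coeff_ext lo c e \<in> borel_measurable lebesgue"
  proof (cases "e \<in> arcs G")
    case True
    have "(\<lambda>x. if x \<in> {0..len e} then c e x - lo else 0) \<in> borel_measurable lebesgue"
      using c True by (intro borel_measurable_if_I) (auto simp: coeff_bounds_def)
    then have "(\<lambda>x. (if x \<in> {0..len e} then c e x - lo else 0) + lo) \<in> borel_measurable lebesgue"
      by simp
    also have "(\<lambda>x. (if x \<in> {0..len e} then c e x - lo else 0) + lo) = coeff_ext lo c e"
      using True by (auto simp: coeff_ext_def fun_eq_iff)
    finally show ?thesis .
  next
    case False
    then have "coeff_ext lo c e = (\<lambda>x. lo)" by (auto simp: coeff_ext_def)
    then show ?thesis by simp
  qed
  show "AE x in lebesgue. lo \<le> coeff_ext lo c e x \<and> coeff_ext lo c e x \<le> max lo up"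
  proof (cases "e \<in> arcs G")
    case True
    then have "AE x in lebesgue_on {0..len e}. lo \<le> c e x \<and> c e x \<le> up"
      using c by (simp add: coeff_bounds_def)
    then have "AE x in lebesgue. x \<in> {0..len e} \<longrightarrow> lo \<le> c e x \<and> c e x \<le> up"
      by (rule iffD1[OF AE_restrict_space_iff, rotated]) simp
    then show ?thesis by eventually_elim (auto simp: coeff_ext_def)
  qed (simp add: coeff_ext_def)
qed

definition coeff_op :: "real \<Rightarrow> 'e edge_fun \<Rightarrow> 'e l2 \<Rightarrow> 'e l2" where
  "coeff_op lo c = l2_mult (coeff_ext lo c)"

lemma coeff_op_emb:
  assumes c: "coeff_bounds G len c lo up" and u: "u \<in> L2_net G len"
  shows "coeff_op lo c (emb u) = emb (\<lambda>e x. c e x * u e x)"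
proof -
  have "(\<lambda>e x. coeff_ext lo c e x * ext u e x) = ext (\<lambda>e x. c e x * u e x)"
    by (auto simp: coeff_ext_def ext_def fun_eq_iff)
  then show ?thesis
    unfolding coeff_op_def emb_def by (simp add: l2_mult_abs[OF coeff_ext_bounded[OF c] ext_raw[OF u]])
qed

section \<open>The space of continuous piecewise Sobolev functions\<close>

lemma H1_dx:
  assumes "q \<in> H1_net G len" "e \<in> arcs G"
  shows "has_sobolev_deriv (len e) (q e) (dx len q e)"
proof -
  have "\<exists>w. has_sobolev_deriv (len e) (q e) w" using assms by (auto simp: H1_net_def H1_on_def)
  then show ?thesis unfolding dx_def by (rule someI_ex)
qed

lemma H1_subset_L2: "q \<in> H1_net G len \<Longrightarrow> q \<in> L2_net G len"
  using H1_dx has_sobolev_deriv_continuous_on sq_integrable_continuous unfolding L2_net_iff by blast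

lemma dx_L2: "q \<in> H1_net G len \<Longrightarrow> dx len q \<in> L2_net G len"
  using H1_dx unfolding L2_net_def has_sobolev_deriv_def by blast

lemma H1_lincomb:
  assumes "q \<in> H1_net G len" "q' \<in> H1_net G len"
  shows "(\<lambda>e x. \<alpha> * q e x + \<beta> * q' e x) \<in> H1_net G len"
proof -
  obtain \<phi> where \<phi>: "\<forall>e\<in>arcs G. q e 0 = \<phi> (tail G e) \<and> q e (len e) = \<phi> (head G e)"
    using assms(1) by (auto simp: H1_net_def)
  obtain \<phi>' where \<phi>': "\<forall>e\<in>arcs G. q' e 0 = \<phi>' (tail G e) \<and> q' e (len e) = \<phi>' (head G e)"
    using assms(2) by (auto simp: H1_net_def)
  have "H1_on (len e) (\<lambda>x. \<alpha> * q e x + \<beta> * q' e x)" if "e \<in> arcs G" for e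
    unfolding H1_on_def using has_sobolev_deriv_lincomb[OF H1_dx[OF assms(1) that] H1_dx[OF assms(2) that]] by blast
  then show ?thesis
    unfolding H1_net_def using \<phi> \<phi>' by (auto intro!: exI[of _ "\<lambda>v. \<alpha> * \<phi> v + \<beta> * \<phi>' v"])
qed

lemma emb_lincomb:
  "q \<in> L2_net G len \<Longrightarrow> q' \<in> L2_net G len \<Longrightarrow> emb (\<lambda>e x. \<alpha> * q e x + \<beta> * q' e x) = \<alpha> *\<^sub>R emb q + \<beta> *\<^sub>R emb q'"
  by (subst emb_add) (auto simp: emb_cmult L2_net_cmult)

text \<open>\<open>dx\<close> chooses a representative for each function separately, so it is linear
  only up to null sets; uniqueness of the weak derivative makes it linear on classes.\<close>

lemma emb_dx_lincomb:
  assumes "q \<in> H1_net G len" "q' \<in> H1_net G len"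
  shows "emb (dx len (\<lambda>e x. \<alpha> * q e x + \<beta> * q' e x)) = \<alpha> *\<^sub>R emb (dx len q) + \<beta> *\<^sub>R emb (dx len q')"
proof -
  have "emb (dx len (\<lambda>e x. \<alpha> * q e x + \<beta> * q' e x)) = emb (\<lambda>e x. \<alpha> * dx len q e x + \<beta> * dx len q' e x)"
  proof (subst emb_eq_iff)
    show "dx len (\<lambda>e x. \<alpha> * q e x + \<beta> * q' e x) \<in> L2_net G len" by (intro dx_L2 H1_lincomb assms)
    show "(\<lambda>e x. \<alpha> * dx len q e x + \<beta> * dx len q' e x) \<in> L2_net G len"
      by (intro L2_net_add L2_net_cmult dx_L2 assms)
    show "ae_eq G len (dx len (\<lambda>e x. \<alpha> * q e x + \<beta> * q' e x)) (\<lambda>e x. \<alpha> * dx len q e x + \<beta> * dx len q' e x)"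
      unfolding ae_eq_def
    proof
      fix e assume e: "e \<in> arcs G"
      show "AE x in lebesgue_on {0..len e}. dx len (\<lambda>e x. \<alpha> * q e x + \<beta> * q' e x) e x
          = \<alpha> * dx len q e x + \<beta> * dx len q' e x"
        using has_sobolev_deriv_unique[OF less_imp_le[OF len_pos[OF e]] H1_dx[OF H1_lincomb[OF assms] e]
            has_sobolev_deriv_lincomb[OF H1_dx[OF assms(1) e] H1_dx[OF assms(2) e]]] .
    qed
  qed
  then show ?thesis using assms by (simp add: emb_lincomb dx_L2)
qed

lemma H1_diff: "q \<in> H1_net G len \<Longrightarrow> q' \<in> H1_net G len \<Longrightarrow> (\<lambda>e x. q e x - q' e x) \<in> H1_net G len"
  using H1_lincomb[of q q' 1 "- 1"] by simp

lemma emb_dx_diff: "q \<in> H1_net G len \<Longrightarrow> q' \<in> H1_net G len \<Longrightarrow>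
    emb (dx len (\<lambda>e x. q e x - q' e x)) = emb (dx len q) - emb (dx len q')"
  using emb_dx_lincomb[of q q' 1 "- 1"] by simp

lemma norm_H1_emb:
  "q \<in> H1_net G len \<Longrightarrow> norm_H1 G len q = sqrt ((norm (emb q))\<^sup>2 + (norm (emb (dx len q)))\<^sup>2)"
  by (simp add: norm_H1_def norm_emb H1_subset_L2 dx_L2)

text \<open>A continuous square with vanishing integral over a nondegenerate interval is zero. This
  carries vertex values over from initial data that are prescribed only almost everywhere.\<close>

lemma H1_ae_eq_imp_eq:
  assumes q: "q \<in> H1_net G len" "q' \<in> H1_net G len" and ae: "ae_eq G len q q'"
    and e: "e \<in> arcs G" and x: "x \<in> {0..len e}"
  shows "q e x = q' e x"
proof -
  have c: "continuous_on {0..len e} (\<lambda>x. q e x - q' e x)"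
    by (intro continuous_intros has_sobolev_deriv_continuous_on[OF H1_dx[OF q(1) e]]
        has_sobolev_deriv_continuous_on[OF H1_dx[OF q(2) e]])
  have "AE x in lebesgue_on {0..len e}. q e x - q' e x = 0"
    using ae e by (auto simp: ae_eq_def)
  then have "AE x in lebesgue_on {0..len e}. (q e x - q' e x)\<^sup>2 = 0" by eventually_elim simp
  then have "(LINT x|lebesgue_on {0..len e}. (q e x - q' e x)\<^sup>2) = 0" by (rule integral_eq_zero_AE)
  then have "integral {0..len e} (\<lambda>x. (q e x - q' e x)\<^sup>2) = 0"
    using c by (subst lebesgue_integral_eq_integral[symmetric])
      (auto intro!: continuous_imp_integrable_real continuous_intros)
  then have "\<forall>x\<in>{0..len e}. (q e x - q' e x)\<^sup>2 = 0"
    using len_pos[OF e] c by (subst (asm) integral_eq_0_iff) (auto intro!: continuous_intros)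
  then show ?thesis using x by simp
qed

lemma emb_dx_cong:
  assumes q: "q \<in> H1_net G len" "q' \<in> H1_net G len" and ae: "ae_eq G len q q'"
  shows "emb (dx len q) = emb (dx len q')"
proof (subst emb_eq_iff)
  show "ae_eq G len (dx len q) (dx len q')"
    unfolding ae_eq_def
  proof
    fix e assume e: "e \<in> arcs G"
    have l: "0 < len e" by (rule len_pos[OF e])
    note eq = H1_ae_eq_imp_eq[OF q ae e]
    have "q e x = q e 0 + (LINT y|lebesgue_on {0..x}. dx len q' e y)" if "x \<in> {0..len e}" for x
    proof -
      have "q' e x = q' e 0 + (LINT y|lebesgue_on {0..x}. dx len q' e y)"
        using H1_dx[OF q(2) e] that unfolding has_sobolev_deriv_def by blast
      moreover have "q e 0 = q' e 0" using l by (intro eq) simp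
      ultimately show ?thesis using eq[OF that] by metis
    qed
    then have "has_sobolev_deriv (len e) (q e) (dx len q' e)"
      using H1_dx[OF q(2) e] unfolding has_sobolev_deriv_def by blast
    then show "AE x in lebesgue_on {0..len e}. dx len q e x = dx len q' e x"
      using has_sobolev_deriv_unique[OF less_imp_le[OF l] H1_dx[OF q(1) e]] by blast
  qed
qed (auto intro: dx_L2 q)

section \<open>Vertex values\<close>

lemma vertex_val_eq:
  assumes "q \<in> H1_net G len" "e \<in> arcs G"
  shows "vertex_val G len q (tail G e) = q e 0" "vertex_val G len q (head G e) = q e (len e)"
proof -
  obtain \<phi> where \<phi>: "\<forall>e\<in>arcs G. q e 0 = \<phi> (tail G e) \<and> q e (len e) = \<phi> (head G e)"
    using assms(1) by (auto simp: H1_net_def)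
  have "vertex_val G len q v = \<phi> v" if "v = tail G e \<or> v = head G e" for v
    unfolding vertex_val_def
  proof (rule the_equality)
    show "\<forall>e\<in>arcs G. (tail G e = v \<longrightarrow> q e 0 = \<phi> v) \<and> (head G e = v \<longrightarrow> q e (len e) = \<phi> v)"
      using \<phi> by auto
    show "c = \<phi> v" if "\<forall>e\<in>arcs G. (tail G e = v \<longrightarrow> q e 0 = c) \<and> (head G e = v \<longrightarrow> q e (len e) = c)" for c
      using that \<phi> assms(2) \<open>v = tail G e \<or> v = head G e\<close> by metis
  qed
  then show "vertex_val G len q (tail G e) = q e 0" "vertex_val G len q (head G e) = q e (len e)"
    using \<phi> assms(2) by auto
qed

text \<open>A vertex value is determined only where an edge ends. If \<open>v\<close> is not the
  tail of a given edge, a walk from \<open>v\<close> to that tail in the symmetrised graph begins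
  with an edge at \<open>v\<close>.\<close>

lemma incident_arc:
  assumes "arcs G \<noteq> {}" "v \<in> verts G"
  obtains e where "e \<in> arcs G" "tail G e = v \<or> head G e = v"
proof -
  obtain e0 where e0: "e0 \<in> arcs G" using assms(1) by auto
  have t: "tail G e0 \<in> verts G" using e0 by simp
  show ?thesis
  proof (cases "tail G e0 = v")
    case True
    then show ?thesis using that e0 by blast
  next
    case False
    have "v \<rightarrow>\<^sup>*\<^bsub>with_proj (mk_symmetric G)\<^esub> tail G e0"
      using connected_G assms(2) t unfolding Digraph_Component.connected_def strongly_connected_def
      by (auto simp: mk_symmetric_def)
    then obtain u where "(v, u) \<in> arcs_ends (with_proj (mk_symmetric G))"
      using False by (cases rule: pre_digraph.converse_reachable_cases) auto
    then have "\<exists>e\<in>arcs G. tail G e = v \<or> head G e = v"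
      by (auto simp: parcs_mk_symmetric arcs_ends_conv symcl_def mk_symmetric_def)
    then show ?thesis using that by blast
  qed
qed

lemma vertex_val_lincomb:
  assumes "arcs G \<noteq> {}" "v \<in> verts G" "q \<in> H1_net G len" "q' \<in> H1_net G len"
  shows "vertex_val G len (\<lambda>e x. \<alpha> * q e x + \<beta> * q' e x) v
    = \<alpha> * vertex_val G len q v + \<beta> * vertex_val G len q' v"
proof -
  obtain e where e: "e \<in> arcs G" "tail G e = v \<or> head G e = v" using incident_arc[OF assms(1,2)] .
  then show ?thesis
    using vertex_val_eq[OF H1_lincomb[OF assms(3,4), of \<alpha> \<beta>] e(1)] vertex_val_eq[OF assms(3) e(1)]
      vertex_val_eq[OF assms(4) e(1)] by auto
qed

lemma vertex_val_diff:
  assumes "arcs G \<noteq> {}" "v \<in> verts G" "q \<in> H1_net G len" "q' \<in> H1_net G len"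
  shows "vertex_val G len (\<lambda>e x. q e x - q' e x) v = vertex_val G len q v - vertex_val G len q' v"
  using vertex_val_lincomb[OF assms, of 1 "- 1"] by simp

text \<open>Integration by parts against an affine function on one edge at \<open>v\<close>.\<close>

lemma trace_representation:
  assumes "arcs G \<noteq> {}" "v \<in> verts G"
  obtains \<mu> \<nu> where "\<mu> \<in> L2_net G len" "\<nu> \<in> L2_net G len"
    "\<And>q. q \<in> H1_net G len \<Longrightarrow> vertex_val G len q v = inner_L2 G len \<mu> (dx len q) + inner_L2 G len \<nu> q"
proof -
  obtain e where e: "e \<in> arcs G" "tail G e = v \<or> head G e = v" using incident_arc[OF assms(1,2)] .
  \<comment> \<open>The weight depends on the end of \<open>e\<close> at which \<open>v\<close>
    lies; a loop at \<open>v\<close> is read at its tail.\<close>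
  define \<mu> where "\<mu> e' x = (if e' = e then (if tail G e = v then x / len e - 1 else x / len e) else 0)" for e' x
  define \<nu> where "\<nu> e' x = (if e' = e then 1 / len e else 0)" for e' and x :: real
  have L2: "\<mu> \<in> L2_net G len" "\<nu> \<in> L2_net G len"
  proof -
    have "continuous_on S (\<mu> e')" "continuous_on S (\<nu> e')" for S e'
      using len_pos[OF e(1)] unfolding \<mu>_def[abs_def] \<nu>_def[abs_def]
      by (cases "e' = e"; cases "tail G e = v"; auto intro!: continuous_intros)+
    then show "\<mu> \<in> L2_net G len" "\<nu> \<in> L2_net G len"
      unfolding L2_net_iff by (auto intro: sq_integrable_continuous)
  qed
  have one: "inner_L2 G len w q = (LINT x|lebesgue_on {0..len e}. w e x * q e x)"
    if "\<And>e' x. e' \<noteq> e \<Longrightarrow> w e' x = 0" for w q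
    unfolding inner_L2_def using finite_arcs e(1) that by (subst sum.remove[OF _ e(1)]) auto
  have "vertex_val G len q v = inner_L2 G len \<mu> (dx len q) + inner_L2 G len \<nu> q" if q: "q \<in> H1_net G len" for q
    using has_sobolev_deriv_average[OF len_pos[OF e(1)] H1_dx[OF q e(1)]] vertex_val_eq[OF q e(1)] e(2)
    by (cases "tail G e = v") (auto simp: one[of \<mu>] one[of \<nu>] \<mu>_def \<nu>_def)
  with L2 show ?thesis using that by blast
qed

end

section \<open>Vertex data in time and integrals over the time grid\<close>

lemma has_sobolev_deriv_H1_time:
  assumes T: "0 \<le> T" and q: "H1_on T q"
  shows "H1_time T q"
proof -
  obtain w where w: "sq_integrable (lebesgue_on {0..T}) w"
    and qw: "\<And>x. x \<in> {0..T} \<Longrightarrow> q x = q 0 + (LINT y|lebesgue_on {0..x}. w y)"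
    using q unfolding H1_on_def has_sobolev_deriv_def L2_on_iff by blast
  obtain w' where w': "w' \<in> borel_measurable borel" and "AE x in lebesgue_on {0..T}. w x = w' x"
    and usq: "sq_integrable lborel (\<lambda>y. indicator {0..T} y * w' y)"
    and "integrable lborel (\<lambda>y. indicator {0..T} y * w' y)"
    and rep: "\<forall>x\<in>{0..T}. (LINT y|lebesgue_on {0..x}. w y) = (LINT y|lborel. indicator {0..x} y * w' y)"
    using sq_integrable_borel_representative[OF w] .
  define u where "u y = indicator {0..T} y * w' y" for y
  note usq = usq[folded u_def]
  have um: "u \<in> borel_measurable borel" unfolding u_def using w' by measurable
  have qu: "q x = q 0 + (LINT y|lborel. indicator {0<..x} y * u y)" if x: "x \<in> {0..T}" for x
  proof -
    have "(LINT y|lebesgue_on {0..x}. w y) = (LINT y|lborel. indicator {0..x} y * w' y)"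
      by (rule bspec[OF rep x])
    also have "\<dots> = (LINT y|lborel. indicator {0<..x} y * u y)"
    proof (rule integral_cong_AE)
      show "AE y in lborel. indicator {0..x} y * w' y = indicator {0<..x} y * u y"
        using AE_lborel_singleton[of 0] by eventually_elim (use x in \<open>auto simp: indicator_def u_def\<close>)
    qed (use w' um in measurable)
    finally show ?thesis using qw[OF x] by metis
  qed
  obtain \<Phi> where "time_modulus T \<Phi>"
    and \<Phi>: "\<And>s t. 0 \<le> s \<Longrightarrow> s \<le> t \<Longrightarrow> (LINT r|lborel. indicator {s<..t} r * (u r)\<^sup>2) = \<Phi> t - \<Phi> s"
    using modulus_of_integrable[of "\<lambda>r. (u r)\<^sup>2" T] usq unfolding sq_integrable_def by auto
  moreover have "has_modulus T \<Phi> q"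
    unfolding has_modulus_def
  proof (intro allI impI)
    fix s t :: real assume st: "0 \<le> s" "s \<le> t" "t \<le> T"
    have "(LINT y|lborel. indicator {0<..t} y * u y)
        = (LINT y|lborel. indicator {0<..s} y * u y + indicator {s<..t} y * u y)"
      using st by (intro Bochner_Integration.integral_cong) (auto simp: indicator_def)
    also have "\<dots> = (LINT y|lborel. indicator {0<..s} y * u y) + (LINT y|lborel. indicator {s<..t} y * u y)"
      using st by (intro Bochner_Integration.integral_add sq_integrable_interval_Cauchy_Schwarz(1)[OF usq]) auto
    finally have "q t - q s = (LINT y|lborel. indicator {s<..t} y * u y)"
      using qu[of s] qu[of t] st by simp
    then have "(norm (q t - q s))\<^sup>2 \<le> (t - s) * (LINT r|lborel. indicator {s<..t} r * (u r)\<^sup>2)"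
      using sq_integrable_interval_Cauchy_Schwarz(3)[OF usq st(2)] by simp
    also have "(LINT r|lborel. indicator {s<..t} r * (u r)\<^sup>2) = \<Phi> t - \<Phi> s" by (rule \<Phi>[OF st(1,2)])
    finally show "(norm (q t - q s))\<^sup>2 \<le> (t - s) * (\<Phi> t - \<Phi> s)" .
  qed
  ultimately show ?thesis unfolding H1_time_def by blast
qed

lemma H2_on_vec_deriv:
  assumes T: "0 < T" and y: "H2_on T (\<lambda>t. y t v)"
  shows "\<And>t. t \<in> {0..T} \<Longrightarrow> ((\<lambda>t. y t v) has_vector_derivative vec_deriv T y t v) (at t within {0..T})"
    and "H1_time T (\<lambda>t. vec_deriv T y t v)"
proof -
  obtain y' where y': "\<And>t. t \<in> {0..T} \<Longrightarrow> ((\<lambda>t. y t v) has_real_derivative y' t) (at t within {0..T})" "H1_on T y'"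
    using y unfolding H2_on_def by blast
  have d: "((\<lambda>t. y t v) has_vector_derivative y' t) (at t within {0..T})" if "t \<in> {0..T}" for t
    using y'(1)[OF that] by (simp add: has_real_derivative_iff_has_vector_derivative)
  have eq: "vec_deriv T y t v = y' t" if "t \<in> {0..T}" for t
    unfolding vec_deriv_def using T that d[OF that]
    by (intro vector_derivative_within_closed_interval) auto
  show "((\<lambda>t. y t v) has_vector_derivative vec_deriv T y t v) (at t within {0..T})" if "t \<in> {0..T}" for t
    using d[OF that] eq[OF that] by simp
  have "H1_time T y'" using has_sobolev_deriv_H1_time[OF _ y'(2)] T by simp
  then show "H1_time T (\<lambda>t. vec_deriv T y t v)"
    by (rule H1_time_bounded_increments[where c = 1]) (simp add: eq)
qed

text \<open>Only the majorant has to be integrable: should \<open>F\<close> fail to be so, its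
  integral is 0 by convention and the majorant is nonnegative.\<close>

lemma LINT_le_sum_integral_grid:
  fixes F :: "real \<Rightarrow> real" and B :: "nat \<Rightarrow> real \<Rightarrow> real"
  assumes n: "0 < n" and T: "0 < T" and \<tau>: "\<tau> = T / real n"
    and B: "\<And>j. j \<in> {1..n} \<Longrightarrow> continuous_on (cell \<tau> j) (B j)"
    and F0: "\<And>t. 0 \<le> F t"
    and FB: "\<And>j t. j \<in> {1..n} \<Longrightarrow> t \<in> {real (j - 1) * \<tau><..real j * \<tau>} \<Longrightarrow> F t \<le> B j t"
  shows "(LINT t|lebesgue_on {0..T}. F t) \<le> (\<Sum>j=1..n. integral (cell \<tau> j) (B j))"
proof -
  have \<tau>p: "0 < \<tau>" "real n * \<tau> = T" using n T by (auto simp: \<tau>)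
  let ?I = "\<lambda>j. {real (j - 1) * \<tau><..real j * \<tau>}"
  \<comment> \<open>Cells open on the left are disjoint and match the convention of
    \<open>pw_const\<close>.\<close>
  define BB where "BB t = (\<Sum>j=1..n. if t \<in> ?I j then B j t else 0)" for t
  have int: "has_bochner_integral lebesgue (\<lambda>t. if t \<in> ?I j then B j t else 0)
      (integral (cell \<tau> j) (B j))" if j: "j \<in> {1..n}" for j
  proof -
    let ?J = "(cell \<tau> j)"
    have i: "integrable (lebesgue_on ?J) (B j)" by (rule continuous_imp_integrable_real[OF B[OF j]])
    then have iJ: "integrable lebesgue (\<lambda>t. if t \<in> ?J then B j t else 0)"
      by (subst Lebesgue_Measure.integrable_restrict_UNIV) auto
    have lint: "(LINT t|lebesgue. (if t \<in> ?J then B j t else 0)) = integral ?J (B j)"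
      using lebesgue_integral_eq_integral[OF i] by (subst Lebesgue_Measure.integral_restrict_UNIV) auto
    \<comment> \<open>Closed and half-open cell differ by the left end point, a null set.\<close>
    have ae: "AE t in lebesgue. (if t \<in> ?J then B j t else 0) = (if t \<in> ?I j then B j t else 0)"
      using AE_completion[OF AE_lborel_singleton[of "real (j - 1) * \<tau>"]] by eventually_elim auto
    have m: "(\<lambda>t. if t \<in> ?I j then B j t else 0) \<in> borel_measurable lebesgue"
      by (rule borel_measurable_lebesgue_AE[OF borel_measurable_integrable[OF iJ] ae])
    have "has_bochner_integral lebesgue (\<lambda>t. if t \<in> ?J then B j t else 0) (integral ?J (B j))"
      using has_bochner_integral_integrable[OF iJ] lint by simp
    then show ?thesis
      by (rule has_bochner_integral_cong_AE[THEN iffD1, rotated -1])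
        (use m borel_measurable_integrable[OF iJ] ae in auto)
  qed
  then have BBi: "has_bochner_integral lebesgue BB (\<Sum>j=1..n. integral (cell \<tau> j) (B j))"
    unfolding BB_def by (intro has_bochner_integral_sum) auto
  have pt: "F t \<le> BB t" if t: "t \<in> {0<..T}" for t
  proof -
    define j where "j = nat \<lceil>t / \<tau>\<rceil>"
    have pos: "0 < t / \<tau>" using t \<tau>p by simp
    have jr: "real j = of_int \<lceil>t / \<tau>\<rceil>" using pos unfolding j_def by simp
    have c: "t / \<tau> \<le> real j" "real j < t / \<tau> + 1" unfolding jr by linarith+
    have tn: "t / \<tau> \<le> real n" using t \<tau>p by (simp add: field_simps)
    have jn: "j \<in> {1..n}" using tn pos unfolding j_def by (auto simp: Suc_le_eq)
    have tj: "t \<in> ?I j" using c jn \<tau>p by (auto simp: field_simps of_nat_diff)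
    have nonneg: "0 \<le> (if t \<in> ?I i then B i t else 0)" if "i \<in> {1..n}" for i
      using FB[OF that, of t] F0[of t] by (auto intro: order_trans)
    have "F t \<le> (if t \<in> ?I j then B j t else 0)" using FB[OF jn tj] tj by simp
    also have "\<dots> \<le> BB t" unfolding BB_def using jn nonneg by (intro member_le_sum) auto
    finally show ?thesis .
  qed
  have BB0: "0 \<le> BB t" for t
    unfolding BB_def using FB F0 by (intro sum_nonneg) (auto intro: order_trans)
  have "(LINT t|lebesgue_on {0..T}. F t) = (LINT t|lebesgue. (if t \<in> {0..T} then F t else 0))"
    by (subst Lebesgue_Measure.integral_restrict_UNIV) auto
  also have "\<dots> \<le> (LINT t|lebesgue. BB t)"
  proof (rule integral_mono_AE')
    show "integrable lebesgue BB" using BBi by (rule integrable.intros)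
    show "AE t in lebesgue. (if t \<in> {0..T} then F t else 0) \<le> BB t"
      using AE_completion[OF AE_lborel_singleton[of 0]]
      by eventually_elim (use pt BB0 in \<open>auto simp: less_le\<close>)
    show "AE t in lebesgue. 0 \<le> BB t" using BB0 by simp
  qed
  also have "\<dots> = (\<Sum>j=1..n. integral (cell \<tau> j) (B j))"
    using has_bochner_integral_integral_eq[OF BBi] .
  finally show ?thesis .
qed

section \<open>The network as an instance of the abstract energy space\<close>

context network
begin

lemma H1_zero: "(\<lambda>e x. 0) \<in> H1_net G len"
proof -
  have "has_sobolev_deriv l (\<lambda>x. 0) (\<lambda>x. 0)" for l
    by (simp add: has_sobolev_deriv_def L2_on_iff sq_integrable_zero)
  then show ?thesis unfolding H1_net_def H1_on_def by auto
qed

lemma H1_sum: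
  assumes "finite S" "\<And>v. v \<in> S \<Longrightarrow> \<phi> v \<in> H1_net G len"
  shows "(\<lambda>e x. \<Sum>v\<in>S. y v * \<phi> v e x) \<in> H1_net G len"
    and "emb (\<lambda>e x. \<Sum>v\<in>S. y v * \<phi> v e x) = (\<Sum>v\<in>S. y v *\<^sub>R emb (\<phi> v))"
    and "emb (dx len (\<lambda>e x. \<Sum>v\<in>S. y v * \<phi> v e x)) = (\<Sum>v\<in>S. y v *\<^sub>R emb (dx len (\<phi> v)))"
    and "arcs G \<noteq> {} \<Longrightarrow> w \<in> verts G \<Longrightarrow>
      vertex_val G len (\<lambda>e x. \<Sum>v\<in>S. y v * \<phi> v e x) w = (\<Sum>v\<in>S. y v * vertex_val G len (\<phi> v) w)"
proof -
  let ?f = "\<lambda>S e x. \<Sum>v\<in>S. y v * \<phi> v e x"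
  have "?f S \<in> H1_net G len \<and> emb (?f S) = (\<Sum>v\<in>S. y v *\<^sub>R emb (\<phi> v)) \<and>
    emb (dx len (?f S)) = (\<Sum>v\<in>S. y v *\<^sub>R emb (dx len (\<phi> v))) \<and>
    (arcs G \<noteq> {} \<longrightarrow> w \<in> verts G \<longrightarrow> vertex_val G len (?f S) w = (\<Sum>v\<in>S. y v * vertex_val G len (\<phi> v) w))"
    using assms
  proof (induction S)
    case empty
    then show ?case
      using H1_zero emb_lincomb[OF H1_subset_L2[OF H1_zero] H1_subset_L2[OF H1_zero], of 0 0]
        emb_dx_lincomb[OF H1_zero H1_zero, of 0 0] vertex_val_lincomb[OF _ _ H1_zero H1_zero, of _ 0 0]
      by simp
  next
    case (insert a S)
    then have IH: "?f S \<in> H1_net G len" "emb (?f S) = (\<Sum>v\<in>S. y v *\<^sub>R emb (\<phi> v))"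
      "emb (dx len (?f S)) = (\<Sum>v\<in>S. y v *\<^sub>R emb (dx len (\<phi> v)))"
      "arcs G \<noteq> {} \<longrightarrow> w \<in> verts G \<longrightarrow> vertex_val G len (?f S) w = (\<Sum>v\<in>S. y v * vertex_val G len (\<phi> v) w)"
      and a: "\<phi> a \<in> H1_net G len" by auto
    show ?case
      using insert.hyps IH H1_lincomb[OF a IH(1), of "y a" 1]
        emb_lincomb[OF H1_subset_L2[OF a] H1_subset_L2[OF IH(1)], of "y a" 1]
        emb_dx_lincomb[OF a IH(1), of "y a" 1] vertex_val_lincomb[OF _ _ a IH(1), of w "y a" 1]
      by simp
  qed
  then show "?f S \<in> H1_net G len" "emb (?f S) = (\<Sum>v\<in>S. y v *\<^sub>R emb (\<phi> v))"
    "emb (dx len (?f S)) = (\<Sum>v\<in>S. y v *\<^sub>R emb (dx len (\<phi> v)))"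
    "arcs G \<noteq> {} \<Longrightarrow> w \<in> verts G \<Longrightarrow> vertex_val G len (?f S) w = (\<Sum>v\<in>S. y v * vertex_val G len (\<phi> v) w)"
    by blast+
qed

lemma emb_has_vector_derivative:
  assumes u: "\<And>t. t \<in> {0..T} \<Longrightarrow> u t \<in> L2_net G len" "\<And>t. t \<in> {0..T} \<Longrightarrow> u' t \<in> L2_net G len"
    and d: "has_L2_time_deriv G len T u u'" and t: "t \<in> {0..T}"
  shows "((\<lambda>t. emb (u t)) has_vector_derivative emb (u' t)) (at t within {0..T})"
  unfolding has_vector_derivative_iff_quotient
proof -
  have "norm ((1 / (s - t)) *\<^sub>R (emb (u s) - emb (u t)) - emb (u' t))
      = norm_L2 G len (\<lambda>e x. (u s e x - u t e x) / (s - t) - u' t e x)" if s: "s \<in> {0..T}" for s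
  proof -
    let ?w = "\<lambda>e x. (1 / (s - t)) * (u s e x - u t e x)"
    have w: "?w \<in> L2_net G len" by (intro L2_net_cmult L2_net_diff u s t)
    have "emb (\<lambda>e x. ?w e x - u' t e x) = (1 / (s - t)) *\<^sub>R (emb (u s) - emb (u t)) - emb (u' t)"
      using emb_diff[OF w u(2)[OF t]] emb_diff[OF u(1)[OF s] u(1)[OF t]]
        emb_cmult[OF L2_net_diff[OF u(1)[OF s] u(1)[OF t]], of "1 / (s - t)"] by (simp only:)
    moreover have "norm (emb (\<lambda>e x. ?w e x - u' t e x)) = norm_L2 G len (\<lambda>e x. ?w e x - u' t e x)"
      by (intro norm_emb L2_net_diff w u t)
    ultimately show ?thesis by simp
  qed
  then have "\<forall>\<^sub>F s in at t within {0..T}. norm_L2 G len (\<lambda>e x. (u s e x - u t e x) / (s - t) - u' t e x)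
      = norm ((1 / (s - t)) *\<^sub>R (emb (u s) - emb (u t)) - emb (u' t))"
    unfolding eventually_at_filter by simp
  note ev = this
  have "((\<lambda>s. norm_L2 G len (\<lambda>e x. (u s e x - u t e x) / (s - t) - u' t e x)) \<longlongrightarrow> 0) (at t within {0..T})"
    using d t unfolding has_L2_time_deriv_def by blast
  then show "((\<lambda>s. norm ((1 / (s - t)) *\<^sub>R (emb (u s) - emb (u t)) - emb (u' t))) \<longlongrightarrow> 0) (at t within {0..T})"
    using tendsto_cong[OF ev, of 0] by blast
qed

lemma emb_continuous_on:
  assumes u: "\<And>t. t \<in> {0..T} \<Longrightarrow> u t \<in> L2_net G len" and c: "continuous_L2 G len T u"
  shows "continuous_on {0..T} (\<lambda>t. emb (u t))"
  unfolding continuous_on_def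
proof
  fix t assume t: "t \<in> {0..T}"
  have "\<forall>\<^sub>F s in at t within {0..T}. norm_L2 G len (\<lambda>e x. u s e x - u t e x) = norm (emb (u s) - emb (u t))"
    unfolding eventually_at_filter
    using u t by (auto simp: emb_diff[symmetric] norm_emb L2_net_diff)
  note ev = this
  have "((\<lambda>s. norm_L2 G len (\<lambda>e x. u s e x - u t e x)) \<longlongrightarrow> 0) (at t within {0..T})"
    using c t unfolding continuous_L2_def by blast
  then have "((\<lambda>s. norm (emb (u s) - emb (u t))) \<longlongrightarrow> 0) (at t within {0..T})"
    using tendsto_cong[OF ev, of 0] by blast
  then show "((\<lambda>t. emb (u t)) \<longlongrightarrow> emb (u t)) (at t within {0..T})"
    using Lim_null tendsto_norm_zero_iff by blast
qed

text \<open>The squared norm is a sum over edges, so the sum of the moduli of the finitely many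
  edges is a modulus.\<close>

lemma H1_time_emb:
  assumes T: "0 \<le> T" and f: "H1_time_L2 G len T f"
  shows "t \<in> {0..T} \<Longrightarrow> f t \<in> L2_net G len" and "H1_time T (\<lambda>t. emb (f t))"
proof -
  obtain f' :: "real \<Rightarrow> 'e edge_fun" where f0: "f 0 \<in> L2_net G len" and f': "\<And>e. e \<in> arcs G \<Longrightarrow>
        (\<lambda>(t, x). f' t e x) \<in> borel_measurable borel"
      "\<And>e. e \<in> arcs G \<Longrightarrow> set_integrable lborel ({0..T} \<times> {0..len e}) (\<lambda>(t, x). (f' t e x)\<^sup>2)"
      "\<And>e t. e \<in> arcs G \<Longrightarrow> t \<in> {0..T} \<Longrightarrow> AE x in lebesgue_on {0..len e}.
           f t e x = f 0 e x + (LINT s|lebesgue_on {0..t}. f' s e x)"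
    using f unfolding H1_time_L2_def by blast
  have "\<exists>\<Phi>. time_modulus T \<Phi> \<and> (\<forall>t\<in>{0..T}. sq_integrable (lebesgue_on {0..len e}) (f t e)) \<and>
      (\<forall>s t. 0 \<le> s \<longrightarrow> s \<le> t \<longrightarrow> t \<le> T \<longrightarrow>
        (LINT x|lebesgue_on {0..len e}. (f t e x - f s e x)\<^sup>2) \<le> (t - s) * (\<Phi> t - \<Phi> s))"
    if e: "e \<in> arcs G" for e
    by (rule time_H1_edge[OF T f'(1)[OF e] f'(2)[OF e], of "\<lambda>t. f t e"])
      (use f0 e f'(3)[OF e] in \<open>auto simp: L2_net_iff\<close>)
  then have "\<forall>e\<in>arcs G. \<exists>\<Phi>. time_modulus T \<Phi> \<and> (\<forall>t\<in>{0..T}. sq_integrable (lebesgue_on {0..len e}) (f t e)) \<and>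
      (\<forall>s t. 0 \<le> s \<longrightarrow> s \<le> t \<longrightarrow> t \<le> T \<longrightarrow>
        (LINT x|lebesgue_on {0..len e}. (f t e x - f s e x)\<^sup>2) \<le> (t - s) * (\<Phi> t - \<Phi> s))" by blast
  from bchoice[OF this] obtain \<Phi> where "\<forall>e\<in>arcs G. time_modulus T (\<Phi> e) \<and>
      (\<forall>t\<in>{0..T}. sq_integrable (lebesgue_on {0..len e}) (f t e)) \<and>
      (\<forall>s t. 0 \<le> s \<longrightarrow> s \<le> t \<longrightarrow> t \<le> T \<longrightarrow>
        (LINT x|lebesgue_on {0..len e}. (f t e x - f s e x)\<^sup>2) \<le> (t - s) * (\<Phi> e t - \<Phi> e s))" by blast
  then have \<Phi>: "\<And>e. e \<in> arcs G \<Longrightarrow> time_modulus T (\<Phi> e)"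
      "\<And>e t. e \<in> arcs G \<Longrightarrow> t \<in> {0..T} \<Longrightarrow> sq_integrable (lebesgue_on {0..len e}) (f t e)"
      "\<And>e s t. e \<in> arcs G \<Longrightarrow> 0 \<le> s \<Longrightarrow> s \<le> t \<Longrightarrow> t \<le> T \<Longrightarrow>
        (LINT x|lebesgue_on {0..len e}. (f t e x - f s e x)\<^sup>2) \<le> (t - s) * (\<Phi> e t - \<Phi> e s)"
    by blast+
  show L2: "f t \<in> L2_net G len" if "t \<in> {0..T}" for t using \<Phi>(2) that by (simp add: L2_net_iff)
  define \<Psi> where "\<Psi> t = (\<Sum>e\<in>arcs G. \<Phi> e t)" for t
  have "time_modulus T \<Psi>"
    using \<Phi>(1) unfolding time_modulus_def \<Psi>_def mono_on_def
    by (auto intro!: continuous_on_sum sum_mono)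
  moreover have "has_modulus T \<Psi> (\<lambda>t. emb (f t))"
    unfolding has_modulus_def
  proof (intro allI impI)
    fix s t :: real assume st: "0 \<le> s" "s \<le> t" "t \<le> T"
    then have fL: "f s \<in> L2_net G len" "f t \<in> L2_net G len" by (auto intro: L2)
    have "(norm (emb (f t) - emb (f s)))\<^sup>2 = inner_L2 G len (\<lambda>e x. f t e x - f s e x) (\<lambda>e x. f t e x - f s e x)"
      using fL by (simp add: emb_diff[symmetric] power2_norm_eq_inner inner_emb L2_net_diff)
    also have "\<dots> = (\<Sum>e\<in>arcs G. LINT x|lebesgue_on {0..len e}. (f t e x - f s e x)\<^sup>2)"
      by (simp add: inner_L2_def power2_eq_square)
    also have "\<dots> \<le> (\<Sum>e\<in>arcs G. (t - s) * (\<Phi> e t - \<Phi> e s))" by (intro sum_mono \<Phi>(3) st)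
    also have "\<dots> = (t - s) * (\<Psi> t - \<Psi> s)"
      by (simp add: \<Psi>_def sum_distrib_left[symmetric] sum_subtractf)
    finally show "(norm (emb (f t) - emb (f s)))\<^sup>2 \<le> (t - s) * (\<Psi> t - \<Psi> s)" .
  qed
  ultimately show "H1_time T (\<lambda>t. emb (f t))" unfolding H1_time_def by blast
qed

definition V0 :: "('e l2 \<times> 'e l2) set" where
  "V0 = (\<lambda>q. (emb q, emb (dx len q))) ` H10_net G len VD"

lemma V0_I: "q \<in> H1_net G len \<Longrightarrow> (\<And>v. v \<in> VD \<Longrightarrow> vertex_val G len q v = 0) \<Longrightarrow> (emb q, emb (dx len q)) \<in> V0"
  unfolding V0_def H10_net_def by auto

lemma V0_E:
  assumes "(q, qx) \<in> V0"
  obtains q' where "q' \<in> H1_net G len" "q' \<in> H10_net G len VD" "q = emb q'" "qx = emb (dx len q')"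
    "\<And>v. v \<in> VD \<Longrightarrow> vertex_val G len q' v = 0"
  using assms unfolding V0_def H10_net_def by auto

lemma subspace_V0:
  assumes "arcs G \<noteq> {}"
  shows "subspace V0"
proof -
  have comb: "(\<alpha> *\<^sub>R q + \<beta> *\<^sub>R q', \<alpha> *\<^sub>R qx + \<beta> *\<^sub>R qx') \<in> V0"
    if V: "(q, qx) \<in> V0" "(q', qx') \<in> V0" for \<alpha> \<beta> q qx q' qx'
  proof -
    obtain p where p: "p \<in> H1_net G len" "q = emb p" "qx = emb (dx len p)"
      "\<And>v. v \<in> VD \<Longrightarrow> vertex_val G len p v = 0" using V0_E[OF V(1)] by metis
    obtain p' where p': "p' \<in> H1_net G len" "q' = emb p'" "qx' = emb (dx len p')"
      "\<And>v. v \<in> VD \<Longrightarrow> vertex_val G len p' v = 0" using V0_E[OF V(2)] by metis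
    have "(emb (\<lambda>e x. \<alpha> * p e x + \<beta> * p' e x), emb (dx len (\<lambda>e x. \<alpha> * p e x + \<beta> * p' e x))) \<in> V0"
    proof (rule V0_I[OF H1_lincomb[OF p(1) p'(1)]])
      fix v assume v: "v \<in> VD"
      then have "v \<in> verts G" using VD_subset by auto
      then show "vertex_val G len (\<lambda>e x. \<alpha> * p e x + \<beta> * p' e x) v = 0"
        using vertex_val_lincomb[OF assms _ p(1) p'(1)] p(4)[OF v] p'(4)[OF v] by simp
    qed
    then show ?thesis
      using p p' by (simp add: emb_lincomb emb_dx_lincomb H1_subset_L2)
  qed
  have "(emb (\<lambda>e x. 0), emb (dx len (\<lambda>e x. 0))) \<in> V0"
    using vertex_val_lincomb[OF assms _ H1_zero H1_zero, of _ 0 0] VD_subset by (intro V0_I H1_zero) auto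
  from comb[OF this this, of 0 0] have "(0, 0) \<in> V0" by simp
  moreover have "x + y \<in> V0" if "x \<in> V0" "y \<in> V0" for x y
    using comb[of "fst x" "snd x" "fst y" "snd y" 1 1] that by (simp add: plus_prod_def)
  moreover have "c *\<^sub>R x \<in> V0" if "x \<in> V0" for c x
    using comb[of "fst x" "snd x" "fst x" "snd x" c 0] that by (simp add: scaleR_prod_def)
  ultimately show ?thesis unfolding subspace_def by (simp add: zero_prod_def)
qed

lemma energy_space_V0:
  assumes "arcs G \<noteq> {}" and a: "coeff_bounds G len a 0 a_up"
    and d: "0 < d_lo" "coeff_bounds G len d d_lo d_up"
  shows "energy_space V0 (coeff_op 0 a) (coeff_op d_lo d) \<bar>a_up\<bar> d_lo (max d_lo \<bar>d_up\<bar>)"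
proof (rule energy_space.intro)
  show "subspace V0" by (rule subspace_V0[OF assms(1)])
  show "linear (coeff_op 0 a)" unfolding coeff_op_def by (rule linear_l2_mult[OF coeff_ext_bounded[OF a]])
  show "linear (coeff_op d_lo d)" unfolding coeff_op_def by (rule linear_l2_mult[OF coeff_ext_bounded[OF d(2)]])
  show "0 \<le> coeff_op 0 a x \<bullet> x" for x
    using l2_mult_lower[OF coeff_ext_bounded[OF a], of x] by (simp add: coeff_op_def)
  show "norm (coeff_op 0 a x) \<le> \<bar>a_up\<bar> * norm x" for x
    unfolding coeff_op_def by (rule l2_mult_norm[OF coeff_ext_bounded[OF a]]) auto
  show "d_lo * (norm x)\<^sup>2 \<le> coeff_op d_lo d x \<bullet> x" for x
    unfolding coeff_op_def by (rule l2_mult_lower[OF coeff_ext_bounded[OF d(2)]])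
  show "norm (coeff_op d_lo d x) \<le> max d_lo \<bar>d_up\<bar> * norm x" for x
    unfolding coeff_op_def using d(1) by (intro l2_mult_norm[OF coeff_ext_bounded[OF d(2)]]) auto
qed (rule d(1))

text \<open>Testing with the difference itself. This turns the flux equation, posed as a functional
  on L^2, into an identity of classes.\<close>

lemma emb_eqI_inner:
  assumes "u \<in> L2_net G len" "w \<in> L2_net G len"
    and "\<And>z. z \<in> L2_net G len \<Longrightarrow> inner_L2 G len u z = inner_L2 G len w z"
  shows "emb u = emb w"
proof -
  let ?z = "\<lambda>e x. u e x - w e x"
  have z: "?z \<in> L2_net G len" by (intro L2_net_diff assms)
  have "emb u \<bullet> emb ?z = emb w \<bullet> emb ?z" using assms z by (simp add: inner_emb)
  then have "(emb u - emb w) \<bullet> (emb u - emb w) = 0"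
    using assms by (simp add: emb_diff inner_diff_left)
  then show ?thesis by simp
qed

end

section \<open>The error bound on the network\<close>

lemma weighted_sum_has_vector_derivative:
  fixes c :: "'i \<Rightarrow> 'a::real_normed_vector"
  assumes "\<And>v. v \<in> S \<Longrightarrow> ((\<lambda>t. y t v) has_vector_derivative y' v) F"
  shows "((\<lambda>t. \<Sum>v\<in>S. y t v *\<^sub>R c v) has_vector_derivative (\<Sum>v\<in>S. y' v *\<^sub>R c v)) F"
  using assms
  by (intro has_vector_derivative_sum bounded_linear.has_vector_derivative[OF bounded_linear_scaleR_left])

text \<open>\<open>pw_linear\<close> is anchored at the left node, the error estimate at the right
  one. At \<open>T\<close> the floor already equals \<open>n\<close>, which is the left node of no
  cell, so this point is treated apart.\<close>

lemma pw_linear_eq: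
  assumes n: "0 < n" and T: "0 < T" and \<tau>: "\<tau> = T / real n" and t: "t \<in> {0..T}"
  obtains j where "j \<in> {1..n}" "t \<in> cell \<tau> j"
    "pw_linear \<tau> U t = (\<lambda>e x. U j e x - (real j * \<tau> - t) / \<tau> * (U j e x - U (j - 1) e x))"
proof (cases "t = T")
  case True
  have "t / \<tau> = real n" using True n T by (simp add: \<tau>)
  then have "pw_linear \<tau> U t = U n" by (simp add: pw_linear_def Let_def)
  moreover have "real n * \<tau> = t" using True n by (simp add: \<tau>)
  ultimately show ?thesis
    using n T by (intro that[of n]) (auto simp: \<tau> divide_simps of_nat_diff True)
next
  case False
  have \<tau>p: "0 < \<tau>" using n T by (simp add: \<tau>)
  define i where "i = nat \<lfloor>t / \<tau>\<rfloor>"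
  have t0: "0 \<le> t / \<tau>" using t \<tau>p by simp
  have ir: "real i = of_int \<lfloor>t / \<tau>\<rfloor>" using t0 by (simp add: i_def)
  have i1: "real i \<le> t / \<tau>" "t / \<tau> < real i + 1" unfolding ir by linarith+
  have "t < T" using False t by simp
  then have "t / \<tau> < real n" using n T by (simp add: \<tau> field_simps)
  then have i: "Suc i \<in> {1..n}" using i1 by simp
  show ?thesis
  proof (rule that[OF i])
    show "t \<in> {real (Suc i - 1) * \<tau>..real (Suc i) * \<tau>}" using i1 \<tau>p by (auto simp: field_simps)
    show "pw_linear \<tau> U t = (\<lambda>e x. U (Suc i) e x - (real (Suc i) * \<tau> - t) / \<tau> * (U (Suc i) e x - U (Suc i - 1) e x))"
      using \<tau>p by (auto simp: pw_linear_def Let_def i_def[symmetric] fun_eq_iff field_simps)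
  qed
qed

lemma pw_const_eq:
  assumes "0 < \<tau>" "j \<in> {1..n}" "t \<in> {real (j - 1) * \<tau><..real j * \<tau>}"
  shows "pw_const \<tau> U t = U j"
proof -
  have "real j - 1 < t / \<tau>" "t / \<tau> \<le> real j"
    using assms by (auto simp: field_simps of_nat_diff)
  then have "\<lceil>t / \<tau>\<rceil> = int j" by (intro ceiling_unique) auto
  then show ?thesis by (simp add: pw_const_def)
qed

lemma (in network) vertex_trace_functions:
  assumes "arcs G \<noteq> {}"
  obtains \<mu> \<nu> where "\<And>v. v \<in> verts G \<Longrightarrow> \<mu> v \<in> L2_net G len" "\<And>v. v \<in> verts G \<Longrightarrow> \<nu> v \<in> L2_net G len"
    "\<And>v q. v \<in> verts G \<Longrightarrow> q \<in> H1_net G len \<Longrightarrow>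
      vertex_val G len q v = emb (\<mu> v) \<bullet> emb (dx len q) + emb (\<nu> v) \<bullet> emb q"
proof -
  let ?P = "\<lambda>v mn. fst mn \<in> L2_net G len \<and> snd mn \<in> L2_net G len \<and> (\<forall>q\<in>H1_net G len.
      vertex_val G len q v = emb (fst mn) \<bullet> emb (dx len q) + emb (snd mn) \<bullet> emb q)"
  have "\<exists>mn. ?P v mn" if v: "v \<in> verts G" for v
  proof -
    obtain m n where mn: "m \<in> L2_net G len" "n \<in> L2_net G len"
      "\<And>q. q \<in> H1_net G len \<Longrightarrow> vertex_val G len q v = inner_L2 G len m (dx len q) + inner_L2 G len n q"
      using trace_representation[OF assms v] by blast
    then have "?P v (m, n)" by (simp add: inner_emb dx_L2 H1_subset_L2)
    then show ?thesis by blast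
  qed
  then have "\<forall>v\<in>verts G. \<exists>mn. ?P v mn" by blast
  from bchoice[OF this] obtain F where F: "\<forall>v\<in>verts G. ?P v (F v)" by blast
  show ?thesis
    by (rule that[of "\<lambda>v. fst (F v)" "\<lambda>v. snd (F v)"]) (use F in blast)+
qed

theorem theorem6p5:
  fixes G :: "('v, 'e) pre_digraph" and len :: "'e \<Rightarrow> real" and VD :: "'v set"
    and a d :: "'e edge_fun" and a_up d_lo d_up :: real
    and Bminus :: "('v \<Rightarrow> real) \<Rightarrow> 'e edge_fun"
    and M :: "'v \<Rightarrow> 'v \<Rightarrow> real"
    and T :: real
    and f g :: "real \<Rightarrow> 'e edge_fun" and h r :: "real \<Rightarrow> 'v \<Rightarrow> real"
    and p_init m_init m_star p_star :: "'e edge_fun"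
  assumes network: "network G len VD"
    and a_bounds: "coeff_bounds G len a 0 a_up"
    and d_bounds: "0 < d_lo" "coeff_bounds G len d d_lo d_up"
    and Bminus: "linear_right_inverse G len VD Bminus"
    and M: "invertible_on VD M"
    and T: "0 < T"
    and f: "H1_time_L2 G len T f"
    and g: "H1_time_L2 G len T g"
    and h: "\<And>v. v \<in> VD \<Longrightarrow> H2_on T (\<lambda>t. h t v)"
    and r: "\<And>v. v \<in> verts G - VD \<Longrightarrow> H2_on T (\<lambda>t. r t v)"
    and p_init: "p_init \<in> H1_net G len" "\<And>v. v \<in> VD \<Longrightarrow> vertex_val G len p_init v = h 0 v"
    and m_init: "m_init \<in> L2_net G len"
    and m_star: "m_star \<in> L2_net G len"
      "\<And>q. q \<in> H10_net G len VD \<Longrightarrow>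
         inner_L2 G len m_star q = K_adj G len m_init q - eval_adj G len (verts G - VD) (r 0) q"
    and p_star: "p_star \<in> L2_net G len"
      "\<And>q. q \<in> H10_net G len VD \<Longrightarrow>
         inner_L2 G len p_star q =
           inner_L2 G len (g 0) q - eval_adj G len (verts G - VD) (r 0) q
           - (L_op G len d p_init q + inner_L2 G len (\<lambda>e x. a e x * p_init e x) q)
           - inner_L2 G len (Bminus (vec_deriv T h 0)) q
           + K_adj G len (\<lambda>e x. f 0 e x / d e x) q"
    and m_init_eq: "ae_eq G len m_init (\<lambda>e x. (f 0 e x - dx len p_init e x) / d e x)"
  shows "\<exists>C. \<forall>\<epsilon> n p m lam P Q Lam Mu.
    0 < \<epsilon> \<longrightarrow> \<epsilon> \<le> 1 \<longrightarrow> 0 < n \<longrightarrow>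
    hyperbolic_solution G len VD a d T f g h r p_init m_init \<epsilon> p m lam \<longrightarrow>
    euler_scheme G len VD a d M T f g h r p_init n P Q Lam Mu \<longrightarrow>
    (let \<tau> = T / real n in
       norm_L2_time T (norm_H1 G len) (\<lambda>t e x. p t e x - pw_const \<tau> P t e x)
       + norm_L2_time T (norm_L2 G len) (\<lambda>t e x. m t e x - pw_const \<tau> Q t e x)
       + norm_sup_time T (norm_L2 G len) (\<lambda>t e x. p t e x - pw_linear \<tau> P t e x)
       \<le> (\<epsilon> + \<tau>) * C)"
proof (cases "arcs G = {}")
  case True
  \<comment> \<open>Without edges every norm is an empty sum. In all other cases each vertex has an
    incident edge.\<close>
  have "norm_L2 G len = (\<lambda>u. 0)" by (simp add: norm_L2_def inner_L2_def True fun_eq_iff)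
  then show ?thesis
    using T by (intro exI[of _ 0]) (simp add: norm_L2_time_def norm_sup_time_def norm_H1_def)
next
  case False
  note arcs = this
  interpret network G len VD by (rule network)
  define A where "A = coeff_op 0 a"
  define D where "D = coeff_op d_lo d"
  interpret es: energy_space V0 A D "\<bar>a_up\<bar>" d_lo "max d_lo \<bar>d_up\<bar>"
    unfolding A_def D_def by (rule energy_space_V0[OF arcs a_bounds d_bounds])
  have finVD: "finite VD" using VD_subset finite_verts by (rule finite_subset)
  define VN where "VN = verts G - VD"
  have finVN: "finite VN" unfolding VN_def using finite_verts by simp
  have fL: "f t \<in> L2_net G len" and gL: "g t \<in> L2_net G len" if "t \<in> {0..T}" for t
    using H1_time_emb(1)[OF less_imp_le[OF T] f that] H1_time_emb(1)[OF less_imp_le[OF T] g that] by auto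
  \<comment> \<open>Nodal functions. Expanding the lifting in them confines the time dependence to
    finitely many real coefficients, so time derivatives act on these alone.\<close>
  define \<phi> where "\<phi> v = Bminus (\<lambda>w. if w = v then 1 else 0)" for v
  have \<phi>H: "\<phi> v \<in> H1_net G len" and \<phi>v: "w \<in> VD \<Longrightarrow> vertex_val G len (\<phi> v) w = (if w = v then 1 else 0)" for v w
    using Bminus unfolding linear_right_inverse_def \<phi>_def by auto
  define lift where "lift y = (\<lambda>e x. \<Sum>v\<in>VD. y v * \<phi> v e x)" for y
  have liftH: "lift y \<in> H1_net G len"
    and emb_lift: "emb (lift y) = (\<Sum>v\<in>VD. y v *\<^sub>R emb (\<phi> v))"
    and emb_dx_lift: "emb (dx len (lift y)) = (\<Sum>v\<in>VD. y v *\<^sub>R emb (dx len (\<phi> v)))" for y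
    unfolding lift_def by (rule H1_sum(1-3)[OF finVD \<phi>H])+
  have lift_v: "vertex_val G len (lift y) w = y w" if "w \<in> VD" for y w
  proof -
    have "vertex_val G len (lift y) w = (\<Sum>v\<in>VD. y v * vertex_val G len (\<phi> v) w)"
      unfolding lift_def using that VD_subset by (intro H1_sum(4)[OF finVD \<phi>H arcs]) auto
    also have "\<dots> = (\<Sum>v\<in>VD. if w = v then y v else 0)" using \<phi>v[OF that] by (intro sum.cong) auto
    finally show ?thesis using that finVD by simp
  qed
  define b where "b t = (\<Sum>v\<in>VD. h t v *\<^sub>R emb (\<phi> v))" for t
  define bx where "bx t = (\<Sum>v\<in>VD. h t v *\<^sub>R emb (dx len (\<phi> v)))" for t
  define b' where "b' t = (\<Sum>v\<in>VD. vec_deriv T h t v *\<^sub>R emb (\<phi> v))" for t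
  define bx' where "bx' t = (\<Sum>v\<in>VD. vec_deriv T h t v *\<^sub>R emb (dx len (\<phi> v)))" for t
  obtain \<mu> \<nu> where tr: "\<And>v. v \<in> verts G \<Longrightarrow> \<mu> v \<in> L2_net G len" "\<And>v. v \<in> verts G \<Longrightarrow> \<nu> v \<in> L2_net G len"
    "\<And>v q. v \<in> verts G \<Longrightarrow> q \<in> H1_net G len \<Longrightarrow>
      vertex_val G len q v = emb (\<mu> v) \<bullet> emb (dx len q) + emb (\<nu> v) \<bullet> emb q"
    using vertex_trace_functions[OF arcs] by blast
  \<comment> \<open>The trace formula splits the load at the vertices of \<open>VN\<close> into a
    part paired with the derivative and a part paired with the function. The former is
    differentiated in time, and H^2 regularity of \<open>r\<close> puts \<open>\<rho>'\<close> in
    H^1.\<close>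
  define \<rho> where "\<rho> t = (\<Sum>v\<in>VN. r t v *\<^sub>R emb (\<mu> v))" for t
  define \<rho>' where "\<rho>' t = (\<Sum>v\<in>VN. vec_deriv T r t v *\<^sub>R emb (\<mu> v))" for t
  define \<sigma> where "\<sigma> t = (\<Sum>v\<in>VN. r t v *\<^sub>R emb (\<nu> v))" for t
  have eval: "eval_adj G len (verts G - VD) (r t) q = \<rho> t \<bullet> emb (dx len q) + \<sigma> t \<bullet> emb q"
    if "q \<in> H1_net G len" for q t
    unfolding eval_adj_def \<rho>_def \<sigma>_def inner_sum_left sum.distrib[symmetric] VN_def[symmetric]
    using tr(3)[OF _ that] by (intro sum.cong) (auto simp: VN_def algebra_simps)
  note hd = H2_on_vec_deriv[OF T h]
  note rd = H2_on_vec_deriv[OF T r[folded VN_def]]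
  have eval0: "eval_adj G len VD y q = 0" if "\<And>v. v \<in> VD \<Longrightarrow> vertex_val G len q v = 0" for y q
    using that by (simp add: eval_adj_def)
  have K: "K_adj G len w q = emb w \<bullet> emb (dx len q)" if "w \<in> L2_net G len" "q \<in> H1_net G len" for w q
    using that by (simp add: K_adj_def K_op_def inner_emb[symmetric] dx_L2 inner_commute)
  have Aemb: "A (emb u) = emb (\<lambda>e x. a e x * u e x)" and Demb: "D (emb u) = emb (\<lambda>e x. d e x * u e x)"
    if "u \<in> L2_net G len" for u
    unfolding A_def D_def using that coeff_op_emb a_bounds d_bounds(2) by auto
  note aL = L2_net_coeff_mult[OF a_bounds] and dL = L2_net_coeff_mult[OF d_bounds(2)]
  \<comment> \<open>The pointwise formula for the initial flux, multiplied by \<open>d\<close>,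
    which is at least \<open>d_lo > 0\<close> almost everywhere.\<close>
  have compat: "D (emb m_init) = emb (f 0) - emb (dx len p_init)"
  proof -
    have f0: "f 0 \<in> L2_net G len" using fL T by simp
    have "D (emb m_init) = emb (\<lambda>e x. f 0 e x - dx len p_init e x)"
      unfolding Demb[OF m_init]
    proof (subst emb_eq_iff)
      show "ae_eq G len (\<lambda>e x. d e x * m_init e x) (\<lambda>e x. f 0 e x - dx len p_init e x)"
        unfolding ae_eq_def
      proof
        fix e assume e: "e \<in> arcs G"
        have "AE x in lebesgue_on {0..len e}. m_init e x = (f 0 e x - dx len p_init e x) / d e x"
          using m_init_eq e by (auto simp: ae_eq_def)
        moreover have "AE x in lebesgue_on {0..len e}. d_lo \<le> d e x \<and> d e x \<le> d_up"
          using d_bounds(2) e by (auto simp: coeff_bounds_def)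
        ultimately show "AE x in lebesgue_on {0..len e}. d e x * m_init e x = f 0 e x - dx len p_init e x"
          by eventually_elim (use d_bounds(1) in auto)
      qed
    qed (auto intro: dL m_init L2_net_diff f0 dx_L2 p_init)
    then show ?thesis using f0 p_init by (simp add: emb_diff dx_L2)
  qed
  \<comment> \<open>\<open>m_star\<close> is the L^2 representative which the initial velocity
    estimate asks for; here it is read off on classes.\<close>
  have s0: "emb m_star \<bullet> q = emb m_init \<bullet> qx - (\<rho> 0 \<bullet> qx + \<sigma> 0 \<bullet> q)" if V: "(q, qx) \<in> V0" for q qx
  proof -
    obtain q' where q': "q' \<in> H1_net G len" "q' \<in> H10_net G len VD" "q = emb q'" "qx = emb (dx len q')"
      using V0_E[OF V] by metis
    show ?thesis
      using m_star(2)[OF q'(2)] q' by (simp add: K m_init eval inner_emb m_star(1) H1_subset_L2)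
  qed
  have d_b: "(b has_vector_derivative b' t) (at t within {0..T})"
    and d_bx: "(bx has_vector_derivative bx' t) (at t within {0..T})"
    and d_\<rho>: "(\<rho> has_vector_derivative \<rho>' t) (at t within {0..T})" if "t \<in> {0..T}" for t
    unfolding b_def[abs_def] b'_def bx_def[abs_def] bx'_def \<rho>_def[abs_def] \<rho>'_def
    by (intro weighted_sum_has_vector_derivative hd(1) rd(1) that; assumption)+
  have H_b: "H1_time T b'" and H_bx: "H1_time T bx'" and H_\<rho>: "H1_time T \<rho>'" and H_\<sigma>: "H1_time T \<sigma>"
    unfolding b'_def[abs_def] bx'_def[abs_def] \<rho>'_def[abs_def] \<sigma>_def[abs_def]
    by (intro H1_time_sum H1_time_scaleR_left hd(2) rd(2) H1_time_of_derivative[OF rd(1) rd(2)]; assumption)+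
  \<comment> \<open>The constant is obtained before \<epsilon>, \<open>n\<close> and the solutions
    are introduced.\<close>
  have "\<exists>C\<ge>0. \<forall>\<epsilon> n p px m p' m' P Px Q. 0 < \<epsilon> \<longrightarrow> \<epsilon> \<le> 1 \<longrightarrow> 0 < n \<longrightarrow>
    es.hyperbolic_inhom T \<epsilon> (\<lambda>t. emb (f t)) (\<lambda>t. emb (g t)) \<rho> \<sigma> b bx p px m p' m' \<longrightarrow>
    p 0 = emb p_init \<longrightarrow> px 0 = emb (dx len p_init) \<longrightarrow> m 0 = emb m_init \<longrightarrow>
    P 0 = emb p_init \<longrightarrow> Px 0 = emb (dx len p_init) \<longrightarrow>
    es.euler_inhom T n (\<lambda>t. emb (f t)) (\<lambda>t. emb (g t)) \<rho> \<sigma> (b 0) (bx 0) b' bx' P Px Q \<longrightarrow>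
    error_estimate T C \<epsilon> n p px m P Px Q"
    by (rule es.euler_error_bound[where \<rho>' = \<rho>' and b' = b' and bx' = bx' and ?s0.0 = "emb m_star"])
      (use T H1_time_emb(2)[OF less_imp_le[OF T] f] H1_time_emb(2)[OF less_imp_le[OF T] g]
        d_b d_bx d_\<rho> H_b H_bx H_\<rho> H_\<sigma> compat s0 in auto)
  then obtain C where C0: "0 \<le> C" and C: "\<And>\<epsilon> n p px m p' m' P Px Q. 0 < \<epsilon> \<Longrightarrow> \<epsilon> \<le> 1 \<Longrightarrow> 0 < n \<Longrightarrow>
    es.hyperbolic_inhom T \<epsilon> (\<lambda>t. emb (f t)) (\<lambda>t. emb (g t)) \<rho> \<sigma> b bx p px m p' m' \<Longrightarrow>
    p 0 = emb p_init \<Longrightarrow> px 0 = emb (dx len p_init) \<Longrightarrow> m 0 = emb m_init \<Longrightarrow>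
    P 0 = emb p_init \<Longrightarrow> Px 0 = emb (dx len p_init) \<Longrightarrow>
    es.euler_inhom T n (\<lambda>t. emb (f t)) (\<lambda>t. emb (g t)) \<rho> \<sigma> (b 0) (bx 0) b' bx' P Px Q \<Longrightarrow>
    error_estimate T C \<epsilon> n p px m P Px Q"
    by blast
  show ?thesis
  \<comment> \<open>Each of the three norms will be at most
    \<open>sqrt C * (\<epsilon> + \<tau>)\<close>.\<close>
  proof (intro exI[of _ "3 * sqrt C"] allI impI)
    fix \<epsilon> :: real and n :: nat and p m lam P Q Lam Mu
    assume \<epsilon>: "0 < \<epsilon>" "\<epsilon> \<le> 1" and n: "0 < n"
      and hyp: "hyperbolic_solution G len VD a d T f g h r p_init m_init \<epsilon> p m lam"
      and eu: "euler_scheme G len VD a d M T f g h r p_init n P Q Lam Mu"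
    define \<tau> where "\<tau> = T / real n"
    have \<tau>: "0 < \<tau>" "real n * \<tau> = T" using n T by (auto simp: \<tau>_def)
    have grid: "real j * \<tau> \<in> {0..T}" if "j \<le> n" for j
      using \<tau> mult_right_mono[of "real j" "real n" \<tau>] that by auto
    have pH: "p t \<in> H1_net G len" and mL: "m t \<in> L2_net G len" if "t \<in> {0..T}" for t
      using hyp that unfolding hyperbolic_solution_def by blast+
    have ini: "ae_eq G len (p 0) p_init" "ae_eq G len (m 0) m_init"
      using hyp unfolding hyperbolic_solution_def by blast+
    have "\<exists>p' m'. (\<forall>t\<in>{0..T}. p' t \<in> L2_net G len \<and> m' t \<in> L2_net G len) \<and>
        has_L2_time_deriv G len T p p' \<and> continuous_L2 G len T p' \<and>
        has_L2_time_deriv G len T m m' \<and> continuous_L2 G len T m' \<and>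
        (\<forall>t\<in>{0..T}.
           (\<forall>q\<in>H1_net G len.
              inner_L2 G len (p' t) q + inner_L2 G len (\<lambda>e x. a e x * p t e x) q
                - K_adj G len (m t) q + eval_adj G len VD (lam t) q
              = inner_L2 G len (g t) q - eval_adj G len (verts G - VD) (r t) q) \<and>
           (\<forall>w\<in>L2_net G len.
              \<epsilon> * inner_L2 G len (m' t) w + K_op G len (p t) w
                + inner_L2 G len (\<lambda>e x. d e x * m t e x) w
              = inner_L2 G len (f t) w) \<and>
           (\<forall>v\<in>VD. vertex_val G len (p t) v = h t v))"
      using hyp unfolding hyperbolic_solution_def by (elim conjE) assumption
    then obtain p' m' where L: "\<forall>t\<in>{0..T}. p' t \<in> L2_net G len \<and> m' t \<in> L2_net G len"
      and dp: "has_L2_time_deriv G len T p p'" and dm: "has_L2_time_deriv G len T m m'"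
      and cm: "continuous_L2 G len T m'"
      and eqs: "\<forall>t\<in>{0..T}.
           (\<forall>q\<in>H1_net G len.
              inner_L2 G len (p' t) q + inner_L2 G len (\<lambda>e x. a e x * p t e x) q
                - K_adj G len (m t) q + eval_adj G len VD (lam t) q
              = inner_L2 G len (g t) q - eval_adj G len (verts G - VD) (r t) q) \<and>
           (\<forall>w\<in>L2_net G len.
              \<epsilon> * inner_L2 G len (m' t) w + K_op G len (p t) w
                + inner_L2 G len (\<lambda>e x. d e x * m t e x) w
              = inner_L2 G len (f t) w) \<and>
           (\<forall>v\<in>VD. vertex_val G len (p t) v = h t v)"
      by (elim exE conjE)
    have p'L: "p' t \<in> L2_net G len" and m'L: "m' t \<in> L2_net G len" if "t \<in> {0..T}" for t
      using bspec[OF L that] by blast+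
    note eq1 = bspec[OF conjunct1[OF bspec[OF eqs]]]
      and eq2 = bspec[OF conjunct1[OF conjunct2[OF bspec[OF eqs]]]]
      and eq3 = bspec[OF conjunct2[OF conjunct2[OF bspec[OF eqs]]]]

    \<comment> \<open>The hyperbolic solution in abstract form\<close>
    have H: "es.hyperbolic_inhom T \<epsilon> (\<lambda>t. emb (f t)) (\<lambda>t. emb (g t)) \<rho> \<sigma> b bx
        (\<lambda>t. emb (p t)) (\<lambda>t. emb (dx len (p t))) (\<lambda>t. emb (m t)) (\<lambda>t. emb (p' t)) (\<lambda>t. emb (m' t))"
      unfolding es.hyperbolic_inhom_def
    proof (intro conjI ballI allI impI)
      show "continuous_on {0..T} (\<lambda>t. emb (m' t))" by (rule emb_continuous_on[OF m'L cm])
      fix t assume t: "t \<in> {0..T}"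
      show "((\<lambda>t. emb (p t)) has_vector_derivative emb (p' t)) (at t within {0..T})"
        by (rule emb_has_vector_derivative[OF _ p'L dp t]) (intro H1_subset_L2 pH)
      show "((\<lambda>t. emb (m t)) has_vector_derivative emb (m' t)) (at t within {0..T})"
        by (rule emb_has_vector_derivative[OF mL m'L dm t])
      \<comment> \<open>Subtracting the lifting of \<open>h t\<close> makes the values at
        \<open>VD\<close> vanish; its class is \<open>b t\<close>, and that of its derivative is
        \<open>bx t\<close>.\<close>
      have "(emb (\<lambda>e x. p t e x - lift (h t) e x), emb (dx len (\<lambda>e x. p t e x - lift (h t) e x))) \<in> V0"
      proof (rule V0_I[OF H1_diff[OF pH[OF t] liftH]])
        fix v assume v: "v \<in> VD"
        then show "vertex_val G len (\<lambda>e x. p t e x - lift (h t) e x) v = 0"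
          using vertex_val_diff[OF arcs _ pH[OF t] liftH, of v "h t"] VD_subset eq3[OF t v] lift_v[OF v] by auto
      qed
      then show "(emb (p t) - b t, emb (dx len (p t)) - bx t) \<in> V0"
        using pH[OF t] liftH
        by (simp add: emb_diff emb_dx_diff H1_subset_L2 emb_lift emb_dx_lift b_def bx_def)
      show "emb (p' t) \<bullet> q + A (emb (p t)) \<bullet> q - emb (m t) \<bullet> qx = emb (g t) \<bullet> q - (\<rho> t \<bullet> qx + \<sigma> t \<bullet> q)"
        if V: "(q, qx) \<in> V0" for q qx
      proof -
        obtain q' where q': "q' \<in> H1_net G len" "q = emb q'" "qx = emb (dx len q')"
          "\<And>v. v \<in> VD \<Longrightarrow> vertex_val G len q' v = 0"
          using V0_E[OF V] by metis
        note pL = H1_subset_L2[OF pH[OF t]]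
        show ?thesis
          using eq1[OF t q'(1)] q'(1)
          by (simp add: q'(2,3) eval0[OF q'(4)] eval K mL[OF t] Aemb[OF pL] inner_emb aL[OF pL] p'L[OF t]
              gL[OF t] H1_subset_L2)
      qed
      show "\<epsilon> *\<^sub>R emb (m' t) + emb (dx len (p t)) + D (emb (m t)) = emb (f t)"
      proof -
        let ?u = "\<lambda>e x. (\<epsilon> * m' t e x + dx len (p t) e x) + d e x * m t e x"
        have 1: "(\<lambda>e x. \<epsilon> * m' t e x) \<in> L2_net G len" by (intro L2_net_cmult m'L t)
        have 2: "dx len (p t) \<in> L2_net G len" by (intro dx_L2 pH t)
        have 3: "(\<lambda>e x. d e x * m t e x) \<in> L2_net G len" by (intro dL mL t)
        have 12: "(\<lambda>e x. \<epsilon> * m' t e x + dx len (p t) e x) \<in> L2_net G len" by (rule L2_net_add[OF 1 2])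
        have eu: "emb ?u = \<epsilon> *\<^sub>R emb (m' t) + emb (dx len (p t)) + D (emb (m t))"
          using emb_add[OF 12 3] emb_add[OF 1 2] emb_cmult[OF m'L[OF t], of \<epsilon>] Demb[OF mL[OF t]] by simp
        have "emb ?u = emb (f t)"
        proof (rule emb_eqI_inner[OF L2_net_add[OF 12 3] fL[OF t]])
          fix z assume z: "z \<in> L2_net G len"
          have "inner_L2 G len ?u z = emb ?u \<bullet> emb z" by (simp add: inner_emb L2_net_add[OF 12 3] z)
          also have "\<dots> = \<epsilon> * inner_L2 G len (m' t) z + K_op G len (p t) z + inner_L2 G len (\<lambda>e x. d e x * m t e x) z"
            unfolding eu Demb[OF mL[OF t]] K_op_def
            by (simp add: inner_add_left inner_emb m'L[OF t] 2 3 z)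
          also have "\<dots> = inner_L2 G len (f t) z" by (rule eq2[OF t z])
          finally show "inner_L2 G len ?u z = inner_L2 G len (f t) z" .
        qed
        then show ?thesis using eu by simp
      qed
    qed

    \<comment> \<open>The Euler scheme in abstract form\<close>
    have PH0: "P 0 \<in> H1_net G len" "ae_eq G len (P 0) p_init"
      using eu unfolding euler_scheme_def Let_def by blast+
    have PH: "P j \<in> H1_net G len" if "j \<le> n" for j
      using eu PH0(1) that unfolding euler_scheme_def Let_def by (cases "j = 0") auto
    have QL: "Q j \<in> L2_net G len"
      and eu1: "\<And>q. q \<in> H1_net G len \<Longrightarrow>
              inner_L2 G len (diff_quot \<tau> P j) q + inner_L2 G len (\<lambda>e x. a e x * P j e x) q
                - K_adj G len (Q j) q + eval_adj G len VD (Lam j) q + eval_adj G len VD (Mu j) q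
              = inner_L2 G len (g (real j * \<tau>)) q - eval_adj G len (verts G - VD) (r (real j * \<tau>)) q"
      and eu2: "\<And>w. w \<in> L2_net G len \<Longrightarrow>
              K_op G len (P j) w + inner_L2 G len (\<lambda>e x. d e x * Q j e x) w
              = inner_L2 G len (f (real j * \<tau>)) w"
      and eu4: "\<And>v. v \<in> VD \<Longrightarrow> vertex_val G len (diff_quot \<tau> P j) v = vec_deriv T h (real j * \<tau>) v"
      if "j \<in> {1..n}" for j
      using eu that unfolding euler_scheme_def Let_def \<tau>_def[symmetric] by blast+
    have dq: "diff_quot \<tau> P j = (\<lambda>e x. (1 / \<tau>) * P j e x + (- 1 / \<tau>) * P (j - 1) e x)" for j
      by (simp add: diff_quot_def fun_eq_iff diff_divide_distrib)
    \<comment> \<open>The boundary values of the scheme, found by summing the prescribed increments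
      from \<open>h 0\<close>.\<close>
    define Bv where "Bv j v = h 0 v + \<tau> * (\<Sum>i=1..j. vec_deriv T h (real i * \<tau>) v)" for j v
    have Pv: "vertex_val G len (P j) v = Bv j v" if v: "v \<in> VD" and "j \<le> n" for j v
      using \<open>j \<le> n\<close>
    proof (induction j)
      case 0
      \<comment> \<open>\<open>P 0\<close> agrees with the initial value only almost everywhere; by
        continuity the end point values coincide too.\<close>
      have vG: "v \<in> verts G" using v VD_subset by auto
      obtain e where e: "e \<in> arcs G" "tail G e = v \<or> head G e = v" using incident_arc[OF arcs vG] .
      have "0 \<in> {0..len e}" "len e \<in> {0..len e}" using len_pos[OF e(1)] by auto
      then have "vertex_val G len (P 0) v = vertex_val G len p_init v"
        using vertex_val_eq[OF PH0(1) e(1)] vertex_val_eq[OF p_init(1) e(1)] e(2)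
          H1_ae_eq_imp_eq[OF PH0(1) p_init(1) PH0(2) e(1)] by metis
      then show ?case using p_init(2)[OF v] by (simp add: Bv_def)
    next
      case (Suc j)
      have "(1 / \<tau>) * vertex_val G len (P (Suc j)) v + (- 1 / \<tau>) * vertex_val G len (P j) v
          = vec_deriv T h (real (Suc j) * \<tau>) v"
        using eu4[of "Suc j" v] vertex_val_lincomb[OF arcs _ PH PH, of v "Suc j" j "1 / \<tau>" "- 1 / \<tau>"]
          Suc.prems v VD_subset by (auto simp: dq)
      then have "vertex_val G len (P (Suc j)) v = vertex_val G len (P j) v + \<tau> * vec_deriv T h (real (Suc j) * \<tau>) v"
        using \<tau> by (simp add: field_simps)
      then show ?case using Suc by (simp add: Bv_def algebra_simps)
    qed
    have E: "es.euler_inhom T n (\<lambda>t. emb (f t)) (\<lambda>t. emb (g t)) \<rho> \<sigma> (b 0) (bx 0) b' bx'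
        (\<lambda>j. emb (P j)) (\<lambda>j. emb (dx len (P j))) (\<lambda>j. emb (Q j))"
      unfolding es.euler_inhom_def Let_def \<tau>_def[symmetric]
    proof (intro conjI ballI allI impI)
      fix j assume j: "j \<in> {1..n}"
      then have jn: "j \<le> n" "j - 1 \<le> n" by auto
      have tj: "real j * \<tau> \<in> {0..T}" by (rule grid[OF jn(1)])
      have "(emb (\<lambda>e x. P j e x - lift (Bv j) e x), emb (dx len (\<lambda>e x. P j e x - lift (Bv j) e x))) \<in> V0"
      proof (rule V0_I[OF H1_diff[OF PH[OF jn(1)] liftH]])
        fix v assume v: "v \<in> VD"
        then show "vertex_val G len (\<lambda>e x. P j e x - lift (Bv j) e x) v = 0"
          using vertex_val_diff[OF arcs _ PH[OF jn(1)] liftH, of v "Bv j"] VD_subset Pv[OF v jn(1)] lift_v[OF v] by auto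
      qed
      moreover have sumB: "(\<Sum>v\<in>VD. Bv j v *\<^sub>R c v)
          = (\<Sum>v\<in>VD. h 0 v *\<^sub>R c v) + \<tau> *\<^sub>R (\<Sum>i=1..j. \<Sum>v\<in>VD. vec_deriv T h (real i * \<tau>) v *\<^sub>R c v)"
        for c :: "'v \<Rightarrow> 'e l2"
        unfolding sum.swap[of _ VD] Bv_def
        by (simp add: scaleR_add_left sum.distrib scaleR_sum_right scaleR_sum_left sum_distrib_left)
      ultimately show "(emb (P j) - (b 0 + \<tau> *\<^sub>R (\<Sum>i=1..j. b' (real i * \<tau>))),
          emb (dx len (P j)) - (bx 0 + \<tau> *\<^sub>R (\<Sum>i=1..j. bx' (real i * \<tau>)))) \<in> V0"
        using PH[OF jn(1)] liftH
        by (simp add: emb_diff emb_dx_diff H1_subset_L2 emb_lift emb_dx_lift sumB b_def bx_def b'_def bx'_def)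
      show "(1 / \<tau>) *\<^sub>R (emb (P j) - emb (P (j - 1))) \<bullet> q + A (emb (P j)) \<bullet> q - emb (Q j) \<bullet> qx
          = emb (g (real j * \<tau>)) \<bullet> q - (\<rho> (real j * \<tau>) \<bullet> qx + \<sigma> (real j * \<tau>) \<bullet> q)"
        if V: "(q, qx) \<in> V0" for q qx
      proof -
        obtain q' where q': "q' \<in> H1_net G len" "q = emb q'" "qx = emb (dx len q')"
          "\<And>v. v \<in> VD \<Longrightarrow> vertex_val G len q' v = 0"
          using V0_E[OF V] by metis
        note PL = H1_subset_L2[OF PH[OF jn(1)]]
        have "emb (diff_quot \<tau> P j) = (1 / \<tau>) *\<^sub>R (emb (P j) - emb (P (j - 1)))"
          unfolding dq using emb_lincomb[OF PL H1_subset_L2[OF PH[OF jn(2)]], of "1 / \<tau>" "- 1 / \<tau>"]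
          by (simp add: scaleR_diff_right)
        moreover have dL: "diff_quot \<tau> P j \<in> L2_net G len"
          unfolding dq by (intro H1_subset_L2 H1_lincomb PH jn)
        ultimately show ?thesis
          using eu1[OF j q'(1)] q'(1)
          by (simp add: q'(2,3) eval0[OF q'(4)] eval K QL[OF j] Aemb[OF PL] inner_emb[symmetric] aL[OF PL]
              gL[OF tj] H1_subset_L2)
      qed
      show "emb (dx len (P j)) + D (emb (Q j)) = emb (f (real j * \<tau>))"
      proof -
        let ?u = "\<lambda>e x. dx len (P j) e x + d e x * Q j e x"
        have 2: "dx len (P j) \<in> L2_net G len" by (intro dx_L2 PH jn)
        have 3: "(\<lambda>e x. d e x * Q j e x) \<in> L2_net G len" by (intro dL QL j)
        have eu: "emb ?u = emb (dx len (P j)) + D (emb (Q j))"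
          using emb_add[OF 2 3] Demb[OF QL[OF j]] by simp
        have "emb ?u = emb (f (real j * \<tau>))"
        proof (rule emb_eqI_inner[OF L2_net_add[OF 2 3] fL[OF tj]])
          fix z assume z: "z \<in> L2_net G len"
          have "inner_L2 G len ?u z = emb ?u \<bullet> emb z" by (simp add: inner_emb L2_net_add[OF 2 3] z)
          also have "\<dots> = K_op G len (P j) z + inner_L2 G len (\<lambda>e x. d e x * Q j e x) z"
            unfolding eu Demb[OF QL[OF j]] K_op_def by (simp add: inner_add_left inner_emb 2 3 z)
          also have "\<dots> = inner_L2 G len (f (real j * \<tau>)) z" by (rule eu2[OF j z])
          finally show "inner_L2 G len ?u z = inner_L2 G len (f (real j * \<tau>)) z" .
        qed
        then show ?thesis using eu by simp
      qed
    qed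

    \<comment> \<open>Translation of the abstract estimate into the three norms\<close>
    have T0: "0 \<in> {0..T}" using T by simp
    have i1: "emb (p 0) = emb p_init" "emb (dx len (p 0)) = emb (dx len p_init)" "emb (m 0) = emb m_init"
      "emb (P 0) = emb p_init" "emb (dx len (P 0)) = emb (dx len p_init)"
      using ini PH0 p_init(1) pH[OF T0] mL[OF T0] m_init
      by (simp_all add: emb_eq_iff H1_subset_L2 emb_dx_cong)
    from C[OF \<epsilon> n H i1 E] obtain B where
      err: "\<And>j t. j \<in> {1..n} \<Longrightarrow> t \<in> cell \<tau> j \<Longrightarrow>
         (norm (emb (p t) - (emb (P j) - ((real j * \<tau> - t) / \<tau>) *\<^sub>R (emb (P j) - emb (P (j - 1))))))\<^sup>2 \<le> C * (\<tau>\<^sup>2 + \<epsilon>\<^sup>2)"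
      and Bc: "\<And>j. j \<in> {1..n} \<Longrightarrow> continuous_on (cell \<tau> j) (B j)"
      and Bb: "\<And>j t. j \<in> {1..n} \<Longrightarrow> t \<in> cell \<tau> j \<Longrightarrow>
            (norm (emb (p t) - emb (P j)))\<^sup>2 + (norm (emb (dx len (p t)) - emb (dx len (P j))))\<^sup>2
              + (norm (emb (m t) - emb (Q j)))\<^sup>2 \<le> B j t"
      and Bi: "(\<Sum>j=1..n. integral (cell \<tau> j) (B j)) \<le> C * (\<tau>\<^sup>2 + \<epsilon>\<^sup>2)"
      unfolding error_estimate_def Let_def \<tau>_def[symmetric] by blast
    have sub: "t \<in> {0..T}" if "j \<in> {1..n}" "t \<in> cell \<tau> j" for j t
    proof -
      have "0 \<le> real (j - 1) * \<tau>" "real j * \<tau> \<le> T" using grid[of j] grid[of "j - 1"] that by auto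
      then show ?thesis using that by auto
    qed
    have sq: "sqrt (C * (\<tau>\<^sup>2 + \<epsilon>\<^sup>2)) \<le> sqrt C * (\<epsilon> + \<tau>)"
    proof -
      have "\<tau>\<^sup>2 + \<epsilon>\<^sup>2 \<le> (\<epsilon> + \<tau>)\<^sup>2" using \<epsilon> \<tau> by (simp add: power2_sum)
      then have "sqrt (\<tau>\<^sup>2 + \<epsilon>\<^sup>2) \<le> \<epsilon> + \<tau>" using \<epsilon> \<tau> by (intro real_le_lsqrt) auto
      then show ?thesis using C0 by (simp add: real_sqrt_mult mult_left_mono)
    qed
    have n1: "norm_L2_time T (norm_H1 G len) (\<lambda>t e x. p t e x - pw_const \<tau> P t e x) \<le> sqrt C * (\<epsilon> + \<tau>)"
    proof -
      have "(LINT t|lebesgue_on {0..T}. (norm_H1 G len (\<lambda>e x. p t e x - pw_const \<tau> P t e x))\<^sup>2)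
          \<le> (\<Sum>j=1..n. integral (cell \<tau> j) (B j))"
      proof (rule LINT_le_sum_integral_grid[OF n T \<tau>_def Bc])
        fix j t assume j: "j \<in> {1..n}" and t: "t \<in> {real (j - 1) * \<tau><..real j * \<tau>}"
        have t': "t \<in> cell \<tau> j" using t by auto
        have pt: "p t \<in> H1_net G len" by (rule pH[OF sub[OF j t']])
        have pj: "P j \<in> H1_net G len" using PH j by simp
        have "(norm_H1 G len (\<lambda>e x. p t e x - pw_const \<tau> P t e x))\<^sup>2
            = (norm (emb (p t) - emb (P j)))\<^sup>2 + (norm (emb (dx len (p t)) - emb (dx len (P j))))\<^sup>2"
          unfolding pw_const_eq[OF \<tau>(1) j t]
          using pt pj by (simp add: norm_H1_emb H1_diff emb_diff emb_dx_diff H1_subset_L2)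
        also have "\<dots> \<le> B j t" using Bb[OF j t'] zero_le_power2[of "norm (emb (m t) - emb (Q j))"] by linarith
        finally show "(norm_H1 G len (\<lambda>e x. p t e x - pw_const \<tau> P t e x))\<^sup>2 \<le> B j t" .
      qed auto
      then show ?thesis
        unfolding norm_L2_time_def using Bi sq real_sqrt_le_mono by (meson order_trans)
    qed
    have n2: "norm_L2_time T (norm_L2 G len) (\<lambda>t e x. m t e x - pw_const \<tau> Q t e x) \<le> sqrt C * (\<epsilon> + \<tau>)"
    proof -
      have "(LINT t|lebesgue_on {0..T}. (norm_L2 G len (\<lambda>e x. m t e x - pw_const \<tau> Q t e x))\<^sup>2)
          \<le> (\<Sum>j=1..n. integral (cell \<tau> j) (B j))"
      proof (rule LINT_le_sum_integral_grid[OF n T \<tau>_def Bc])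
        fix j t assume j: "j \<in> {1..n}" and t: "t \<in> {real (j - 1) * \<tau><..real j * \<tau>}"
        have t': "t \<in> cell \<tau> j" using t by auto
        have "(norm_L2 G len (\<lambda>e x. m t e x - pw_const \<tau> Q t e x))\<^sup>2 = (norm (emb (m t) - emb (Q j)))\<^sup>2"
          unfolding pw_const_eq[OF \<tau>(1) j t]
          using mL[OF sub[OF j t']] QL[OF j] by (simp add: norm_emb[symmetric] L2_net_diff emb_diff)
        also have "\<dots> \<le> B j t"
          using Bb[OF j t'] zero_le_power2[of "norm (emb (p t) - emb (P j))"]
            zero_le_power2[of "norm (emb (dx len (p t)) - emb (dx len (P j)))"] by linarith
        finally show "(norm_L2 G len (\<lambda>e x. m t e x - pw_const \<tau> Q t e x))\<^sup>2 \<le> B j t" .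
      qed auto
      then show ?thesis
        unfolding norm_L2_time_def using Bi sq real_sqrt_le_mono by (meson order_trans)
    qed
    have n3: "norm_sup_time T (norm_L2 G len) (\<lambda>t e x. p t e x - pw_linear \<tau> P t e x) \<le> sqrt C * (\<epsilon> + \<tau>)"
      unfolding norm_sup_time_def
    proof (rule cSUP_least)
      show "{0..T} \<noteq> {}" using T by simp
      fix t assume t: "t \<in> {0..T}"
      obtain j where j: "j \<in> {1..n}" "t \<in> cell \<tau> j"
        and pl: "pw_linear \<tau> P t = (\<lambda>e x. P j e x - (real j * \<tau> - t) / \<tau> * (P j e x - P (j - 1) e x))"
        using pw_linear_eq[OF n T \<tau>_def t, of P] .
      have L: "P j \<in> L2_net G len" "P (j - 1) \<in> L2_net G len" "p t \<in> L2_net G len"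
        using j PH pH[OF t] by (auto intro!: H1_subset_L2)
      define \<theta> where "\<theta> = (real j * \<tau> - t) / \<tau>"
      have "emb (\<lambda>e x. p t e x - (P j e x - \<theta> * (P j e x - P (j - 1) e x)))
          = emb (p t) - (emb (P j) - \<theta> *\<^sub>R (emb (P j) - emb (P (j - 1))))"
        using emb_diff[OF L(3) L2_net_diff[OF L(1) L2_net_cmult[OF L2_net_diff[OF L(1,2)], of \<theta>]]]
          emb_diff[OF L(1) L2_net_cmult[OF L2_net_diff[OF L(1,2)], of \<theta>]]
          emb_cmult[OF L2_net_diff[OF L(1,2)], of \<theta>] emb_diff[OF L(1,2)] by (simp only:)
      moreover have "(\<lambda>e x. p t e x - (P j e x - \<theta> * (P j e x - P (j - 1) e x))) \<in> L2_net G len"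
        by (intro L2_net_diff L2_net_cmult L)
      ultimately have "(norm_L2 G len (\<lambda>e x. p t e x - pw_linear \<tau> P t e x))\<^sup>2 \<le> C * (\<tau>\<^sup>2 + \<epsilon>\<^sup>2)"
        using err[OF j] unfolding pl \<theta>_def[symmetric] by (simp add: norm_emb[symmetric])
      then have "norm_L2 G len (\<lambda>e x. p t e x - pw_linear \<tau> P t e x) \<le> sqrt (C * (\<tau>\<^sup>2 + \<epsilon>\<^sup>2))"
        by (rule real_le_rsqrt)
      then show "norm_L2 G len (\<lambda>e x. p t e x - pw_linear \<tau> P t e x) \<le> sqrt C * (\<epsilon> + \<tau>)"
        using sq by linarith
    qed
    show "let \<tau> = T / real n in
       norm_L2_time T (norm_H1 G len) (\<lambda>t e x. p t e x - pw_const \<tau> P t e x)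
       + norm_L2_time T (norm_L2 G len) (\<lambda>t e x. m t e x - pw_const \<tau> Q t e x)
       + norm_sup_time T (norm_L2 G len) (\<lambda>t e x. p t e x - pw_linear \<tau> P t e x)
       \<le> (\<epsilon> + \<tau>) * (3 * sqrt C)"
      unfolding Let_def \<tau>_def[symmetric] using n1 n2 n3 by (simp add: algebra_simps)
  qed
qed

end
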